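(* Let $\Omega\subset\mathbb{R}^m$ be a bounded domain with infinitely smooth boundary and let $\widehat{L}$ be the maximal operator generated by the Laplace operator $-\Delta$ in $L_2(\Omega)$. Let $L$ be a well-defined restriction of $\widehat{L}$ such that $L^{-1}$ is a non-negative compact operator with $\lim_{n\to\infty}n^2s_n(L^{-1})=\infty$ and, for some real numbers $\alpha$ and $a$ with $0<\alpha<2$ and $0<a<\infty$, $\lim_{n\to\infty}n^{\alpha}s_n(L^{-1})=a$. Let $K$ be a bounded linear operator in $L_2(\Omega)$ with $R(K)\subset\mathrm{Ker}\,\widehat{L}$ and $K\in\mathfrak{S}_q(L_2(\Omega))$ for all $q$ with $0<q\le\frac1\alpha$, and let $L_K$ be the well-defined restriction of $\widehat{L}$ with inverse $$L_K^{-1}f=L^{-1}f+Kf,\quad f\in L_2(\Omega).$$ Then $L_K^{-1}$ is not a Volterra operator, i.e. $L_K$ is a non-Volterra well-defined restriction of the maximal operator $\widehat{L}$.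
   Context: $L_2(\Omega)$ is the complex Hilbert space of square-integrable functions. $R(\cdot)$ and $\mathrm{Ker}$ denote range and kernel, $D(\cdot)$ domain. The minimal operator $L_0$ is the closure in $L_2(\Omega)$ of $-\Delta$ with domain $C_0^\infty(\Omega)$; the maximal operator $\widehat{L}$ is the adjoint of $L_0$, i.e. $\widehat{L}u=-\Delta u$ with $D(\widehat{L})=\{u\in L_2(\Omega):\ \Delta u\in L_2(\Omega)\}$. A closed linear operator $L$ in a Hilbert space is called well defined if it has a bounded inverse $L^{-1}$ defined on the whole space; a well-defined restriction of $\widehat{L}$ is a well-defined operator $L$ with $L\subset\widehat{L}$ (i.e. $D(L)\subset D(\widehat{L})$ and $Lf=\widehat{L}f$ on $D(L)$). The domain of $L_K$ is $D(L_K)=\{u\in D(\widehat{L}):\ (I-K\widehat{L})u\in D(L)\}$. For a compact operator $T$, the $s$-numbers $s_n(T)$, $n=1,2,\dots$, are the eigenvalues of $(T^*T)^{1/2}$, counted with multiplicity, in non-increasing order; for $0<p<\infty$, $\mathfrak{S}_p(H)$ is the set of compact operators $T$ in $H$ with $\sum_j s_j^p(T)<\infty$. A non-negative operator is a self-adjoint operator $C$ with $(Cf,f)\ge0$ for all $f$. A Volterra operator is a compact operator whose spectrum is $\{0\}$; a well-defined operator $L$ is called Volterra if $L^{-1}$ is a Volterra operator. *)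

theory Defs
  imports "HOL-Analysis.Analysis" "HOL-Library.Nonpos_Ints"
begin

section \<open>Complex inner product spaces\<close>

text \<open>The inner product is linear in its first argument.\<close>

class complex_inner = real_inner +
  fixes scaleC :: "complex \<Rightarrow> 'a \<Rightarrow> 'a" (infixr \<open>*\<^sub>C\<close> 75)
    and cinner :: "'a \<Rightarrow> 'a \<Rightarrow> complex"
  assumes scaleC_add_right: "c *\<^sub>C (x + y) = c *\<^sub>C x + c *\<^sub>C y"
    and scaleC_add_left: "(c + d) *\<^sub>C x = c *\<^sub>C x + d *\<^sub>C x"
    and scaleC_scaleC: "c *\<^sub>C d *\<^sub>C x = (c * d) *\<^sub>C x"
    and scaleR_conv_scaleC: "r *\<^sub>R x = complex_of_real r *\<^sub>C x"
    and cinner_commute: "cinner x y = cnj (cinner y x)"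
    and cinner_add_left: "cinner (x + y) z = cinner x z + cinner y z"
    and cinner_scaleC_left: "cinner (c *\<^sub>C x) y = c * cinner x y"
    and inner_conv_cinner: "inner x y = Re (cinner x y)"

section \<open>Square-integrable functions\<close>

definition square_integrable :: "('a::euclidean_space \<Rightarrow> complex) \<Rightarrow> bool" where
  "square_integrable f \<longleftrightarrow>
     f \<in> borel_measurable lborel \<and> integrable lborel (\<lambda>x. (cmod (f x))\<^sup>2)"

lemma square_integrable_mult_cnj:
  assumes "square_integrable f" "square_integrable g"
  shows "integrable lborel (\<lambda>x. f x * cnj (g x))"
proof (rule Bochner_Integration.integrable_bound)
  have f_meas: "f \<in> borel_measurable lborel" and g_meas: "g \<in> borel_measurable lborel"
    using assms by (simp_all add: square_integrable_def)
  have cnj_meas: "(\<lambda>x. cnj (g x)) \<in> borel_measurable lborel"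
    by (rule borel_measurable_continuous_on[OF _ g_meas]) (intro continuous_intros)
  show "integrable lborel (\<lambda>x. (cmod (f x))\<^sup>2 + (cmod (g x))\<^sup>2)"
    using assms by (auto simp: square_integrable_def)
  show "(\<lambda>x. f x * cnj (g x)) \<in> borel_measurable lborel"
    using borel_measurable_times[OF f_meas cnj_meas] .
  have "cmod (f x * cnj (g x)) \<le> (cmod (f x))\<^sup>2 + (cmod (g x))\<^sup>2" for x
  proof -
    have "0 \<le> cmod (f x) * cmod (g x)" by simp
    then have "cmod (f x) * cmod (g x) \<le> 2 * cmod (f x) * cmod (g x)" by linarith
    also have "\<dots> \<le> (cmod (f x))\<^sup>2 + (cmod (g x))\<^sup>2" by (rule sum_squares_bound)
    finally show ?thesis by (simp add: norm_mult)
  qed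
  then show "AE x in lborel. norm (f x * cnj (g x))
      \<le> norm ((cmod (f x))\<^sup>2 + (cmod (g x))\<^sup>2)"
    by simp
qed

lemma square_integrable_zero: "square_integrable (\<lambda>x. 0)"
  by (simp add: square_integrable_def)

lemma square_integrable_mult:
  assumes "square_integrable f"
  shows "square_integrable (\<lambda>x. c * f x)"
  using assms by (auto simp: square_integrable_def norm_mult power_mult_distrib)

lemma square_integrable_add:
  assumes "square_integrable f" "square_integrable g"
  shows "square_integrable (\<lambda>x. f x + g x)"
proof -
  have "integrable lborel (\<lambda>x. (cmod (f x + g x))\<^sup>2)"
  proof (rule Bochner_Integration.integrable_bound)
    show "integrable lborel (\<lambda>x. 2 * (cmod (f x))\<^sup>2 + 2 * (cmod (g x))\<^sup>2)"
      using assms by (auto simp: square_integrable_def)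
    show "(\<lambda>x. (cmod (f x + g x))\<^sup>2) \<in> borel_measurable lborel"
      using assms unfolding square_integrable_def
      by (intro borel_measurable_power borel_measurable_norm borel_measurable_add) auto
    have "(cmod (f x + g x))\<^sup>2 \<le> 2 * (cmod (f x))\<^sup>2 + 2 * (cmod (g x))\<^sup>2" for x
    proof -
      have "(cmod (f x + g x))\<^sup>2 \<le> (cmod (f x) + cmod (g x))\<^sup>2"
        by (intro power_mono norm_triangle_ineq norm_ge_zero)
      also have "\<dots> \<le> 2 * (cmod (f x))\<^sup>2 + 2 * (cmod (g x))\<^sup>2"
        using sum_squares_bound[of "cmod (f x)" "cmod (g x)"] by (simp add: power2_sum)
      finally show ?thesis .
    qed
    then show "AE x in lborel. norm ((cmod (f x + g x))\<^sup>2)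
        \<le> norm (2 * (cmod (f x))\<^sup>2 + 2 * (cmod (g x))\<^sup>2)"
      by simp
  qed
  then show ?thesis
    using assms by (auto simp: square_integrable_def)
qed

definition L2_eq :: "('a::euclidean_space \<Rightarrow> complex) \<Rightarrow> ('a \<Rightarrow> complex) \<Rightarrow> bool" where
  "L2_eq f g \<longleftrightarrow>
     square_integrable f \<and> square_integrable g \<and> (AE x in lborel. f x = g x)"

lemma part_equivp_L2_eq: "part_equivp L2_eq"
proof (rule part_equivpI)
  show "\<exists>f. L2_eq f f"
    using square_integrable_zero by (auto simp: L2_eq_def)
  show "symp L2_eq"
    by (auto simp: symp_def L2_eq_def elim: eventually_mono)
  show "transp L2_eq"
    unfolding transp_def L2_eq_def by (auto elim: eventually_elim2)
qed

text \<open>Square-integrable functions on the whole space modulo equality almost everywhere.\<close>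

quotient_type (overloaded) 'a L2 = "'a::euclidean_space \<Rightarrow> complex" / partial: L2_eq
  by (rule part_equivp_L2_eq)

instantiation L2 :: (euclidean_space) complex_inner
begin

lift_definition zero_L2 :: "'a L2" is "\<lambda>x. 0"
  by (simp add: L2_eq_def square_integrable_zero)

lift_definition plus_L2 :: "'a L2 \<Rightarrow> 'a L2 \<Rightarrow> 'a L2" is "\<lambda>f g x. f x + g x"
  by (auto simp: L2_eq_def square_integrable_add elim: eventually_elim2)

lift_definition scaleC_L2 :: "complex \<Rightarrow> 'a L2 \<Rightarrow> 'a L2" is "\<lambda>c f x. c * f x"
  by (auto simp: L2_eq_def square_integrable_mult elim: eventually_mono)

lift_definition cinner_L2 :: "'a L2 \<Rightarrow> 'a L2 \<Rightarrow> complex"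
  is "\<lambda>f g. integral\<^sup>L lborel (\<lambda>x. f x * cnj (g x))"
proof -
  fix f f' g g' :: "'a \<Rightarrow> complex"
  assume *: "L2_eq f f'" "L2_eq g g'"
  show "integral\<^sup>L lborel (\<lambda>x. f x * cnj (g x)) = integral\<^sup>L lborel (\<lambda>x. f' x * cnj (g' x))"
  proof (rule integral_cong_AE)
    show "(\<lambda>x. f x * cnj (g x)) \<in> borel_measurable lborel"
      "(\<lambda>x. f' x * cnj (g' x)) \<in> borel_measurable lborel"
      using * by (simp_all only: L2_eq_def borel_measurable_integrable square_integrable_mult_cnj)
    show "AE x in lborel. f x * cnj (g x) = f' x * cnj (g' x)"
      using * by (auto simp: L2_eq_def elim: eventually_elim2)
  qed
qed

definition uminus_L2 :: "'a L2 \<Rightarrow> 'a L2" where "uminus_L2 u = (-1) *\<^sub>C u"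
definition minus_L2 :: "'a L2 \<Rightarrow> 'a L2 \<Rightarrow> 'a L2" where "minus_L2 u v = u + (-1) *\<^sub>C v"
definition scaleR_L2 :: "real \<Rightarrow> 'a L2 \<Rightarrow> 'a L2" where
  "scaleR_L2 r u = complex_of_real r *\<^sub>C u"
definition inner_L2 :: "'a L2 \<Rightarrow> 'a L2 \<Rightarrow> real" where "inner_L2 u v = Re (cinner u v)"
definition norm_L2 :: "'a L2 \<Rightarrow> real" where "norm_L2 u = sqrt (inner u u)"
definition dist_L2 :: "'a L2 \<Rightarrow> 'a L2 \<Rightarrow> real" where "dist_L2 u v = norm (u - v)"
definition sgn_L2 :: "'a L2 \<Rightarrow> 'a L2" where "sgn_L2 u = inverse (norm u) *\<^sub>R u"
definition uniformity_L2 :: "('a L2 \<times> 'a L2) filter" where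
  "uniformity_L2 = (INF e\<in>{0 <..}. principal {(u, v). dist u v < e})"
definition open_L2 :: "'a L2 set \<Rightarrow> bool" where
  "open_L2 U = (\<forall>u\<in>U. eventually (\<lambda>(u', v). u' = u \<longrightarrow> v \<in> U) uniformity)"

instance
proof
  fix u v w :: "'a L2" and r s :: real and c d :: complex
  have scaleC_add_r: "c *\<^sub>C (u + v) = c *\<^sub>C u + c *\<^sub>C v" for c and u v :: "'a L2"
    by transfer (simp add: L2_eq_def square_integrable_add square_integrable_mult algebra_simps)
  have scaleC_add_l: "(c + d) *\<^sub>C u = c *\<^sub>C u + d *\<^sub>C u" for c d and u :: "'a L2"
    by transfer (simp add: L2_eq_def square_integrable_add square_integrable_mult algebra_simps)
  have scaleC_scaleC: "c *\<^sub>C d *\<^sub>C u = (c * d) *\<^sub>C u" for c d and u :: "'a L2"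
    by transfer (simp add: L2_eq_def square_integrable_mult algebra_simps)
  have scaleC_one: "1 *\<^sub>C u = u" for u :: "'a L2"
    by transfer (simp add: L2_eq_def)
  have cinner_comm: "cinner u v = cnj (cinner v u)" for u v :: "'a L2"
  proof transfer
    fix f g :: "'a \<Rightarrow> complex"
    have "(LINT x|lborel. cnj (g x * cnj (f x))) = cnj (LINT x|lborel. g x * cnj (f x))"
      by (rule Bochner_Integration.integral_cnj)
    then show "(LINT x|lborel. f x * cnj (g x)) = cnj (LINT x|lborel. g x * cnj (f x))"
      by (simp add: mult.commute del: Bochner_Integration.integral_cnj)
  qed
  have cinner_add_l: "cinner (u + v) w = cinner u w + cinner v w" for u v w :: "'a L2"
    by transfer (simp add: L2_eq_def square_integrable_mult_cnj distrib_right)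
  have cinner_scaleC_l: "cinner (c *\<^sub>C u) v = c * cinner u v" for c and u v :: "'a L2"
    by transfer (simp add: mult.assoc)
  have norm_eq: "Re (cinner u u) = (LINT x|lborel. (cmod (f x))\<^sup>2)"
    if "L2_eq f f" "u = abs_L2 f" for f :: "'a \<Rightarrow> complex" and u
  proof -
    have "cinner u u = (LINT x|lborel. f x * cnj (f x))"
      using that by (simp add: cinner_L2.abs_eq)
    also have "\<dots> = (LINT x|lborel. complex_of_real ((cmod (f x))\<^sup>2))"
      by (simp only: complex_norm_square)
    also have "\<dots> = complex_of_real (LINT x|lborel. (cmod (f x))\<^sup>2)"
      by (rule integral_complex_of_real)
    finally show ?thesis by simp
  qed
  have ex_rep: "\<exists>f. L2_eq f f \<and> u = abs_L2 f" for u :: "'a L2"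
    using Quotient_abs_rep[OF Quotient_L2, of u] Quotient_rep_reflp[OF Quotient_L2, of u] by metis
  have inner_nonneg: "0 \<le> inner u u" for u :: "'a L2"
  proof -
    obtain f where "L2_eq f f" "u = abs_L2 f" using ex_rep by blast
    then show ?thesis by (simp add: inner_L2_def norm_eq)
  qed
  have zero_add: "0 + u = u" for u :: "'a L2"
    by transfer (simp add: L2_eq_def)
  have scaleC_zero: "0 *\<^sub>C u = 0" for u :: "'a L2"
    by transfer (simp add: L2_eq_def square_integrable_zero)
  show "u + v + w = u + (v + w)"
    by transfer (simp add: L2_eq_def square_integrable_add algebra_simps)
  show "u + v = v + u"
    by transfer (simp add: L2_eq_def square_integrable_add algebra_simps)
  show "0 + u = u" by (rule zero_add)
  show "- u + u = 0"
    using scaleC_add_l[of "-1" 1 u] by (simp add: uminus_L2_def scaleC_one scaleC_zero)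
  show "u - v = u + - v" by (simp add: uminus_L2_def minus_L2_def)
  show "r *\<^sub>R (u + v) = r *\<^sub>R u + r *\<^sub>R v" by (simp add: scaleR_L2_def scaleC_add_r)
  show "(r + s) *\<^sub>R u = r *\<^sub>R u + s *\<^sub>R u" by (simp add: scaleR_L2_def scaleC_add_l)
  show "r *\<^sub>R s *\<^sub>R u = (r * s) *\<^sub>R u" by (simp add: scaleR_L2_def scaleC_scaleC)
  show "1 *\<^sub>R u = u" by (simp add: scaleR_L2_def scaleC_one)
  show "dist u v = norm (u - v)" by (simp add: dist_L2_def)
  show "sgn u = inverse (norm u) *\<^sub>R u" by (simp add: sgn_L2_def)
  show "(uniformity :: ('a L2 \<times> 'a L2) filter) = (INF e\<in>{0 <..}. principal {(u, v). dist u v < e})"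
    by (simp add: uniformity_L2_def)
  show "open U = (\<forall>u\<in>U. eventually (\<lambda>(u', v). u' = u \<longrightarrow> v \<in> U) uniformity)" for U :: "'a L2 set"
    by (simp add: open_L2_def)
  show "inner u v = inner v u"
    unfolding inner_L2_def by (subst cinner_comm) simp
  show "inner (u + v) w = inner u w + inner v w"
    by (simp add: inner_L2_def cinner_add_l)
  show "inner (r *\<^sub>R u) v = r * inner u v"
    by (simp add: inner_L2_def scaleR_L2_def cinner_scaleC_l)
  show "0 \<le> inner u u" by (rule inner_nonneg)
  show "inner u u = 0 \<longleftrightarrow> u = 0"
  proof
    obtain f where f: "L2_eq f f" "u = abs_L2 f" using ex_rep by blast
    assume "inner u u = 0"
    then have "(LINT x|lborel. (cmod (f x))\<^sup>2) = 0"
      using norm_eq[OF f] by (simp add: inner_L2_def)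
    moreover have "integrable lborel (\<lambda>x. (cmod (f x))\<^sup>2)"
      using f by (simp add: L2_eq_def square_integrable_def)
    ultimately have "AE x in lborel. (cmod (f x))\<^sup>2 = 0"
      by (simp add: integral_nonneg_eq_0_iff_AE)
    then have "L2_eq f (\<lambda>x. 0)"
      using f by (simp add: L2_eq_def square_integrable_zero)
    then show "u = 0"
      using f Quotient_rel_abs[OF Quotient_L2, of f "\<lambda>x. 0"] by (simp add: zero_L2_def)
  next
    assume "u = 0"
    then show "inner u u = 0"
      using cinner_scaleC_l[of 0 0 u] by (simp add: inner_L2_def scaleC_zero)
  qed
  show "norm u = sqrt (inner u u)" by (simp add: norm_L2_def)
  show "c *\<^sub>C (u + v) = c *\<^sub>C u + c *\<^sub>C v" by (rule scaleC_add_r)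
  show "(c + d) *\<^sub>C u = c *\<^sub>C u + d *\<^sub>C u" by (rule scaleC_add_l)
  show "c *\<^sub>C d *\<^sub>C u = (c * d) *\<^sub>C u" by (rule scaleC_scaleC)
  show "r *\<^sub>R u = complex_of_real r *\<^sub>C u" by (simp add: scaleR_L2_def)
  show "cinner u v = cnj (cinner v u)" by (rule cinner_comm)
  show "cinner (u + v) w = cinner u w + cinner v w" by (rule cinner_add_l)
  show "cinner (c *\<^sub>C u) v = c * cinner u v" by (rule cinner_scaleC_l)
  show "inner u v = Re (cinner u v)" by (simp add: inner_L2_def)
qed

end

text \<open>\<open>L\<^sub>2(\<Omega>)\<close> is realised as the closed subspace of those elements of \<open>L\<^sub>2\<close> of the whole
  space which vanish almost everywhere outside \<open>\<Omega>\<close> (extension by zero).\<close>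

lift_definition vanishes_outside :: "'a::euclidean_space set \<Rightarrow> 'a L2 \<Rightarrow> bool"
  is "\<lambda>\<Omega> f. AE x in lborel. x \<notin> \<Omega> \<longrightarrow> f x = 0"
proof -
  fix \<Omega> :: "'a set" and f g :: "'a \<Rightarrow> complex"
  assume "L2_eq f g"
  then have "AE x in lborel. f x = g x" by (simp add: L2_eq_def)
  then have "AE x in lborel. (x \<notin> \<Omega> \<longrightarrow> f x = 0) \<longleftrightarrow> (x \<notin> \<Omega> \<longrightarrow> g x = 0)"
    by (rule eventually_mono) simp
  then show "(AE x in lborel. x \<notin> \<Omega> \<longrightarrow> f x = 0) = (AE x in lborel. x \<notin> \<Omega> \<longrightarrow> g x = 0)"
    by (rule eventually_subst)
qed

definition L2_on :: "'a::euclidean_space set \<Rightarrow> 'a L2 set" where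
  "L2_on \<Omega> = {u. vanishes_outside \<Omega> u}"

section \<open>Operators in a Hilbert space\<close>

text \<open>A (possibly unbounded) operator in a Hilbert space \<open>H\<close>, given as a closed subspace of a
  type of class \<open>complex_inner\<close>, is identified with its graph. Thus \<open>Domain T\<close> is \<open>D(T)\<close>,
  \<open>Range T\<close> is \<open>R(T)\<close>, \<open>T\<inverse>\<close> is the inverse operator, \<open>S \<subseteq> T\<close> says that \<open>S\<close> is a restriction
  of \<open>T\<close>, and the composition ``first \<open>S\<close>, then \<open>T\<close>'' is \<open>S O T\<close>.\<close>

type_synonym 'a operator = "('a \<times> 'a) set"

definition linear_operator :: "'a::complex_inner set \<Rightarrow> 'a operator \<Rightarrow> bool" where
  "linear_operator H T \<longleftrightarrow> T \<subseteq> H \<times> H \<and> single_valued T \<and> (0, 0) \<in> T \<and>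
     (\<forall>x y x' y'. (x, y) \<in> T \<and> (x', y') \<in> T \<longrightarrow> (x + x', y + y') \<in> T) \<and>
     (\<forall>c x y. (x, y) \<in> T \<longrightarrow> (c *\<^sub>C x, c *\<^sub>C y) \<in> T)"

definition closed_operator :: "'a::complex_inner set \<Rightarrow> 'a operator \<Rightarrow> bool" where
  "closed_operator H T \<longleftrightarrow> linear_operator H T \<and> closed T"

definition bounded_operator :: "'a::complex_inner set \<Rightarrow> 'a operator \<Rightarrow> bool" where
  "bounded_operator H T \<longleftrightarrow> linear_operator H T \<and> Domain T = H \<and>
     (\<exists>B. \<forall>(x, y)\<in>T. norm y \<le> B * norm x)"

definition well_defined_operator :: "'a::complex_inner set \<Rightarrow> 'a operator \<Rightarrow> bool" where
  "well_defined_operator H T \<longleftrightarrow> closed_operator H T \<and> bounded_operator H (T\<inverse>)"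

definition op_kernel :: "'a::zero operator \<Rightarrow> 'a set" where
  "op_kernel T = {x. (x, 0) \<in> T}"

definition op_sum :: "'a::plus operator \<Rightarrow> 'a operator \<Rightarrow> 'a operator" where
  "op_sum S T = {(x, y + z) | x y z. (x, y) \<in> S \<and> (x, z) \<in> T}"

text \<open>The following is the domain formula
  \<open>D(L\<^sub>K) = {u \<in> D(Lh). (I - K Lh) u \<in> D(L)}\<close> for the operator \<open>L\<^sub>K\<close> with inverse
  \<open>L\<inverse> + K\<close>, where \<open>Lh\<close> is the operator which \<open>L\<close> and \<open>L\<^sub>K\<close> restrict.\<close>

lemma Domain_perturbed_restriction:
  assumes lin: "linear_operator H Lh" and sub: "L \<subseteq> Lh"
    and ran: "Range K \<subseteq> op_kernel Lh" and inv: "L\<^sub>K\<inverse> = op_sum (L\<inverse>) K"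
  shows "Domain L\<^sub>K = {u. \<exists>v w. (u, v) \<in> Lh \<and> (v, w) \<in> K \<and> u - w \<in> Domain L}"
    and "L\<^sub>K \<subseteq> Lh"
proof -
  have add: "(x + x', y + y') \<in> Lh" if "(x, y) \<in> Lh" "(x', y') \<in> Lh" for x y x' y'
    using lin that unfolding linear_operator_def by blast
  have LK: "(u, v) \<in> L\<^sub>K \<longleftrightarrow> (\<exists>w k. u = w + k \<and> (w, v) \<in> L \<and> (v, k) \<in> K)" for u v
  proof -
    have "(u, v) \<in> L\<^sub>K \<longleftrightarrow> (v, u) \<in> op_sum (L\<inverse>) K" unfolding inv[symmetric] by simp
    then show ?thesis by (auto simp: op_sum_def)
  qed
  have ker: "(k, 0) \<in> Lh" if "(v, k) \<in> K" for v k
    using ran that by (auto simp: op_kernel_def)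
  show restr: "L\<^sub>K \<subseteq> Lh"
  proof clarify
    fix u v assume "(u, v) \<in> L\<^sub>K"
    then obtain w k where "u = w + k" "(w, v) \<in> L" "(v, k) \<in> K" using LK by blast
    then show "(u, v) \<in> Lh" using add[of w v k 0] ker[of v k] subsetD[OF sub, of "(w, v)"] by simp
  qed
  have "u \<in> Domain L\<^sub>K" if uv: "(u, v) \<in> Lh" "(v, w) \<in> K" "(u - w, v') \<in> L" for u v v' w
  proof -
    have "(u, v') \<in> Lh" using add[of "u - w" v' w 0] subsetD[OF sub uv(3)] ker[OF uv(2)] by simp
    then have "v' = v" using lin uv(1) unfolding linear_operator_def single_valued_def by blast
    then have "(u, v) \<in> L\<^sub>K" unfolding LK using uv by (intro exI[of _ "u - w"] exI[of _ w] conjI) simp_all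
    then show ?thesis by blast
  qed
  moreover have "\<exists>v w. (u, v) \<in> Lh \<and> (v, w) \<in> K \<and> u - w \<in> Domain L"
    if uv: "(u, v) \<in> L\<^sub>K" for u v
  proof -
    from uv obtain w k where wk: "u = w + k" "(w, v) \<in> L" "(v, k) \<in> K" unfolding LK by blast
    then have "u - k \<in> Domain L" by (auto intro: DomainI)
    then show ?thesis using subsetD[OF restr uv] wk(3) by (intro exI[of _ v] exI[of _ k] conjI)
  qed
  ultimately show "Domain L\<^sub>K = {u. \<exists>v w. (u, v) \<in> Lh \<and> (v, w) \<in> K \<and> u - w \<in> Domain L}"
    by (intro equalityI subsetI) (auto elim!: DomainE)
qed

definition adjoint_operator :: "'a::complex_inner set \<Rightarrow> 'a operator \<Rightarrow> 'a operator" where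
  "adjoint_operator H T =
     {(v, w) \<in> H \<times> H. \<forall>(x, y)\<in>T. cinner y v = cinner x w}"

definition self_adjoint_operator :: "'a::complex_inner set \<Rightarrow> 'a operator \<Rightarrow> bool" where
  "self_adjoint_operator H T \<longleftrightarrow> linear_operator H T \<and> adjoint_operator H T = T"

definition nonneg_operator :: "'a::complex_inner set \<Rightarrow> 'a operator \<Rightarrow> bool" where
  "nonneg_operator H T \<longleftrightarrow> self_adjoint_operator H T \<and> (\<forall>(x, y)\<in>T. cinner y x \<in> \<real>\<^sub>\<ge>\<^sub>0)"

definition compact_operator :: "'a::complex_inner set \<Rightarrow> 'a operator \<Rightarrow> bool" where
  "compact_operator H T \<longleftrightarrow> bounded_operator H T \<and> compact (closure (T `` (H \<inter> cball 0 1)))"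

definition operator_spectrum :: "'a::complex_inner set \<Rightarrow> 'a operator \<Rightarrow> complex set" where
  "operator_spectrum H T =
     {z. \<not> bounded_operator H ({(x, y - z *\<^sub>C x) | x y. (x, y) \<in> T}\<inverse>)}"

definition volterra_operator :: "'a::complex_inner set \<Rightarrow> 'a operator \<Rightarrow> bool" where
  "volterra_operator H T \<longleftrightarrow> compact_operator H T \<and> operator_spectrum H T = {0}"

definition volterra_well_defined_operator :: "'a::complex_inner set \<Rightarrow> 'a operator \<Rightarrow> bool" where
  "volterra_well_defined_operator H L \<longleftrightarrow>
     well_defined_operator H L \<and> volterra_operator H (L\<inverse>)"

subsection \<open>The \<open>s\<close>-numbers\<close>

definition abs_operator :: "'a::complex_inner set \<Rightarrow> 'a operator \<Rightarrow> 'a operator" where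
  "abs_operator H T = (THE C. nonneg_operator H C \<and> C O C = T O adjoint_operator H T)"

definition eigenvalue_multiplicity :: "'a::complex_inner operator \<Rightarrow> complex \<Rightarrow> nat" where
  "eigenvalue_multiplicity T z = vector_space.dim (*\<^sub>C) {x. (x, z *\<^sub>C x) \<in> T}"

text \<open>For a compact non-negative \<open>C\<close> this determines the values \<open>s 1, s 2, \<dots>\<close>: they are the positive
  eigenvalues in non-increasing order, each repeated according to its multiplicity, followed by
  zeros if there are only finitely many of them.\<close>

definition enumerates_eigenvalues :: "'a::complex_inner operator \<Rightarrow> (nat \<Rightarrow> real) \<Rightarrow> bool" where
  "enumerates_eigenvalues C s \<longleftrightarrow>
     (\<forall>n\<ge>1. 0 \<le> s n \<and> s (Suc n) \<le> s n) \<and>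
     (\<forall>\<mu>>0. finite {n. 1 \<le> n \<and> s n = \<mu>} \<and>
        card {n. 1 \<le> n \<and> s n = \<mu>} = eigenvalue_multiplicity C (complex_of_real \<mu>))"

text \<open>Indexed from 1; the value at index 0 is irrelevant.\<close>

definition s_number :: "'a::complex_inner set \<Rightarrow> 'a operator \<Rightarrow> nat \<Rightarrow> real" where
  "s_number H T = (SOME s. enumerates_eigenvalues (abs_operator H T) s)"

definition schatten_class :: "'a::complex_inner set \<Rightarrow> real \<Rightarrow> 'a operator set" where
  "schatten_class H p =
     {T. compact_operator H T \<and> summable (\<lambda>j. s_number H T (Suc j) powr p)}"

section \<open>Smooth functions and smooth domains\<close>

primrec C_k_on :: "nat \<Rightarrow> 'a::real_normed_vector set \<Rightarrow> ('a \<Rightarrow> 'b::real_normed_vector) \<Rightarrow> bool" where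
  "C_k_on 0 S f \<longleftrightarrow> continuous_on S f"
| "C_k_on (Suc k) S f \<longleftrightarrow> f differentiable_on S \<and>
     (\<forall>v. C_k_on k S (\<lambda>x. frechet_derivative f (at x) v))"

text \<open>Intended for open \<open>S\<close>.\<close>

definition smooth_on :: "'a::real_normed_vector set \<Rightarrow> ('a \<Rightarrow> 'b::real_normed_vector) \<Rightarrow> bool" where
  "smooth_on S f \<longleftrightarrow> (\<forall>k. C_k_on k S f)"

text \<open>Near each boundary point the boundary can be flattened by a \<open>C\<^sup>\<infinity>\<close> diffeomorphism which
  takes \<open>\<Omega>\<close> to one side of a coordinate hyperplane.\<close>

definition smooth_boundary :: "'a::euclidean_space set \<Rightarrow> bool" where
  "smooth_boundary \<Omega> \<longleftrightarrow> (\<forall>x\<in>frontier \<Omega>. \<exists>U V \<phi> \<psi>. \<exists>b\<in>Basis.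
     open U \<and> x \<in> U \<and> open (V :: 'a set) \<and> homeomorphism U V \<phi> \<psi> \<and>
     smooth_on U \<phi> \<and> smooth_on V \<psi> \<and>
     \<phi> ` (U \<inter> \<Omega>) = {y \<in> V. 0 < y \<bullet> b} \<and>
     \<phi> ` (U \<inter> frontier \<Omega>) = {y \<in> V. y \<bullet> b = 0})"

definition bounded_smooth_domain :: "'a::euclidean_space set \<Rightarrow> bool" where
  "bounded_smooth_domain \<Omega> \<longleftrightarrow>
     \<Omega> \<noteq> {} \<and> open \<Omega> \<and> connected \<Omega> \<and> bounded \<Omega> \<and> smooth_boundary \<Omega>"

section \<open>The minimal and the maximal Laplace operator\<close>

definition laplacian :: "('a::euclidean_space \<Rightarrow> complex) \<Rightarrow> 'a \<Rightarrow> complex" where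
  "laplacian f x =
     (\<Sum>b\<in>Basis. frechet_derivative (\<lambda>y. frechet_derivative f (at y) b) (at x) b)"

definition test_functions :: "'a::euclidean_space set \<Rightarrow> ('a \<Rightarrow> complex) set" where
  "test_functions \<Omega> = {\<phi>. smooth_on UNIV \<phi> \<and>
     compact (closure {x. \<phi> x \<noteq> 0}) \<and> closure {x. \<phi> x \<noteq> 0} \<subseteq> \<Omega>}"

definition minimal_operator :: "'a::euclidean_space set \<Rightarrow> 'a L2 operator" where
  "minimal_operator \<Omega> =
     closure {(abs_L2 \<phi>, abs_L2 (\<lambda>x. - laplacian \<phi> x)) | \<phi>. \<phi> \<in> test_functions \<Omega>}"

definition maximal_operator :: "'a::euclidean_space set \<Rightarrow> 'a L2 operator" where
  "maximal_operator \<Omega> = adjoint_operator (L2_on \<Omega>) (minimal_operator \<Omega>)"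

definition well_defined_restriction :: "'a::euclidean_space set \<Rightarrow> 'a L2 operator \<Rightarrow> bool" where
  "well_defined_restriction \<Omega> L \<longleftrightarrow>
     well_defined_operator (L2_on \<Omega>) L \<and> L \<subseteq> maximal_operator \<Omega>"

end

theory Submission
  imports Defs "HOL-Complex_Analysis.Complex_Analysis" "HOL-Real_Asymp.Real_Asymp"
    "Jordan_Normal_Form.Determinant"
begin

text \<open>Write \<open>A = L\<inverse>\<close>, with eigenvalues \<open>\<lambda>\<^sub>l \<sim> a / l\<^sup>\<alpha>\<close>. If \<open>A + K\<close> had no
  nonzero eigenvalue, then on every disc \<open>|z| \<le> R\<close> the determinants \<open>P(z)\<close> of large finite sections of
  \<open>I - z(A + K)\<close> would have no zeros, by compactness. Factoring out the diagonal part \<open>I - zA\<close>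
  leaves a determinant controlled by the s-numbers of \<open>K\<close> alone, and these decay faster than any power. So where all
  \<open>|1 - z \<lambda>\<^sub>l| \<ge> c\<close>, the holomorphic function \<open>F(z) = \<Prod>(1 - z \<lambda>\<^sub>l) / P(z)\<close> satisfies
  \<open>|1/F(z)| \<le> exp (C (|z|/c)\<^sup>q)\<close> with \<open>q\<close> as small as desired and \<open>C\<close> independent of the size of the section.

  Away from the positive half-axis \<open>F\<close> is zero-free, so Harnack's inequality in a sector of opening almost \<open>2\<pi>\<close>
  turns this lower bound into an upper bound for \<open>ln |F|\<close> of order little more than \<open>1/2\<close>, and a
  Phragmen-Lindelof argument extends it across the half-axis. By Jensen's inequality \<open>F\<close> has few
  zeros, while the \<open>1 / \<lambda>\<^sub>l\<close> have density \<open>1 / \<alpha> > 1/2\<close>: a contradiction. Hence \<open>A + K\<close> has a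
  nonzero eigenvalue and its spectrum is not \<open>{0}\<close>.

  That \<open>L\<^sub>K\<close> is an operator at all rests on the maximal operator being single-valued, that is, on the density
  of the test functions in \<open>L\<^sub>2(\<Omega>)\<close>.\<close>

text \<open>For \<alpha> \<le> 1 the operator \<open>A\<close> is not trace class, so
  \<open>I - z(A + K)\<close> has no Fredholm determinant. This is why finite sections are used,
  with every constant independent of their size. The price is that \<open>P\<close> is zero-free,
  and \<open>F\<close> holomorphic, only on a disc whose radius \<open>R\<close> is fixed before the
  section. A Phragmen-Lindelof theorem on an unbounded sector is therefore out of reach; the version
  used lives on a bounded sector and needs an explicit bound for \<open>F\<close> on the outer arc.
  Such a bound is available, but poor: \<open>ln |F|\<close> is at most of order
  \<open>R powr (1 / \<alpha> + 1)\<close>. What rescues it is that the sector around the half-axis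
  may be taken as narrow as desired, which permits a damping exponent \<beta> as large as desired.
  Retreating from radius \<open>R\<close> to about \<open>R powr (1 - \<epsilon>)\<close>, with
  \<open>\<epsilon> * \<beta> = 1 / \<alpha> + 1\<close>, then reduces the outer contribution to a
  constant, and a small \<epsilon> sacrifices so few zeros that those remaining still outnumber what
  the growth of \<open>F\<close> permits.\<close>

section \<open>Determinants of perturbed diagonal matrices\<close>

text \<open>Expanding the product of the row sums gives one term for every map of the index set into
  itself, and the permutations in Leibniz' formula are among these maps.\<close>

lemma norm_det_le_prod_row_sums:
  fixes A :: "complex mat"
  assumes A: "A \<in> carrier_mat n n"
  shows "norm (Determinant.det A) \<le> (\<Prod>i\<in>{0..<n}. \<Sum>j\<in>{0..<n}. norm (A $$ (i, j)))"
proof -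
  let ?I = "{0..<n}"
  let ?h = "\<lambda>p :: nat \<Rightarrow> nat. \<Prod>i\<in>?I. norm (A $$ (i, p i))"
  have "norm (Determinant.det A) \<le> (\<Sum>p\<in>{p. p permutes ?I}. norm (signof p * (\<Prod>i\<in>?I. A $$ (i, p i))))"
    unfolding Determinant.det_def'[OF A] by (rule norm_sum)
  also have "\<dots> = (\<Sum>p\<in>{p. p permutes ?I}. ?h p)"
    by (intro sum.cong refl) (auto simp: norm_mult prod_norm sign_def)
  \<comment> \<open>Permutations are the identity outside \<open>?I\<close> while members of
    \<open>PiE\<close> are \<open>undefined\<close> there, so restriction is needed before the two
    index sets can be compared.\<close>
  also have "\<dots> = (\<Sum>q\<in>(\<lambda>p. restrict p ?I) ` {p. p permutes ?I}. ?h q)"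
  proof (subst sum.reindex)
    show "inj_on (\<lambda>p. restrict p ?I) {p. p permutes ?I}"
    proof (rule inj_onI)
      fix p q assume *: "p \<in> {p. p permutes ?I}" "q \<in> {p. p permutes ?I}" "restrict p ?I = restrict q ?I"
      show "p = q"
      proof
        fix x show "p x = q x"
        proof (cases "x \<in> ?I")
          case True
          then show ?thesis using fun_cong[OF *(3), of x] by simp
        next
          case False
          then show ?thesis using *(1,2) by (simp add: permutes_not_in)
        qed
      qed
    qed
    show "(\<Sum>p | p permutes ?I. ?h p) = sum (?h \<circ> (\<lambda>p. restrict p ?I)) {p. p permutes ?I}"
      by (intro sum.cong refl) (simp add: restrict_def)
  qed
  also have "\<dots> \<le> (\<Sum>q\<in>PiE ?I (\<lambda>_. ?I). ?h q)"
  proof (rule sum_mono2)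
    show "finite (PiE ?I (\<lambda>_. ?I))" by (simp add: finite_PiE)
    show "(\<lambda>p. restrict p ?I) ` {p. p permutes ?I} \<subseteq> PiE ?I (\<lambda>_. ?I)"
      using permutes_in_image[of _ ?I] by (force simp del: atLeastLessThan_iff)
  qed (simp add: prod_nonneg)
  also have "\<dots> = (\<Prod>i\<in>?I. \<Sum>j\<in>?I. norm (A $$ (i, j)))"
    by (subst prod_sum_PiE) auto
  finally show ?thesis .
qed

text \<open>Sylvester's identity. The block matrix \<open>?N\<close> has determinant
  \<open>det (1 - A * B)\<close> by a Schur complement, and multiplication by the unipotent
  \<open>?U\<close> makes it block triangular with the other determinant on the diagonal.\<close>

lemma det_one_minus_mult_commute:
  fixes A B :: "complex mat"
  assumes A: "A \<in> carrier_mat n n" and B: "B \<in> carrier_mat n n"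
  shows "Determinant.det (1\<^sub>m n - A * B) = Determinant.det (1\<^sub>m n - B * A)"
proof -
  let ?I = "1\<^sub>m n :: complex mat" and ?Z = "0\<^sub>m n n :: complex mat"
  let ?N = "four_block_mat ?I A B ?I" and ?U = "four_block_mat ?I (- A) ?Z ?I"
  have NU: "?N \<in> carrier_mat (n + n) (n + n)" "?U \<in> carrier_mat (n + n) (n + n)"
    using A B by (auto intro!: four_block_carrier_mat)
  have dU: "Determinant.det ?U = 1"
    using A by (subst det_four_block_mat_lower_left_zero[of _ n _ n]) auto
  have "?N * ?U = four_block_mat ?I ?Z B (?I - B * A)"
    using A B by (subst mult_four_block_mat[of _ n n _ n _ n _ _ n _ n]) (auto simp: minus_add_uminus_mat[of _ n n] comm_add_mat[of _ n n] uminus_l_inv_mat)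
  then have "Determinant.det ?N * Determinant.det ?U = Determinant.det (?I - B * A)"
    using A B det_mult[OF NU] det_four_block_mat_upper_right_zero[of ?I n ?Z n B "?I - B * A"]
      minus_carrier_mat[of "B * A" n n ?I] by simp
  moreover have "Determinant.det ?N = Determinant.det (?I - A * B)"
    using A B by (subst det_four_block_mat[of _ n]) auto
  ultimately show ?thesis using dU by simp
qed

text \<open>The matrix of \<open>I - z(A + K)\<close>, truncated to size \<open>n\<close>, in an eigenbasis \<open>e\<close> of \<open>A\<close> with
  eigenvalues \<open>lam\<close>, for \<open>K = (\<Sum>j. s\<^sub>j \<langle>\<sqdot>, f\<^sub>j\<rangle> g\<^sub>j)\<close> with \<open>g j i\<close> and \<open>f j i\<close> the coefficients
  of \<open>g\<^sub>j\<close> and \<open>f\<^sub>j\<close> at \<open>e\<^sub>i\<close>.\<close>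

definition pert_mat :: "nat \<Rightarrow> (nat \<Rightarrow> real) \<Rightarrow> (nat \<Rightarrow> real) \<Rightarrow> (nat \<Rightarrow> nat \<Rightarrow> complex) \<Rightarrow>
    (nat \<Rightarrow> nat \<Rightarrow> complex) \<Rightarrow> complex \<Rightarrow> complex mat" where
  "pert_mat n lam s g f z = mat n n (\<lambda>(i, l). (if i = l then 1 - z * lam i else 0) -
     z * (\<Sum>j\<in>{0..<n}. s j * g j i * cnj (f j l)))"

text \<open>The matrix is \<open>D * (1 - A * B)\<close> with \<open>D\<close> the diagonal part.
  Commuting to \<open>1 - B * A\<close> moves the row index from the eigenbasis to the singular
  index of \<open>K\<close>, so that the row sums are governed by the singular values alone; the
  eigenvalues of the diagonal part enter only through \<open>c\<close>.\<close>

lemma norm_det_pert_mat_le: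
  fixes lam s :: "nat \<Rightarrow> real" and z :: complex
  assumes s: "\<And>j. j < n \<Longrightarrow> 0 \<le> s j" and c: "0 < c"
    and lam: "\<And>l. l < n \<Longrightarrow> c \<le> norm (1 - z * lam l)"
    and g: "\<And>j. j < n \<Longrightarrow> (\<Sum>i\<in>{0..<n}. (norm (g j i))\<^sup>2) \<le> 1"
    and f: "\<And>j. j < n \<Longrightarrow> (\<Sum>i\<in>{0..<n}. (norm (f j i))\<^sup>2) \<le> 1"
  shows "norm (Determinant.det (pert_mat n lam s g f z)) \<le>
    (\<Prod>l\<in>{0..<n}. norm (1 - z * lam l)) *
    (\<Prod>j\<in>{0..<n}. 1 + norm z / c * sqrt (s j) * (\<Sum>i\<in>{0..<n}. sqrt (s i)))"
proof -
  let ?I = "{0..<n}"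
  \<comment> \<open>Splitting \<open>s j\<close> into two square roots, one for each factor, makes
    the entries of \<open>B * A\<close> at most
    \<open>norm z / c * sqrt (s i) * sqrt (s j)\<close>.\<close>
  define A where "A = mat n n (\<lambda>(i, j). z / (1 - z * lam i) * g j i * sqrt (s j))"
  define B where "B = mat n n (\<lambda>(j, l). sqrt (s j) * cnj (f j l))"
  define D where "D = mat n n (\<lambda>(i, l). if i = l then 1 - z * lam i else 0)"
  have car: "A \<in> carrier_mat n n" "B \<in> carrier_mat n n" "D \<in> carrier_mat n n"
    by (auto simp: A_def B_def D_def)
  have nz: "1 - z * lam l \<noteq> 0" if "l < n" for l
    using lam[OF that] c by auto
  have "pert_mat n lam s g f z = D * (1\<^sub>m n - A * B)"
  proof (rule eq_matI)
    fix i l assume "i < dim_row (D * (1\<^sub>m n - A * B))" "l < dim_col (D * (1\<^sub>m n - A * B))"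
    then have il: "i < n" "l < n" using car by auto
    have AB: "(A * B) $$ (k, l) = (\<Sum>j\<in>?I. z / (1 - z * lam k) * (s j * g j k * cnj (f j l)))" if "k < n" for k
    proof -
      have "(A * B) $$ (k, l) = (\<Sum>j\<in>?I. A $$ (k, j) * B $$ (j, l))"
        using that il car by (simp add: scalar_prod_def)
      also have "\<dots> = (\<Sum>j\<in>?I. z / (1 - z * lam k) * (s j * g j k * cnj (f j l)))"
      proof (rule sum.cong[OF refl])
        fix j assume "j \<in> ?I"
        then have "complex_of_real (sqrt (s j)) * complex_of_real (sqrt (s j)) = s j"
          using s[of j] by (metis atLeastLessThan_iff of_real_mult real_sqrt_mult_self abs_of_nonneg)
        then show "A $$ (k, j) * B $$ (j, l) = z / (1 - z * lam k) * (s j * g j k * cnj (f j l))"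
          using \<open>j \<in> ?I\<close> that il by (simp add: A_def B_def algebra_simps)
      qed
      finally show ?thesis .
    qed
    have "(D * (1\<^sub>m n - A * B)) $$ (i, l) = (\<Sum>k\<in>?I. D $$ (i, k) * (1\<^sub>m n - A * B) $$ (k, l))"
      using il car by (simp add: scalar_prod_def)
    also have "\<dots> = (\<Sum>k\<in>?I. if k = i then (1 - z * lam i) * (1\<^sub>m n - A * B) $$ (i, l) else 0)"
      using il by (intro sum.cong) (auto simp: D_def)
    also have "\<dots> = (1 - z * lam i) * (1\<^sub>m n - A * B) $$ (i, l)"
      using il by simp
    also have "(1\<^sub>m n - A * B) $$ (i, l) = (if i = l then 1 else 0) - (\<Sum>j\<in>?I. z / (1 - z * lam i) * (s j * g j i * cnj (f j l)))"
      using il car AB[OF il(1)] index_minus_mat(1)[of i "A * B" l "1\<^sub>m n"] by simp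
    also have "(1 - z * lam i) * \<dots> = pert_mat n lam s g f z $$ (i, l)"
      using il nz[of i] by (auto simp: pert_mat_def sum_distrib_left right_diff_distrib intro!: sum.cong)
    finally show "pert_mat n lam s g f z $$ (i, l) = (D * (1\<^sub>m n - A * B)) $$ (i, l)" by simp
  qed (auto simp: pert_mat_def A_def B_def D_def)
  then have "Determinant.det (pert_mat n lam s g f z) = Determinant.det D * Determinant.det (1\<^sub>m n - A * B)"
    using car minus_carrier_mat[of "A * B" n n "1\<^sub>m n"] by (simp add: det_mult[of _ n])
  also have "Determinant.det D = (\<Prod>l\<in>?I. 1 - z * lam l)"
  proof -
    have "upper_triangular D" by (auto simp: D_def)
    then have "Determinant.det D = prod_list (diag_mat D)" using car(3) by (rule det_upper_triangular)
    also have "\<dots> = (\<Prod>l\<in>?I. 1 - z * lam l)"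
      by (simp add: prod_list_diag_prod D_def)
    finally show ?thesis .
  qed
  also have "Determinant.det (1\<^sub>m n - A * B) = Determinant.det (1\<^sub>m n - B * A)"
    using car by (intro det_one_minus_mult_commute)
  finally have "norm (Determinant.det (pert_mat n lam s g f z)) =
      (\<Prod>l\<in>?I. norm (1 - z * lam l)) * norm (Determinant.det (1\<^sub>m n - B * A))"
    by (simp add: norm_mult prod_norm)
  also have "norm (Determinant.det (1\<^sub>m n - B * A)) \<le>
      (\<Prod>i\<in>?I. \<Sum>j\<in>?I. norm ((1\<^sub>m n - B * A) $$ (i, j)))"
    using car by (intro norm_det_le_prod_row_sums) auto
  also have "\<dots> \<le> (\<Prod>i\<in>?I. 1 + norm z / c * sqrt (s i) * (\<Sum>j\<in>?I. sqrt (s j)))"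
  proof (intro prod_mono conjI sum_nonneg)
    fix i assume i: "i \<in> ?I"
    have BA: "norm ((B * A) $$ (i, j)) \<le> norm z / c * sqrt (s i) * sqrt (s j)" if j: "j \<in> ?I" for j
    proof -
      have fg: "(\<Sum>l\<in>?I. norm (f i l) * norm (g j l)) \<le> 1"
      proof -
        have "(\<Sum>l\<in>?I. norm (f i l) * norm (g j l)) \<le> (\<Sum>l\<in>?I. ((norm (f i l))\<^sup>2 + (norm (g j l))\<^sup>2) / 2)"
        proof (rule sum_mono)
          fix l show "norm (f i l) * norm (g j l) \<le> ((norm (f i l))\<^sup>2 + (norm (g j l))\<^sup>2) / 2"
            using sum_squares_bound[of "norm (f i l)" "norm (g j l)"] by simp
        qed
        also have "\<dots> = ((\<Sum>l\<in>?I. (norm (f i l))\<^sup>2) + (\<Sum>l\<in>?I. (norm (g j l))\<^sup>2)) / 2"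
          by (simp add: sum.distrib sum_divide_distrib[symmetric])
        also have "\<dots> \<le> 1" using f[of i] g[of j] i j by simp
        finally show ?thesis .
      qed
      have "(B * A) $$ (i, j) = (\<Sum>l\<in>?I. B $$ (i, l) * A $$ (l, j))"
        using i j car by (simp add: scalar_prod_def)
      also have "norm \<dots> \<le> (\<Sum>l\<in>?I. norm (B $$ (i, l) * A $$ (l, j)))" by (rule norm_sum)
      also have "\<dots> \<le> (\<Sum>l\<in>?I. (norm z / c * sqrt (s i) * sqrt (s j)) * (norm (f i l) * norm (g j l)))"
      proof (rule sum_mono)
        fix l assume l: "l \<in> ?I"
        have "norm (B $$ (i, l) * A $$ (l, j)) =
            norm z / norm (1 - z * lam l) * (sqrt (s i) * sqrt (s j) * (norm (f i l) * norm (g j l)))"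
          using i j l s by (simp add: A_def B_def norm_mult norm_divide)
        also have "\<dots> \<le> norm z / c * (sqrt (s i) * sqrt (s j) * (norm (f i l) * norm (g j l)))"
          using lam[of l] l c i j s by (intro mult_right_mono divide_left_mono) (auto intro!: mult_nonneg_nonneg mult_pos_pos)
        finally show "norm (B $$ (i, l) * A $$ (l, j)) \<le> (norm z / c * sqrt (s i) * sqrt (s j)) * (norm (f i l) * norm (g j l))"
          by (simp add: mult.assoc)
      qed
      also have "\<dots> = (norm z / c * sqrt (s i) * sqrt (s j)) * (\<Sum>l\<in>?I. norm (f i l) * norm (g j l))"
        by (simp add: sum_distrib_left)
      also have "\<dots> \<le> (norm z / c * sqrt (s i) * sqrt (s j)) * 1"
        using fg c i j s by (intro mult_left_mono) auto
      finally show ?thesis by simp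
    qed
    have "(\<Sum>j\<in>?I. norm ((1\<^sub>m n - B * A) $$ (i, j))) \<le> (\<Sum>j\<in>?I. (if i = j then 1 else 0) + norm ((B * A) $$ (i, j)))"
    proof (rule sum_mono)
      fix j assume "j \<in> ?I"
      then have "(1\<^sub>m n - B * A) $$ (i, j) = (if i = j then 1 else 0) - (B * A) $$ (i, j)"
        using i car by simp
      also have "norm \<dots> \<le> norm (if i = j then 1 else (0::complex)) + norm ((B * A) $$ (i, j))"
        by (rule norm_triangle_ineq4)
      finally show "norm ((1\<^sub>m n - B * A) $$ (i, j)) \<le> (if i = j then 1 else 0) + norm ((B * A) $$ (i, j))"
        by (auto split: if_splits)
    qed
    also have "\<dots> \<le> (\<Sum>j\<in>?I. (if i = j then 1 else 0) + norm z / c * sqrt (s i) * sqrt (s j))"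
      using BA by (intro sum_mono add_mono) auto
    also have "\<dots> = 1 + norm z / c * sqrt (s i) * (\<Sum>j\<in>?I. sqrt (s j))"
      using i by (simp add: sum.distrib sum_distrib_left)
    finally show "(\<Sum>j\<in>?I. norm ((1\<^sub>m n - B * A) $$ (i, j))) \<le> 1 + norm z / c * sqrt (s i) * (\<Sum>j\<in>?I. sqrt (s j))" .
  qed auto
  finally show ?thesis
    by (simp add: mult_left_mono prod_nonneg)
qed

lemma holomorphic_det_pert_mat:
  "(\<lambda>z. Determinant.det (pert_mat n lam s g f z)) holomorphic_on S"
proof -
  have "Determinant.det (pert_mat n lam s g f (z::complex)) = (\<Sum>p\<in>{p. p permutes {0..<n}}. signof p *
      (\<Prod>i\<in>{0..<n}. (if i = p i then 1 - z * complex_of_real (lam i) else 0) - z * (\<Sum>j\<in>{0..<n}. s j * g j i * cnj (f j (p i)))))" for z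
    by (subst Determinant.det_def'[of _ n])
      (auto simp: pert_mat_def permutes_in_image intro!: sum.cong prod.cong arg_cong2[of _ _ _ _ "(*)"])
  moreover have "(\<lambda>z. if b then 1 - z * c else 0) holomorphic_on S" for b and c :: complex
    by (cases b) (auto intro!: holomorphic_intros)
  ultimately show ?thesis
    by (auto intro!: holomorphic_intros)
qed

lemma pert_mat_det_eq_0:
  assumes "Determinant.det (pert_mat n lam s g f z) = 0"
  obtains v where "\<exists>i<n. v i \<noteq> 0"
    and "\<And>i. i < n \<Longrightarrow> v i = z * (lam i * v i + (\<Sum>j\<in>{0..<n}. s j * g j i * (\<Sum>l\<in>{0..<n}. cnj (f j l) * v l)))"
proof -
  have car: "pert_mat n lam s g f z \<in> carrier_mat n n" by (simp add: pert_mat_def)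
  obtain w where w: "w \<in> carrier_vec n" "w \<noteq> 0\<^sub>v n" "pert_mat n lam s g f z *\<^sub>v w = 0\<^sub>v n"
    using assms det_0_iff_vec_prod_zero_field[OF car] by blast
  define v where "v = vec_index w"
  have "\<exists>i<n. v i \<noteq> 0"
    using w(1,2) by (auto simp: v_def vec_eq_iff)
  moreover have "v i = z * (lam i * v i + (\<Sum>j\<in>{0..<n}. s j * g j i * (\<Sum>l\<in>{0..<n}. cnj (f j l) * v l)))"
    if i: "i < n" for i
  proof -
    have "0 = vec_index (pert_mat n lam s g f z *\<^sub>v w) i" using w i by simp
    also have "\<dots> = (\<Sum>l\<in>{0..<n}. pert_mat n lam s g f z $$ (i, l) * v l)"
      using i w(1) car by (simp add: scalar_prod_def v_def)
    also have "\<dots> = (\<Sum>l\<in>{0..<n}. (if l = i then (1 - z * lam i) * v i else 0) -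
         z * (\<Sum>j\<in>{0..<n}. s j * g j i * (cnj (f j l) * v l)))"
      using i by (intro sum.cong) (auto simp: pert_mat_def left_diff_distrib sum_distrib_right sum_distrib_left mult.assoc)
    also have "\<dots> = (1 - z * lam i) * v i - z * (\<Sum>l\<in>{0..<n}. \<Sum>j\<in>{0..<n}. s j * g j i * (cnj (f j l) * v l))"
      using i by (simp add: sum_subtractf sum_distrib_left)
    also have "(\<Sum>l\<in>{0..<n}. \<Sum>j\<in>{0..<n}. s j * g j i * (cnj (f j l) * v l)) =
        (\<Sum>j\<in>{0..<n}. s j * g j i * (\<Sum>l\<in>{0..<n}. cnj (f j l) * v l))"
      by (subst sum.swap) (simp add: sum_distrib_left)
    finally show ?thesis by (simp add: algebra_simps)
  qed
  ultimately show thesis by (rule that)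
qed

section \<open>Zero-free functions in discs and sectors\<close>

text \<open>Harnack's inequality for the positive harmonic function
  \<open>B - ln (norm (f z))\<close>, obtained from the Schwarz lemma through a holomorphic
  logarithm of \<open>f\<close>. The two conclusions bound its value at \<open>z\<close> above and
  below by its value at the centre; both are multiplied out to avoid quotients.\<close>

lemma harnack_nonvanishing:
  fixes f :: "complex \<Rightarrow> complex"
  assumes hol: "f holomorphic_on ball c r" and nz: "\<And>z. z \<in> ball c r \<Longrightarrow> f z \<noteq> 0"
    and le: "\<And>z. z \<in> ball c r \<Longrightarrow> norm (f z) < exp B" and z: "z \<in> ball c r"
  shows "(B - ln (norm (f z))) * (r - dist c z) \<le> (B - ln (norm (f c))) * (r + dist c z)"
    and "(B - ln (norm (f c))) * (r - dist c z) \<le> (B - ln (norm (f z))) * (r + dist c z)"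
proof -
  have r: "0 < r" using z by (metis ball_eq_empty empty_iff not_le)
  obtain g where g: "g holomorphic_on ball c r" "\<And>z. z \<in> ball c r \<Longrightarrow> f z = exp (g z)"
    using contractible_imp_holomorphic_log[OF hol _ nz] convex_imp_contractible convex_ball by metis
  define \<psi> where "\<psi> z = complex_of_real B - g z" for z
  have Re_\<psi>: "Re (\<psi> z) = B - ln (norm (f z))" if "z \<in> ball c r" for z
    using g(2)[OF that] by (simp add: \<psi>_def)
  have pos: "0 < Re (\<psi> z)" if "z \<in> ball c r" for z
  proof -
    have "ln (norm (f z)) < B"
      using le[OF that] nz[OF that] by (metis ln_exp ln_less_cancel_iff zero_less_norm_iff exp_gt_zero)
    then show ?thesis using Re_\<psi>[OF that] by simp
  qed
  \<comment> \<open>The Cayley transform sending the right half-plane to the unit disc and the value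
    at the centre to 0, precomposed with the affine map from the unit disc onto
    \<open>ball c r\<close>.\<close>
  define h where "h u = (\<psi> (c + complex_of_real r * u) - \<psi> c) / (\<psi> (c + complex_of_real r * u) + cnj (\<psi> c))" for u
  have in_ball: "c + complex_of_real r * u \<in> ball c r" if "norm u < 1" for u :: complex
    using that r by (simp add: dist_norm norm_mult)
  have c: "c \<in> ball c r" using r by simp
  have den: "\<psi> (c + complex_of_real r * u) + cnj (\<psi> c) \<noteq> 0" if "norm u < 1" for u
    using pos[OF in_ball[OF that]] pos[OF c] by (auto simp: complex_eq_iff)
  have \<psi>_hol: "(\<lambda>u. \<psi> (c + complex_of_real r * u)) holomorphic_on ball 0 1"
  proof -
    have "(g \<circ> (\<lambda>u. c + complex_of_real r * u)) holomorphic_on ball 0 1"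
      by (rule holomorphic_on_compose_gen[OF _ g(1)]) (use in_ball in \<open>auto intro!: holomorphic_intros\<close>)
    then show ?thesis by (auto simp: \<psi>_def o_def intro!: holomorphic_intros)
  qed
  have h_hol: "h holomorphic_on ball 0 1"
    unfolding h_def using \<psi>_hol den by (intro holomorphic_intros) auto
  have h1: "norm (h u) < 1" if "norm u < 1" for u
  proof -
    let ?x = "\<psi> (c + complex_of_real r * u)" and ?a = "\<psi> c"
    have "(norm (?x - ?a))\<^sup>2 < (norm (?x + cnj ?a))\<^sup>2"
    proof -
      have "(norm (?x + cnj ?a))\<^sup>2 - (norm (?x - ?a))\<^sup>2 = 4 * Re ?x * Re ?a"
        unfolding cmod_power2 by (simp add: power2_eq_square algebra_simps)
      moreover have "0 < 4 * Re ?x * Re ?a" using pos[OF in_ball[OF that]] pos[OF c] by simp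
      ultimately show ?thesis by linarith
    qed
    then have "norm (?x - ?a) < norm (?x + cnj ?a)" by (simp add: power2_less_imp_less)
    then show ?thesis using den[OF that] by (simp add: h_def norm_divide)
  qed
  define u where "u = (z - c) / r"
  define t where "t = norm u"
  have t: "t = dist c z / r" using r by (simp add: t_def u_def norm_divide dist_norm norm_minus_commute)
  have t1: "t < 1" using z r by (simp add: t)
  have cu: "c + complex_of_real r * u = z" using r by (simp add: u_def)
  have "norm (h u) \<le> t"
    unfolding t_def using t1 h1 by (intro Schwarz_Lemma[OF h_hol]) (auto simp: h_def t_def)
  then have "norm (\<psi> z - \<psi> c) \<le> t * norm (\<psi> z + cnj (\<psi> c))"
    using den[of u] t1 cu by (simp add: h_def norm_divide t_def pos_divide_le_eq)
  then have sq: "(norm (\<psi> z - \<psi> c))\<^sup>2 \<le> t\<^sup>2 * (norm (\<psi> z + cnj (\<psi> c)))\<^sup>2"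
    by (metis norm_ge_zero power_mono power_mult_distrib)
  let ?x = "Re (\<psi> z)" and ?a = "Re (\<psi> c)"
  \<comment> \<open>The imaginary part of \<psi> contributes the same square to both sides of
    \<open>sq\<close>; since \<open>t\<close> is at most 1 it can be cancelled, leaving an
    inequality between real parts.\<close>
  have "t\<^sup>2 \<le> 1" using t1 by (simp add: t_def power_le_one)
  then have "t\<^sup>2 * (Im (\<psi> z) - Im (\<psi> c))\<^sup>2 \<le> 1 * (Im (\<psi> z) - Im (\<psi> c))\<^sup>2"
    by (intro mult_right_mono) auto
  then have "(?x - ?a)\<^sup>2 \<le> t\<^sup>2 * (?x + ?a)\<^sup>2"
    using sq unfolding cmod_power2 by (simp add: distrib_left)
  then have "\<bar>?x - ?a\<bar> \<le> t * (?x + ?a)"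
    using pos[OF z] pos[OF c] t1
    by (simp add: power_mult_distrib[symmetric] abs_le_square_iff[symmetric] t_def)
  then have "\<bar>?x - ?a\<bar> * r \<le> t * (?x + ?a) * r" using r by (intro mult_right_mono) auto
  then have "\<bar>?x - ?a\<bar> * r \<le> dist c z * (?x + ?a)" using r by (simp add: t)
  moreover have "(?x - ?a) * r \<le> \<bar>?x - ?a\<bar> * r" "(?a - ?x) * r \<le> \<bar>?x - ?a\<bar> * r"
    using r by (auto intro!: mult_right_mono)
  ultimately have "?x * (r - dist c z) \<le> ?a * (r + dist c z) \<and> ?a * (r - dist c z) \<le> ?x * (r + dist c z)"
    by (simp add: algebra_simps)
  then show "(B - ln (norm (f z))) * (r - dist c z) \<le> (B - ln (norm (f c))) * (r + dist c z)"
    and "(B - ln (norm (f c))) * (r - dist c z) \<le> (B - ln (norm (f z))) * (r + dist c z)"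
    by (auto simp: Re_\<psi>[OF z] Re_\<psi>[OF c])
qed

lemma norm_le_on_cball:
  fixes f :: "complex \<Rightarrow> complex"
  assumes "f holomorphic_on cball 0 R" "0 < R" "\<And>z. norm z = R \<Longrightarrow> norm (f z) \<le> B" "norm z \<le> R"
  shows "norm (f z) \<le> B"
  by (rule maximum_modulus_frontier[of f "cball 0 R"])
    (use assms in \<open>auto intro: holomorphic_on_imp_continuous_on holomorphic_on_subset\<close>)

text \<open>Harnack's inequality in a disc tangent to the imaginary axis at 0, transported to a slit sector by
  the power map \<open>v \<mapsto> - r v\<^sup>\<gamma>\<close>; the exponent \<open>1 / \<gamma>\<close>, close to \<open>1 / 2\<close>, is the source of the
  threshold \<open>\<alpha> < 2\<close>.\<close>

lemma sector_harnack:
  fixes D :: "complex \<Rightarrow> complex" and \<delta> R B r :: real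
  defines "\<gamma> \<equiv> 2 - 2 * \<delta> / pi" and "\<psi> \<equiv> (pi - 2 * \<delta>) / (2 - 2 * \<delta> / pi)"
  assumes \<delta>: "0 < \<delta>" "\<delta> < pi / 4"
    and U: "\<And>\<zeta>. \<bar>Im \<zeta>\<bar> < pi - \<delta> \<Longrightarrow> Re \<zeta> < ln R \<Longrightarrow> - exp \<zeta> \<in> U"
    and hol: "D holomorphic_on U" and nz: "\<And>z. z \<in> U \<Longrightarrow> D z \<noteq> 0"
    and le: "\<And>z. z \<in> U \<Longrightarrow> norm (D z) < exp B"
    and r: "0 < r" and \<zeta>: "\<bar>Im \<zeta>\<bar> \<le> pi - 2 * \<delta>" "ln r \<le> Re \<zeta>"
    and R: "Re \<zeta> < ln R - 2 * ln (2 / cos \<psi>)"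
  shows "B - ln (norm (D (- exp \<zeta>))) \<le>
    4 / (cos \<psi> * (1 - sin \<psi>)) * exp ((Re \<zeta> - ln r) / \<gamma>) * (B - ln (norm (D (- of_real r))))"
proof -
  have \<gamma>: "1 < \<gamma>" "\<gamma> < 2" using \<delta> by (auto simp: \<gamma>_def field_simps)
  have \<gamma>pi: "\<gamma> * (pi / 2) = pi - \<delta>" by (simp add: \<gamma>_def field_simps)
  have \<psi>: "0 < \<psi>" "\<psi> < pi / 2"
  proof -
    show "0 < \<psi>" using \<delta> \<gamma> by (auto simp: \<psi>_def \<gamma>_def[symmetric])
    have "pi - 2 * \<delta> < \<gamma> * (pi / 2)" using \<delta> \<gamma>pi by simp
    then show "\<psi> < pi / 2" using \<gamma> unfolding \<psi>_def \<gamma>_def[symmetric] by (simp add: field_simps)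
  qed
  have cs: "0 < cos \<psi>" "cos \<psi> \<le> 1" "0 < sin \<psi>" "sin \<psi> < 1"
    using \<psi> sin_monotone_2pi[of \<psi> "pi / 2"] by (auto intro!: cos_gt_zero_pi sin_gt_zero2)
  have cos2: "cos \<psi> \<le> 2" using cs(2) by linarith
  \<comment> \<open>The preimage of the target point under
    \<open>v \<mapsto> - r v\<^sup>\<gamma>\<close>; the base point \<open>- r\<close> has preimage
    1.\<close>
  define w where "w = exp ((\<zeta> - ln r) / \<gamma>)"
  \<comment> \<open>The disc with centre and radius \<open>T\<close> is tangent to the imaginary
    axis at 0. With \<open>norm w = T * cos \<psi>\<close> and the argument of \<open>w\<close> at
    most \<psi>, the distance from \<open>w\<close> to the centre is at most
    \<open>T * sin \<psi>\<close>, so \<open>w\<close> keeps a fixed relative distance from the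
    boundary.\<close>
  define T where "T = norm w / cos \<psi>"
  have nw: "norm w = exp ((Re \<zeta> - ln r) / \<gamma>)" by (simp add: w_def)
  have nw1: "1 \<le> norm w" using \<zeta> \<gamma> by (simp add: nw)
  have T1: "1 \<le> T" using order_trans[OF cs(2) nw1] cs(1) by (simp add: T_def le_divide_eq)
  have nwT: "norm w = T * cos \<psi>" using cs by (simp add: T_def)
  define \<Phi> where "\<Phi> v = \<gamma> * Ln v + ln r" for v
  define E where "E v = D (- exp (\<Phi> v))" for v
  let ?T = "complex_of_real T"
  have Re_pos: "0 < Re v" if "v \<in> ball ?T T" for v
  proof -
    have "\<bar>Re (?T - v)\<bar> < T" using that abs_Re_le_cmod[of "?T - v"] by (simp add: dist_norm)
    then show ?thesis by simp
  qed
  \<comment> \<open>Points of the disc have modulus below \<open>2 * T\<close>, that is, below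
    \<open>norm w * (2 / cos \<psi>)\<close>. Raising to the power \<gamma> < 2 costs at most
    \<open>2 * ln (2 / cos \<psi>)\<close> on the logarithmic scale, which is the margin demanded by
    the assumption \<open>R\<close>.\<close>
  have inU: "- exp (\<Phi> v) \<in> U" if v: "v \<in> ball ?T T" for v
  proof (rule U)
    have v0: "v \<noteq> 0" using Re_pos[OF v] by auto
    have "\<bar>Im (Ln v)\<bar> < pi / 2" using Re_pos[OF v] Re_Ln_pos_lt[OF v0] by blast
    then have "\<gamma> * \<bar>Im (Ln v)\<bar> < pi - \<delta>" unfolding \<gamma>pi[symmetric] using \<gamma> by (intro mult_strict_left_mono) auto
    then show "\<bar>Im (\<Phi> v)\<bar> < pi - \<delta>" using \<gamma> by (simp add: \<Phi>_def abs_mult)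
    have "norm v \<le> norm ?T + norm (v - ?T)" using norm_triangle_ineq[of ?T "v - ?T"] by simp
    also have "\<dots> < 2 * T" using v T1 by (simp add: dist_norm norm_minus_commute)
    also have "\<dots> = norm w * (2 / cos \<psi>)" by (simp add: T_def)
    finally have "ln (norm v) < ln (norm w * (2 / cos \<psi>))" using v0 cs(1) by (subst ln_less_cancel_iff) (auto simp: w_def)
    also have "\<dots> = (Re \<zeta> - ln r) / \<gamma> + ln (2 / cos \<psi>)" using cs by (subst ln_mult_pos) (auto simp: nw)
    finally have "\<gamma> * ln (norm v) < \<gamma> * ((Re \<zeta> - ln r) / \<gamma> + ln (2 / cos \<psi>))" using \<gamma> by simp
    also have "\<dots> = Re \<zeta> - ln r + \<gamma> * ln (2 / cos \<psi>)" using \<gamma> by (simp add: distrib_left)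
    also have "\<gamma> * ln (2 / cos \<psi>) \<le> 2 * ln (2 / cos \<psi>)" using \<gamma> cs(1) cos2 by (intro mult_right_mono) auto
    finally show "Re (\<Phi> v) < ln R" using R v0 by (simp add: \<Phi>_def)
  qed
  have E_hol: "E holomorphic_on ball ?T T"
  proof -
    have "(D \<circ> (\<lambda>v. - exp (\<Phi> v))) holomorphic_on ball ?T T"
    proof (rule holomorphic_on_compose_gen[OF _ hol])
      have "v \<notin> \<real>\<^sub>\<le>\<^sub>0" if "v \<in> ball ?T T" for v
        using Re_pos[OF that] by (auto simp: complex_nonpos_Reals_iff)
      then show "(\<lambda>v. - exp (\<Phi> v)) holomorphic_on ball ?T T"
        unfolding \<Phi>_def by (intro holomorphic_intros) auto
    qed (use inU in auto)
    then show ?thesis by (simp add: E_def[abs_def] o_def)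
  qed
  have E_nz: "E v \<noteq> 0" and E_le: "norm (E v) < exp B" if "v \<in> ball ?T T" for v
    using inU[OF that] nz le by (auto simp: E_def)
  note har = harnack_nonvanishing[OF E_hol E_nz E_le]
  have Re_w: "norm w * cos \<psi> \<le> Re w"
  proof -
    have "\<bar>Im \<zeta> / \<gamma>\<bar> \<le> \<psi>" using \<zeta>(1) \<gamma> by (simp add: \<psi>_def \<gamma>_def[symmetric] divide_right_mono)
    then have "cos \<psi> \<le> cos \<bar>Im \<zeta> / \<gamma>\<bar>" using \<psi> by (intro cos_monotone_0_pi_le) auto
    then have "cos \<psi> \<le> cos (Im \<zeta> / \<gamma>)" by (metis cos_abs_real)
    then show ?thesis by (simp add: nw w_def Re_exp)
  qed
  have dist_w: "dist ?T w \<le> T * sin \<psi>"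
  proof (rule power2_le_imp_le)
    have "(dist ?T w)\<^sup>2 = (norm w)\<^sup>2 - 2 * T * Re w + T\<^sup>2"
      unfolding dist_norm cmod_power2 by (simp add: power2_eq_square algebra_simps)
    also have "\<dots> \<le> (norm w)\<^sup>2 - 2 * T * (norm w * cos \<psi>) + T\<^sup>2" using Re_w T1 by simp
    also have "\<dots> = T\<^sup>2 * (1 - (cos \<psi>)\<^sup>2)" by (simp add: nwT power2_eq_square algebra_simps)
    also have "\<dots> = (T * sin \<psi>)\<^sup>2" by (simp add: sin_squared_eq power_mult_distrib)
    finally show "(dist ?T w)\<^sup>2 \<le> (T * sin \<psi>)\<^sup>2" .
  qed (use T1 cs in auto)
  have w_ball: "w \<in> ball ?T T"
  proof -
    have "T * sin \<psi> < T * 1" using T1 cs by (intro mult_strict_left_mono) auto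
    then show ?thesis using dist_w by simp
  qed
  have one_ball: "1 \<in> ball ?T T" and dist1: "dist ?T 1 = T - 1"
  proof -
    have "dist ?T 1 = norm (complex_of_real (T - 1))" by (simp add: dist_norm)
    then show "dist ?T 1 = T - 1" using T1 by (simp del: of_real_diff)
    then show "1 \<in> ball ?T T" using T1 by simp
  qed
  let ?h = "\<lambda>v. B - ln (norm (E v))"
  have h_pos: "0 \<le> ?h v" if "v \<in> ball ?T T" for v
    using E_le[OF that] E_nz[OF that]
    by (metis diff_ge_0_iff_ge less_imp_le ln_exp ln_less_cancel_iff zero_less_norm_iff exp_gt_zero)
  have T_ball: "?T \<in> ball ?T T" using T1 by simp
  \<comment> \<open>Harnack is applied twice. Passing from 1, at distance 1 from the boundary, to
    the centre costs a factor \<open>2 * T\<close>; passing from the centre to \<open>w\<close>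
    costs \<open>2 / (1 - sin \<psi>)\<close>.\<close>
  have hT: "?h ?T \<le> 2 * T * ?h 1"
  proof -
    have "?h ?T * (T - (T - 1)) \<le> ?h 1 * (T + (T - 1))"
      using har(2)[OF _ _ one_ball] by (simp only: dist1)
    also have "\<dots> \<le> ?h 1 * (2 * T)" using h_pos[OF one_ball] by (intro mult_left_mono) auto
    finally show ?thesis by (simp add: algebra_simps)
  qed
  have "?h w * (T * (1 - sin \<psi>)) \<le> ?h w * (T - dist ?T w)"
    using dist_w h_pos[OF w_ball] by (intro mult_left_mono) (auto simp: algebra_simps)
  also have "\<dots> \<le> ?h ?T * (T + dist ?T w)" using har(1)[OF _ _ w_ball] by simp
  also have "\<dots> \<le> ?h ?T * (2 * T)" using w_ball h_pos[OF T_ball] by (intro mult_left_mono) auto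
  finally have "(?h w * (1 - sin \<psi>)) * T \<le> (?h ?T * 2) * T" by (simp only: mult.assoc mult.commute[of T])
  then have "?h w * (1 - sin \<psi>) \<le> ?h ?T * 2" using T1 by (simp only: mult_le_cancel_right)
  also have "\<dots> \<le> 2 * T * ?h 1 * 2" using hT by simp
  finally have "?h w \<le> 4 * T * ?h 1 / (1 - sin \<psi>)" using cs by (simp add: field_simps)
  also have "\<dots> = 4 / (cos \<psi> * (1 - sin \<psi>)) * norm w * ?h 1" by (simp add: T_def)
  finally have fin: "?h w \<le> 4 / (cos \<psi> * (1 - sin \<psi>)) * norm w * ?h 1" .
  have "Ln w = (\<zeta> - ln r) / \<gamma>"
  proof -
    have "\<bar>Im \<zeta> / \<gamma>\<bar> < pi"
    proof -
      have "\<bar>Im \<zeta> / \<gamma>\<bar> = \<bar>Im \<zeta>\<bar> / \<gamma>" using \<gamma> by simp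
      also have "\<dots> \<le> \<bar>Im \<zeta>\<bar> / 1" using \<gamma> by (intro divide_left_mono) auto
      finally show ?thesis using \<zeta>(1) \<delta> by linarith
    qed
    then have "- pi < Im \<zeta> / \<gamma>" "Im \<zeta> / \<gamma> \<le> pi" by linarith+
    then show ?thesis unfolding w_def by (intro Ln_exp) auto
  qed
  then have "\<Phi> w = \<zeta>" using \<gamma> by (simp add: \<Phi>_def)
  then have "E w = D (- exp \<zeta>)" by (simp add: E_def)
  moreover have "E 1 = D (- of_real r)" using r by (simp add: E_def \<Phi>_def exp_of_real)
  ultimately show ?thesis using fin by (simp add: nw)
qed

text \<open>Maximum principle for \<open>F \<circ> exp\<close> on a rectangle, with the damping factor
  \<open>exp (- 2 M exp (\<beta> (\<zeta> - ln R)))\<close>.\<close>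

lemma phragmen_lindelof_sector:
  fixes F :: "complex \<Rightarrow> complex"
  assumes \<beta>: "0 < \<beta>" "0 < \<theta>" "\<beta> * \<theta> \<le> pi / 3" and r: "0 < r" "r < R"
    and hol: "F holomorphic_on cball 0 R" and M: "0 \<le> M" and m: "0 \<le> m"
    and leM: "\<And>z. norm z \<le> R \<Longrightarrow> norm (F z) \<le> exp M"
    and side: "\<And>\<zeta>. \<bar>Im \<zeta>\<bar> = \<theta> \<Longrightarrow> ln r \<le> Re \<zeta> \<Longrightarrow> Re \<zeta> \<le> ln R \<Longrightarrow> norm (F (exp \<zeta>)) \<le> exp m"
    and inner: "\<And>z. norm z = r \<Longrightarrow> norm (F z) \<le> exp m"
    and \<zeta>: "\<bar>Im \<zeta>\<bar> \<le> \<theta>" "ln r \<le> Re \<zeta>" "Re \<zeta> \<le> ln R"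
  shows "norm (F (exp \<zeta>)) \<le> exp (m + 2 * M * exp (\<beta> * (Re \<zeta> - ln R)))"
proof -
  \<comment> \<open>On the right side of the rectangle the real part of the exponential is at least
    \<open>cos (\<beta> * \<theta>)\<close>, hence at least 1/2, and the factor cancels
    \<open>exp M\<close>. On the other sides its modulus is at most 1. Removing it at the end
    produces the second summand of the bound.\<close>
  define G where "G z = F (exp z) * exp (- (2 * M * exp (\<beta> * (z - ln R))))" for z :: complex
  define S where "S = cbox (Complex (ln r) (- \<theta>)) (Complex (ln R) \<theta>)"
  have S: "z \<in> S \<longleftrightarrow> ln r \<le> Re z \<and> Re z \<le> ln R \<and> \<bar>Im z\<bar> \<le> \<theta>" for z :: complex
    by (auto simp: S_def in_cbox_complex_iff)
  have exp_S: "norm (exp z) \<le> R" if "z \<in> S" for z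
    using that r S by (simp add: ln_ge_iff)
  have G_hol: "G holomorphic_on S"
  proof -
    have "(F \<circ> exp) holomorphic_on S"
      by (rule holomorphic_on_compose_gen[OF _ hol]) (use exp_S in \<open>auto intro!: holomorphic_intros\<close>)
    then show ?thesis unfolding G_def[abs_def] by (auto simp: o_def intro!: holomorphic_intros)
  qed
  have Re_e: "cos (\<beta> * \<theta>) * exp (\<beta> * (Re z - ln R)) \<le> Re (exp (\<beta> * (z - ln R)))" and half: "1 / 2 \<le> cos (\<beta> * \<theta>)"
    if "z \<in> S" for z :: complex
  proof -
    have bt: "\<beta> * \<theta> \<le> pi" using \<beta>(3) pi_gt_zero by linarith
    have "\<bar>\<beta> * Im z\<bar> \<le> \<beta> * \<theta>" using that S \<beta> by (simp add: abs_mult)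
    then have "cos (\<beta> * \<theta>) \<le> cos \<bar>\<beta> * Im z\<bar>" using \<beta> bt by (intro cos_monotone_0_pi_le) auto
    then have "cos (\<beta> * \<theta>) \<le> cos (\<beta> * Im z)" by (metis cos_abs_real)
    then have "cos (\<beta> * \<theta>) * exp (\<beta> * (Re z - ln R)) \<le> cos (\<beta> * Im z) * exp (\<beta> * (Re z - ln R))"
      by (intro mult_right_mono) auto
    then show "cos (\<beta> * \<theta>) * exp (\<beta> * (Re z - ln R)) \<le> Re (exp (\<beta> * (z - ln R)))"
      by (simp add: Re_exp mult.commute)
    have "cos (pi / 3) \<le> cos (\<beta> * \<theta>)" using \<beta> by (intro cos_monotone_0_pi_le) auto
    then show "1 / 2 \<le> cos (\<beta> * \<theta>)" by (simp add: cos_60)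
  qed
  have nG: "norm (G z) = norm (F (exp z)) * exp (- (2 * M * Re (exp (\<beta> * (z - ln R)))))" for z :: complex
    by (simp add: G_def norm_mult)
  have Re_nonneg: "0 \<le> Re (exp (\<beta> * (z - ln R)))" if "z \<in> S" for z :: complex
  proof -
    have "0 \<le> cos (\<beta> * \<theta>) * exp (\<beta> * (Re z - ln R))" using half[OF that] by simp
    then show ?thesis using Re_e[OF that] by simp
  qed
  have GF: "norm (G z) \<le> norm (F (exp z))" if "z \<in> S" for z
  proof -
    have "exp (- (2 * M * Re (exp (\<beta> * (z - ln R))))) \<le> 1" using Re_nonneg[OF that] M by simp
    then show ?thesis unfolding nG by (simp add: mult_left_le)
  qed
  have lnrR: "ln r < ln R" using r by simp
  have "norm (G \<zeta>) \<le> exp m"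
  proof (rule maximum_modulus_frontier[of G S])
    show "G holomorphic_on interior S" by (rule holomorphic_on_subset[OF G_hol interior_subset])
    have "closed S" by (simp add: S_def closed_cbox)
    then show "continuous_on (closure S) G" using G_hol by (simp add: holomorphic_on_imp_continuous_on)
    show "bounded S" by (simp add: S_def)
    show "\<zeta> \<in> S" using \<zeta> S by auto
    fix z assume z: "z \<in> frontier S"
    then have zS: "z \<in> S" using \<open>closed S\<close> by (simp add: frontier_def)
    have "z \<notin> box (Complex (ln r) (- \<theta>)) (Complex (ln R) \<theta>)"
      using z by (simp add: frontier_def S_def interior_cbox)
    then consider "\<bar>Im z\<bar> = \<theta>" | "Re z = ln r" | "Re z = ln R"
      using zS S[of z] by (auto simp: in_box_complex_iff)
    then show "norm (G z) \<le> exp m"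
    proof cases
      case 1
      then show ?thesis using order_trans[OF GF[OF zS] side[of z]] zS S[of z] by blast
    next
      case 2
      then have "norm (exp z) = r" using r by simp
      then show ?thesis by (rule order_trans[OF GF[OF zS] inner])
    next
      case 3
      then have "1 / 2 \<le> Re (exp (\<beta> * (z - ln R)))" using Re_e[OF zS] half[OF zS] by simp
      then have "2 * M * (1 / 2) \<le> 2 * M * Re (exp (\<beta> * (z - ln R)))" using M by (intro mult_left_mono) auto
      then have "exp (- (2 * M * Re (exp (\<beta> * (z - ln R))))) \<le> exp (- M)" by simp
      then have "norm (G z) \<le> exp M * exp (- M)"
        unfolding nG using leM[OF exp_S[OF zS]] by (intro mult_mono) auto
      also have "\<dots> \<le> exp m" using m by (simp add: exp_minus)
      finally show ?thesis .
    qed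
  qed
  then have "norm (F (exp \<zeta>)) * exp (- (2 * M * Re (exp (\<beta> * (\<zeta> - ln R))))) * exp (2 * M * Re (exp (\<beta> * (\<zeta> - ln R))))
      \<le> exp m * exp (2 * M * Re (exp (\<beta> * (\<zeta> - ln R))))"
    unfolding nG[symmetric] by (intro mult_right_mono) auto
  then have "norm (F (exp \<zeta>)) \<le> exp (m + 2 * M * Re (exp (\<beta> * (\<zeta> - ln R))))"
    by (simp add: mult.assoc exp_add[symmetric])
  also have "\<dots> \<le> exp (m + 2 * M * exp (\<beta> * (Re \<zeta> - ln R)))"
    using M complex_Re_le_cmod[of "exp (\<beta> * (\<zeta> - ln R))"] by (simp add: mult_left_mono)
  finally show ?thesis .
qed

text \<open>Pigeonhole: \<open>n + 1\<close> disjoint intervals of length \<open>2 * h\<close> fill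
  the interval from \<open>R / 2\<close> to \<open>R\<close>, and each of the at most
  \<open>n\<close> given points comes within less than \<open>h\<close> of at most one of their
  midpoints.\<close>

lemma exists_point_away_from_finite_set:
  fixes R :: real
  assumes "finite X" "card X \<le> n" "0 < R"
  obtains x where "R / 2 \<le> x" "x \<le> R" "\<And>y. y \<in> X \<Longrightarrow> R / (4 * (n + 1)) \<le> \<bar>x - y\<bar>"
proof -
  define h where "h = R / (4 * (real n + 1))"
  define x where "x j = R / 2 + (2 * real j + 1) * h" for j :: nat
  have h: "0 < h" "(4 * real n + 4) * h = R" using assms by (auto simp: h_def field_simps)
  have "\<exists>j\<le>n. \<forall>y\<in>X. h \<le> \<bar>x j - y\<bar>"
  proof (rule ccontr)
    assume "\<not> ?thesis"
    then have "\<forall>j\<in>{..n}. \<exists>y. y \<in> X \<and> \<bar>x j - y\<bar> < h" by (meson not_le atMost_iff)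
    from bchoice[OF this] obtain y where "\<forall>j\<in>{..n}. y j \<in> X \<and> \<bar>x j - y j\<bar> < h" by (elim exE)
    then have y: "y j \<in> X \<and> \<bar>x j - y j\<bar> < h" if "j \<le> n" for j using that by simp
    have "inj_on y {..n}"
    proof (rule inj_onI)
      fix i j assume "i \<in> {..n}" "j \<in> {..n}" "y i = y j"
      then have "\<bar>x i - x j\<bar> < 2 * h" using y[of i] y[of j] by (simp add: abs_less_iff)
      moreover have "\<bar>x i - x j\<bar> = \<bar>(real i - real j) * (2 * h)\<bar>" by (simp add: x_def algebra_simps)
      ultimately have "\<bar>real i - real j\<bar> * (2 * h) < 1 * (2 * h)"
        using h(1) by (simp add: abs_mult)
      then have "\<bar>real i - real j\<bar> < 1" using h(1) by (simp only: mult_less_cancel_right)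
      then show "i = j" by linarith
    qed
    then have "card {..n} \<le> card X" using assms(1) y card_inj_on_le[of y "{..n}" X] by fastforce
    then show False using assms(2) by simp
  qed
  then obtain j where jn: "j \<le> n" "\<forall>y\<in>X. h \<le> \<bar>x j - y\<bar>" by (elim exE conjE)
  note j = jn(1) bspec[OF jn(2)]
  have "(2 * real j + 1) * h \<le> (2 * real n + 2) * h" using j(1) h(1) by (intro mult_right_mono) auto
  then have "x j \<le> R" using h(2) by (simp add: x_def algebra_simps)
  moreover have "R / 2 \<le> x j" using h(1) by (simp add: x_def)
  ultimately show thesis using that[of "x j"] j(2) by (simp add: h_def add.commute)
qed

section \<open>Growth of quotients of entire functions\<close>

text \<open>\<open>P\<close> stands for the determinant of the section of size \<open>N\<close>,
  zero-free on the disc of radius \<open>R\<close>. In \<open>P_le\<close> the distance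
  \<open>c\<close> is left free because it is used at two scales: a constant in the slit sector and
  near 0, and a quantity of order 1/n on a circle passing between the zeros of the
  numerator.\<close>

locale zero_free_perturbation =
  fixes P :: "complex \<Rightarrow> complex" and lam :: "nat \<Rightarrow> real" and N :: nat and R C q b :: real
  assumes P_hol: "\<And>S. P holomorphic_on S" and P_0: "P 0 = 1"
    and P_nz: "\<And>z. norm z \<le> R \<Longrightarrow> P z \<noteq> 0"
    and R_pos: "0 < R" and C_nonneg: "0 \<le> C" and q_pos: "0 < q" and b_pos: "0 < b"
    and lam_pos: "\<And>l. l < N \<Longrightarrow> 0 < lam l" and lam_le: "\<And>l. l < N \<Longrightarrow> lam l \<le> b"
    and P_le: "\<And>z c. 0 < c \<Longrightarrow> (\<And>l. l < N \<Longrightarrow> c \<le> norm (1 - z * complex_of_real (lam l))) \<Longrightarrow>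
      norm (P z) \<le> (\<Prod>l\<in>{0..<N}. norm (1 - z * complex_of_real (lam l))) * exp (C * (norm z / c) powr q)"
begin

definition "F z = (\<Prod>l\<in>{0..<N}. 1 - z * complex_of_real (lam l)) / P z"

lemma F_hol: "F holomorphic_on cball 0 R"
  unfolding F_def using P_nz by (auto intro!: holomorphic_intros P_hol)

lemma norm_F_nonzero_bound:
  assumes "0 < c" "\<And>l. l < N \<Longrightarrow> c \<le> norm (1 - z * complex_of_real (lam l))"
  shows "norm (inverse (F z)) \<le> exp (C * (norm z / c) powr q)"
proof -
  have "0 < norm (1 - z * complex_of_real (lam l))" if "l < N" for l using assms(1) assms(2)[OF that] by linarith
  then have pos: "0 < (\<Prod>l\<in>{0..<N}. norm (1 - z * complex_of_real (lam l)))" by (intro prod_pos) auto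
  have "norm (inverse (F z)) = norm (P z) / (\<Prod>l\<in>{0..<N}. norm (1 - z * complex_of_real (lam l)))"
    by (simp add: F_def norm_divide prod_norm)
  also have "\<dots> \<le> exp (C * (norm z / c) powr q)"
    using P_le[OF assms] pos by (simp add: divide_le_eq mult.commute)
  finally show ?thesis .
qed

text \<open>Jensen's inequality, by dividing out the zeros of the numerator in the disc of radius \<open>r / 3\<close>.\<close>

lemma zero_count_le:
  assumes r: "0 < r" "r \<le> R" and le: "\<And>z. norm z = r \<Longrightarrow> norm (F z) \<le> exp m"
  shows "real (card {l\<in>{0..<N}. 3 / r \<le> lam l}) * ln 2 \<le> m"
proof -
  define I where "I = {l\<in>{0..<N}. 3 / r \<le> lam l}"
  define J where "J = {0..<N} - I"
  have IJ: "finite I" "finite J" "I \<inter> J = {}" "{0..<N} = I \<union> J" by (auto simp: I_def J_def)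
  define G where "G z = (\<Prod>l\<in>J. 1 - z * complex_of_real (lam l)) / P z" for z
  have FG: "F z = (\<Prod>l\<in>I. 1 - z * complex_of_real (lam l)) * G z" for z
    unfolding F_def G_def IJ(4) using IJ by (simp add: prod.union_disjoint)
  have G_hol: "G holomorphic_on cball 0 r"
    unfolding G_def using P_nz r by (auto intro!: holomorphic_intros P_hol)
  have "norm (G 0) \<le> exp m / 2 ^ card I"
  proof (rule norm_le_on_cball[OF G_hol r(1)])
    fix z :: complex assume z: "norm z = r"
    \<comment> \<open>The threshold \<open>3 / r\<close> makes \<open>norm (z * lam l)\<close> at
      least 3 on the circle, so each removed factor has modulus at least 2 there. At 0 it equals 1,
      which leaves \<open>G 0 = 1\<close>.\<close>
    have "2 ^ card I = (\<Prod>l\<in>I. 2::real)" by simp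
    also have "\<dots> \<le> (\<Prod>l\<in>I. norm (1 - z * complex_of_real (lam l)))"
    proof (rule prod_mono, intro conjI)
      fix l assume l: "l \<in> I"
      then have "3 \<le> r * lam l" using r by (simp add: I_def field_simps)
      moreover have "norm (z * complex_of_real (lam l)) = r * lam l" using z lam_pos[of l] l by (simp add: norm_mult I_def)
      moreover have "norm (z * complex_of_real (lam l)) - norm (1::complex) \<le> norm (1 - z * complex_of_real (lam l))"
        by (metis norm_minus_commute norm_triangle_ineq2)
      ultimately show "2 \<le> norm (1 - z * complex_of_real (lam l))" by simp
    qed simp
    finally have "2 ^ card I * norm (G z) \<le> norm (F z)"
      unfolding FG norm_mult prod_norm[symmetric] by (intro mult_right_mono) auto
    also have "\<dots> \<le> exp m" by (rule le[OF z])
    finally show "norm (G z) \<le> exp m / 2 ^ card I" by (simp add: field_simps)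
  qed (use r in auto)
  then have "2 ^ card I \<le> exp m" by (simp add: G_def P_0 field_simps)
  then have "ln (2 ^ card I) \<le> ln (exp m)" by (subst ln_le_cancel_iff) auto
  then show ?thesis by (simp add: ln_realpow I_def)
qed

text \<open>On a circle which keeps away from the zeros of the numerator, \<open>F\<close> splits into the factors with zeros
  in the disc and a zero-free part, to which Harnack's inequality applies.\<close>

lemma F_a_priori:
  assumes n: "card {l\<in>{0..<N}. 1 / (2 * R) \<le> lam l} = n" and z: "norm z \<le> R / 4"
  shows "norm (F z) \<le> exp (3 * (n * ln (1 + R * b) + C * (8 * (n + 1) * R) powr q + 1))"
proof -
  define I where "I = {l\<in>{0..<N}. 1 / (2 * R) \<le> lam l}"
  define J where "J = {0..<N} - I"
  have IJ: "finite I" "finite J" "I \<inter> J = {}" "{0..<N} = I \<union> J" by (auto simp: I_def J_def)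
  have cI: "card I = n" using n by (simp add: I_def)
  \<comment> \<open>The first summand bounds the factors with zeros near the disc, the second the
    determinant on the chosen circle. The final 1 makes the bound on \<open>d\<close> strict, as
    Harnack's inequality requires.\<close>
  define U where "U = n * ln (1 + R * b) + C * (8 * (n + 1) * R) powr q + 1"
  have "card ((\<lambda>l. 1 / lam l) ` I) \<le> n" using cI IJ(1) card_image_le by blast
  then obtain R' where R': "R / 2 \<le> R'" "R' \<le> R"
      "\<And>y. y \<in> (\<lambda>l. 1 / lam l) ` I \<Longrightarrow> R / (4 * (n + 1)) \<le> \<bar>R' - y\<bar>"
    using exists_point_away_from_finite_set[of "(\<lambda>l. 1 / lam l) ` I" n R] IJ(1) R_pos by auto
  have R'_pos: "0 < R'" using R' R_pos by simp
  have J_small: "norm (z * complex_of_real (lam l)) < 1 / 2" if "l \<in> J" "norm z \<le> R" for l and z :: complex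
  proof -
    have "lam l < 1 / (2 * R)" "0 < lam l" using that lam_pos[of l] by (auto simp: J_def I_def)
    note l = this
    have "norm z * lam l \<le> R * lam l" using that l by (intro mult_right_mono) auto
    also have "\<dots> < R * (1 / (2 * R))" using R_pos l by (intro mult_strict_left_mono) auto
    also have "\<dots> = 1 / 2" using R_pos by simp
    finally show ?thesis using l by (simp add: norm_mult)
  qed
  \<comment> \<open>For \<open>l \<in> I\<close> this is the gap \<open>R / (4 * (n + 1))\<close>
    between \<open>R'\<close> and \<open>1 / lam l\<close>, times
    \<open>lam l \<ge> 1 / (2 * R)\<close>; for the other indices \<open>norm (z * lam l)\<close>
    stays below 1/2.\<close>
  have far: "1 / (8 * (n + 1)) \<le> norm (1 - z * complex_of_real (lam l))" if z: "norm z = R'" and l: "l < N" for z :: complex and l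
  proof (cases "l \<in> I")
    case True
    have l0: "0 < lam l" using lam_pos[OF l] .
    have "1 / (8 * (real n + 1)) = R / (4 * (real n + 1)) * (1 / (2 * R))" using R_pos by (simp add: field_simps)
    also have "\<dots> \<le> \<bar>R' - 1 / lam l\<bar> * lam l"
      using R'(3)[of "1 / lam l"] True R_pos by (intro mult_mono) (auto simp: I_def add.commute)
    also have "\<dots> = \<bar>(R' - 1 / lam l) * lam l\<bar>" using l0 by (simp add: abs_mult)
    also have "(R' - 1 / lam l) * lam l = R' * lam l - 1" using l0 by (simp add: field_simps)
    also have "\<bar>R' * lam l - 1\<bar> = \<bar>norm (z * complex_of_real (lam l)) - norm (1::complex)\<bar>"
      using z l0 by (simp add: norm_mult)
    also have "\<dots> \<le> norm (1 - z * complex_of_real (lam l))" by (metis norm_minus_commute norm_triangle_ineq3)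
    finally show ?thesis by (simp add: add.commute)
  next
    case False
    then have "norm (z * complex_of_real (lam l)) < 1 / 2" using l z R' by (intro J_small) (auto simp: J_def)
    moreover have "norm (1::complex) - norm (z * complex_of_real (lam l)) \<le> norm (1 - z * complex_of_real (lam l))" by (rule norm_triangle_ineq2)
    moreover have "1 / real (8 * (n + 1)) \<le> 1 / 2" "norm (1::complex) = 1" by (auto simp: field_simps)
    ultimately show ?thesis by linarith
  qed
  have p_le: "norm (\<Prod>l\<in>I. 1 - z * complex_of_real (lam l)) \<le> exp (n * ln (1 + R * b))" if z: "norm z \<le> R" for z :: complex
  proof -
    have "norm (\<Prod>l\<in>I. 1 - z * complex_of_real (lam l)) = (\<Prod>l\<in>I. norm (1 - z * complex_of_real (lam l)))" by (simp add: prod_norm)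
    also have "\<dots> \<le> (\<Prod>l\<in>I. 1 + R * b)"
    proof (intro prod_mono conjI)
      fix l assume l: "l \<in> I"
      then have "l < N" by (simp add: I_def)
      have "norm (1 - z * complex_of_real (lam l)) \<le> norm (1::complex) + norm (z * complex_of_real (lam l))" by (rule norm_triangle_ineq4)
      also have "norm (z * complex_of_real (lam l)) \<le> R * b"
        using z lam_pos[OF \<open>l < N\<close>] lam_le[OF \<open>l < N\<close>] R_pos by (auto simp: norm_mult intro!: mult_mono)
      finally show "norm (1 - z * complex_of_real (lam l)) \<le> 1 + R * b" by simp
    qed simp
    also have "\<dots> = exp (ln (1 + R * b)) ^ n" using R_pos b_pos cI by (simp add: add_pos_pos)
    also have "\<dots> = exp (n * ln (1 + R * b))" by (simp only: exp_of_nat_mult)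
    finally show ?thesis .
  qed
  \<comment> \<open>Here \<open>F\<close> is the product over \<open>I\<close> divided by
    \<open>d\<close>, so a lower bound for \<open>d\<close> is wanted. It is zero-free with
    \<open>d 0 = 1\<close>; since \<open>norm z\<close> is at most half of \<open>R'\<close>,
    Harnack's factor is at most 3, and the upper bound \<open>exp U\<close> turns into the lower
    bound \<open>exp (- (2 * U))\<close>.\<close>
  define d where "d z = P z / (\<Prod>l\<in>J. 1 - z * complex_of_real (lam l))" for z
  have Q_nz: "(\<Prod>l\<in>J. 1 - z * complex_of_real (lam l)) \<noteq> 0" if z: "norm z \<le> R" for z :: complex
  proof -
    have "1 - z * complex_of_real (lam l) \<noteq> 0" if "l \<in> J" for l
    proof
      assume "1 - z * complex_of_real (lam l) = 0"
      then have "norm (z * complex_of_real (lam l)) = 1" by (metis norm_one right_minus_eq)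
      then show False using J_small[OF that z] by simp
    qed
    then show ?thesis using IJ by simp
  qed
  have d_hol: "d holomorphic_on cball 0 R'"
    unfolding d_def using Q_nz R' by (auto intro!: holomorphic_intros P_hol)
  have d_nz: "d z \<noteq> 0" if "norm z \<le> R" for z using P_nz[OF that] Q_nz[OF that] by (simp add: d_def)
  have d_le: "norm (d z) \<le> exp (U - 1)" if "norm z \<le> R'" for z
  proof (rule norm_le_on_cball[OF d_hol R'_pos _ that])
    fix z :: complex assume z: "norm z = R'"
    have zR: "norm z \<le> R" using z R' by simp
    have "norm (P z) \<le> (\<Prod>l\<in>{0..<N}. norm (1 - z * complex_of_real (lam l))) * exp (C * (norm z / (1 / (8 * (n + 1)))) powr q)"
      by (rule P_le[OF _ far[OF z]]) auto
    also have "(\<Prod>l\<in>{0..<N}. norm (1 - z * complex_of_real (lam l))) = norm (\<Prod>l\<in>I. 1 - z * complex_of_real (lam l)) * norm (\<Prod>l\<in>J. 1 - z * complex_of_real (lam l))"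
      unfolding IJ(4) using IJ by (simp add: prod.union_disjoint prod_norm norm_mult)
    finally have "norm (d z) \<le> norm (\<Prod>l\<in>I. 1 - z * complex_of_real (lam l)) * exp (C * (norm z / (1 / (8 * (n + 1)))) powr q)"
      using Q_nz[OF zR] by (simp add: d_def norm_divide divide_le_eq mult_ac)
    also have "\<dots> \<le> exp (n * ln (1 + R * b)) * exp (C * (8 * (n + 1) * R) powr q)"
    proof (rule mult_mono[OF p_le[OF zR]])
      have "norm z / (1 / (8 * (real n + 1))) \<le> 8 * (real n + 1) * R" using zR by (simp add: mult.commute mult_left_mono)
      then have "(norm z / (1 / (8 * (real n + 1)))) powr q \<le> (8 * (real n + 1) * R) powr q"
        using q_pos by (intro powr_mono2) auto
      then show "exp (C * (norm z / (1 / (8 * (n + 1)))) powr q) \<le> exp (C * (8 * (n + 1) * R) powr q)"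
        using C_nonneg by (simp add: mult_left_mono add.commute)
    qed auto
    also have "\<dots> = exp (U - 1)" by (simp add: U_def exp_add)
    finally show "norm (d z) \<le> exp (U - 1)" .
  qed
  have zR: "norm z \<le> R" "norm z \<le> R' / 2" using z R' R_pos by auto
  have zb: "z \<in> ball 0 R'" using zR R'_pos by simp
  have "(U - ln (norm (d z))) * (R' - dist 0 z) \<le> (U - ln (norm (d 0))) * (R' + dist 0 z)"
  proof (rule harnack_nonvanishing(1)[OF _ _ _ zb])
    show "d holomorphic_on ball 0 R'" using d_hol by (rule holomorphic_on_subset) auto
    show "d w \<noteq> 0" if "w \<in> ball 0 R'" for w using that R' by (intro d_nz) auto
    show "norm (d w) < exp U" if "w \<in> ball 0 R'" for w
      using d_le[of w] that by (simp add: le_less_trans)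
  qed
  moreover have "d 0 = 1" by (simp add: d_def P_0)
  moreover have U0: "0 \<le> U"
    unfolding U_def using C_nonneg R_pos b_pos by (intro add_nonneg_nonneg mult_nonneg_nonneg) auto
  moreover have "U * (R' + norm z) \<le> U * (3 * (R' - norm z))" using zR U0 by (intro mult_left_mono) auto
  ultimately have "(U - ln (norm (d z))) * (R' - norm z) \<le> (3 * U) * (R' - norm z)"
    by (simp add: mult.assoc mult.left_commute)
  then have "U - ln (norm (d z)) \<le> 3 * U" using zR R'_pos by (simp add: mult_le_cancel_right)
  then have dz: "exp (- (2 * U)) \<le> norm (d z)"
    using d_nz[OF zR(1)] by (subst ln_ge_iff[symmetric]) auto
  have "F z = (\<Prod>l\<in>I. 1 - z * complex_of_real (lam l)) / d z"
    unfolding F_def d_def IJ(4) using IJ by (simp add: prod.union_disjoint)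
  then have "norm (F z) = norm (\<Prod>l\<in>I. 1 - z * complex_of_real (lam l)) / norm (d z)" by (simp add: norm_divide)
  also have "\<dots> \<le> exp (n * ln (1 + R * b)) / exp (- (2 * U))"
    using p_le[OF zR(1)] dz by (intro frac_le) auto
  also have "\<dots> \<le> exp (3 * U)"
  proof -
    have "n * ln (1 + R * b) \<le> U" using C_nonneg by (simp add: U_def)
    then show ?thesis by (simp add: exp_diff[symmetric])
  qed
  finally show ?thesis by (simp add: U_def add.commute)
qed

text \<open>Where \<open>norm (z * lam l)\<close> is at most 1/2 no factor of the numerator
  vanishes, so Harnack's inequality applies on the full disc of radius \<open>2 * r\<close>, with
  factor 3 at radius \<open>r\<close>. This supplies the base point \<open>- r\<close> for the
  sector estimate and the bound on the inner arc; \<open>s \<le> 1 / 2\<close> lets the same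
  \<open>B\<close> serve here and in the sector.\<close>

lemma F_near_zero:
  assumes r: "2 * r * b \<le> 1 / 2" "0 < r" "2 * r \<le> R" and s: "0 < s" "s \<le> 1 / 2"
    and B: "C * (R / s) powr q < B" and z: "norm z \<le> r"
  shows "B - ln (norm (inverse (F z))) \<le> 3 * B"
proof -
  have half: "1 / 2 \<le> norm (1 - z * complex_of_real (lam l))" if "norm z \<le> 2 * r" "l < N" for z :: complex and l
  proof -
    have "norm (z * complex_of_real (lam l)) \<le> 2 * r * b"
      using that lam_pos[of l] lam_le[of l] r by (auto simp: norm_mult intro!: mult_mono)
    moreover have "norm (1::complex) - norm (z * complex_of_real (lam l)) \<le> norm (1 - z * complex_of_real (lam l))" by (rule norm_triangle_ineq2)
    ultimately show ?thesis using r by simp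
  qed
  have nz: "F z \<noteq> 0" if "norm z \<le> 2 * r" for z
  proof -
    have "P z \<noteq> 0" using that r P_nz by auto
    moreover have "1 - z * complex_of_real (lam l) \<noteq> 0" if "l < N" for l
      using half[OF \<open>norm z \<le> 2 * r\<close> that] by auto
    ultimately show ?thesis by (simp add: F_def)
  qed
  let ?D = "\<lambda>z. inverse (F z)"
  have "F holomorphic_on ball 0 (2 * r)" using F_hol by (rule holomorphic_on_subset) (use r in auto)
  then have hol: "?D holomorphic_on ball 0 (2 * r)" using nz by (intro holomorphic_on_inverse) auto
  have le: "norm (?D w) < exp B" if "w \<in> ball 0 (2 * r)" for w
  proof -
    have "norm (?D w) \<le> exp (C * (norm w / s) powr q)"
    proof (rule norm_F_nonzero_bound[OF s(1)])
      fix l assume "l < N"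
      then show "s \<le> norm (1 - w * complex_of_real (lam l))" using half[of w l] that s by simp
    qed
    also have "\<dots> \<le> exp (C * (R / s) powr q)"
      using that r s C_nonneg q_pos by (auto intro!: mult_left_mono powr_mono2 divide_right_mono)
    also have "\<dots> < exp B" using B by simp
    finally show ?thesis .
  qed
  have zb: "z \<in> ball 0 (2 * r)" using z r by simp
  have "(B - ln (norm (?D z))) * (2 * r - dist 0 z) \<le> (B - ln (norm (?D 0))) * (2 * r + dist 0 z)"
    by (rule harnack_nonvanishing(1)[OF hol _ le zb]) (use nz in auto)
  moreover have "?D 0 = 1" by (simp add: F_def P_0)
  moreover have "0 \<le> C * (R / s) powr q" using C_nonneg by simp
  then have B0: "0 \<le> B" using B by linarith
  moreover from B0 have "B * (2 * r + norm z) \<le> B * (3 * (2 * r - norm z))" using z r by (intro mult_left_mono) auto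
  ultimately have "(B - ln (norm (?D z))) * (2 * r - norm z) \<le> (3 * B) * (2 * r - norm z)"
    by (simp add: mult.assoc mult.left_commute)
  then show ?thesis using z r by (simp add: mult_le_cancel_right)
qed

end

text \<open>The point \<open>exp \<zeta> * t\<close> lies on a ray making an angle of at least
  \<delta> with the negative half-axis. The distance from such a ray to -1 is at least 1 in the
  right half-plane, and otherwise at least the length of the perpendicular,
  \<open>|sin (Im \<zeta>)|\<close>.\<close>

lemma sin_le_norm_one_plus_exp:
  fixes \<zeta> :: complex
  assumes \<delta>: "0 < \<delta>" "\<delta> \<le> pi / 2" and Im: "\<bar>Im \<zeta>\<bar> \<le> pi - \<delta>" and t: "0 < t"
  shows "sin \<delta> \<le> norm (1 + exp \<zeta> * complex_of_real t)"
proof (rule power2_le_imp_le)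
  define x where "x = t * exp (Re \<zeta>)"
  let ?y = "Im \<zeta>"
  have x: "0 < x" using t by (simp add: x_def)
  have "(norm (1 + exp \<zeta> * complex_of_real t))\<^sup>2 = (1 + x * cos ?y)\<^sup>2 + (x * sin ?y)\<^sup>2"
    unfolding cmod_power2 by (simp add: Re_exp Im_exp x_def mult_ac)
  also have "\<dots> = 1 + 2 * x * cos ?y + x\<^sup>2 * ((cos ?y)\<^sup>2 + (sin ?y)\<^sup>2)"
    by (simp add: power2_eq_square algebra_simps del: sin_cos_squared_add sin_cos_squared_add2 sin_cos_squared_add3)
  finally have eq: "(norm (1 + exp \<zeta> * complex_of_real t))\<^sup>2 = 1 + 2 * x * cos ?y + x\<^sup>2" by simp
  show "(sin \<delta>)\<^sup>2 \<le> (norm (1 + exp \<zeta> * complex_of_real t))\<^sup>2"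
  proof (cases "\<bar>?y\<bar> \<le> pi / 2")
    case True
    then have "0 \<le> cos ?y" by (intro cos_ge_zero) auto
    then have "1 \<le> 1 + 2 * x * cos ?y + x\<^sup>2" using x by simp
    moreover have "(sin \<delta>)\<^sup>2 \<le> 1" by (simp add: abs_square_le_1)
    ultimately show ?thesis using eq by linarith
  next
    case False
    have "sin \<delta> \<le> sin (pi - \<bar>?y\<bar>)" using False \<delta> Im by (intro sin_monotone_2pi_le) auto
    also have "\<dots> = \<bar>sin ?y\<bar>"
    proof -
      have "0 \<le> sin \<bar>?y\<bar>" using Im \<delta> by (intro sin_ge_zero) auto
      then show ?thesis by (simp add: abs_if split: if_splits)
    qed
    finally have "(sin \<delta>)\<^sup>2 \<le> \<bar>sin ?y\<bar>\<^sup>2" using \<delta> by (intro power_mono) (auto intro!: sin_ge_zero)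
    then have "(sin \<delta>)\<^sup>2 \<le> (sin ?y)\<^sup>2" by simp
    also have "\<dots> \<le> (x + cos ?y)\<^sup>2 + (sin ?y)\<^sup>2" by simp
    also have "\<dots> = x\<^sup>2 + 2 * x * cos ?y + ((cos ?y)\<^sup>2 + (sin ?y)\<^sup>2)"
      by (simp add: power2_sum algebra_simps del: sin_cos_squared_add sin_cos_squared_add2 sin_cos_squared_add3)
    also have "\<dots> = (norm (1 + exp \<zeta> * complex_of_real t))\<^sup>2" by (simp add: eq)
    finally show ?thesis .
  qed
qed simp

section \<open>Growth of the quotient on a smaller disc\<close>

context zero_free_perturbation
begin

text \<open>Harnack's inequality yields \<open>exp m\<close> at angular distance at least
  \<open>2 * \<delta>\<close> from the positive half-axis, and Phragmen-Lindelof fills the remaining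
  sector. The factor \<open>(cos \<psi> / 2)\<^sup>2\<close> in \<open>R\<^sub>1\<close> is the room
  taken up by the Harnack disc, and the extra 1/2 makes that inequality strict; the 3 in
  \<open>m\<close> comes from the value at the base point \<open>- r\<close>. The a priori bound
  \<open>exp M\<close> enters only as the bound on the outer arc.\<close>

lemma F_growth:
  fixes \<delta> \<beta> r B :: real
  defines "\<gamma> \<equiv> 2 - 2 * \<delta> / pi" and "\<psi> \<equiv> (pi - 2 * \<delta>) / (2 - 2 * \<delta> / pi)"
  defines "m \<equiv> 3 * (4 / (cos \<psi> * (1 - sin \<psi>))) * exp ((ln R - ln r) / \<gamma>) * B"
    and "R\<^sub>1 \<equiv> R * (cos \<psi> / 2)\<^sup>2 / 2" and "s \<equiv> min (sin \<delta>) (1 / 2)"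
  assumes \<delta>: "0 < \<delta>" "\<delta> < pi / 4" and \<beta>: "0 < \<beta>" "\<beta> * (2 * \<delta>) \<le> pi / 3"
    and r: "0 < r" "2 * r * b \<le> 1 / 2" "r < R\<^sub>1" and B: "C * (R / s) powr q < B"
    and M: "0 \<le> M" "\<And>z. norm z \<le> R / 4 \<Longrightarrow> norm (F z) \<le> exp M"
    and z: "r \<le> norm z" "norm z \<le> R\<^sub>1"
  shows "norm (F z) \<le> exp (m + 2 * M * exp (\<beta> * (ln (norm z) - ln R\<^sub>1)))"
proof -
  have \<gamma>: "1 < \<gamma>" "\<gamma> < 2" using \<delta> by (auto simp: \<gamma>_def field_simps)
  have \<psi>: "0 < \<psi>" "\<psi> < pi / 2"
  proof -
    show "0 < \<psi>" using \<delta> \<gamma> by (auto simp: \<psi>_def \<gamma>_def[symmetric])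
    have "\<gamma> * (pi / 2) = pi - \<delta>" by (simp add: \<gamma>_def field_simps)
    then have "pi - 2 * \<delta> < \<gamma> * (pi / 2)" using \<delta> by simp
    then show "\<psi> < pi / 2" using \<gamma> unfolding \<psi>_def \<gamma>_def[symmetric] by (simp add: field_simps)
  qed
  have cs: "0 < cos \<psi>" "cos \<psi> \<le> 1" "0 < sin \<psi>" "sin \<psi> < 1"
    using \<psi> sin_monotone_2pi[of \<psi> "pi / 2"] by (auto intro!: cos_gt_zero_pi sin_gt_zero2)
  define K where "K = 4 / (cos \<psi> * (1 - sin \<psi>))"
  have K: "1 \<le> K"
  proof -
    have "cos \<psi> * (1 - sin \<psi>) \<le> 1 * 1" using cs by (intro mult_mono) auto
    then show ?thesis using cs by (simp add: K_def le_divide_eq)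
  qed
  have cR: "(cos \<psi> / 2)\<^sup>2 \<le> 1 / 4" using cs by (simp add: power_divide power_le_one)
  have R1: "0 < R\<^sub>1" "R\<^sub>1 \<le> R / 8" "R\<^sub>1 < R * (cos \<psi> / 2)\<^sup>2"
    using R_pos cs mult_left_mono[OF cR, of R] by (auto simp: R\<^sub>1_def)
  have rR: "8 * r < R" using r R1 by simp
  have s: "0 < s" "s \<le> 1 / 2" "s \<le> sin \<delta>" using \<delta> by (auto simp: s_def intro!: sin_gt_zero)
  have "0 \<le> C * (R / s) powr q" using C_nonneg by simp
  then have B0: "0 < B" using B by linarith
  have e1: "1 \<le> exp ((ln R - ln r) / \<gamma>)" using rR r \<gamma> by simp
  have m_B: "3 * B \<le> m"
  proof -
    have "3 * B * 1 \<le> 3 * B * (K * exp ((ln R - ln r) / \<gamma>))"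
      using B0 mult_mono[OF K e1] K by (intro mult_left_mono) auto
    then show ?thesis by (simp add: m_def K_def[symmetric] mult_ac)
  qed
  have m0: "0 \<le> m" using m_B B0 by simp
  \<comment> \<open>The disc without a closed sector of half-angle \<delta> around the positive
    half-axis: there all factors \<open>1 - z * lam l\<close> stay away from 0, so \<open>F\<close>
    has no zeros.\<close>
  define U where "U = {z. norm z < R \<and> (\<exists>\<zeta>. z = - exp \<zeta> \<and> \<bar>Im \<zeta>\<bar> < pi - \<delta>)}"
  have sU: "s \<le> norm (1 - z * complex_of_real (lam l))" if "z \<in> U" "l < N" for z l
  proof -
    obtain \<zeta> where "z = - exp \<zeta>" "\<bar>Im \<zeta>\<bar> < pi - \<delta>" using \<open>z \<in> U\<close> by (auto simp: U_def)
    then show ?thesis using sin_le_norm_one_plus_exp[of \<delta> \<zeta> "lam l"] lam_pos[OF that(2)] \<delta> s by simp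
  qed
  have F_nz: "F z \<noteq> 0" if "z \<in> U" for z
  proof -
    have "1 - z * complex_of_real (lam l) \<noteq> 0" if "l < N" for l
      using sU[OF \<open>z \<in> U\<close> that] s by auto
    moreover have "P z \<noteq> 0" using that by (intro P_nz) (auto simp: U_def)
    ultimately show ?thesis by (simp add: F_def)
  qed
  let ?D = "\<lambda>z. inverse (F z)"
  have D_hol: "?D holomorphic_on U"
    using F_nz by (intro holomorphic_on_inverse holomorphic_on_subset[OF F_hol]) (auto simp: U_def)
  have D_le: "norm (?D z) < exp B" if "z \<in> U" for z
  proof -
    have "norm (?D z) \<le> exp (C * (norm z / s) powr q)"
      using sU[OF that] by (intro norm_F_nonzero_bound[OF s(1)])
    also have "\<dots> \<le> exp (C * (R / s) powr q)"
      using that s C_nonneg q_pos by (auto simp: U_def intro!: mult_left_mono powr_mono2 divide_right_mono)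
    also have "\<dots> < exp B" using B by simp
    finally show ?thesis .
  qed
  have near: "B - ln (norm (?D z)) \<le> 3 * B" if "norm z \<le> r" for z
    using r rR s B that by (intro F_near_zero[of r s]) auto
  have sector: "norm (F (- exp \<zeta>)) \<le> exp m"
    if \<zeta>: "\<bar>Im \<zeta>\<bar> \<le> pi - 2 * \<delta>" "ln r \<le> Re \<zeta>" "Re \<zeta> \<le> ln R\<^sub>1" for \<zeta>
  proof -
    have exp_less: "norm (exp \<xi>) < R" if "Re \<xi> < ln R" for \<xi>
      using that R_pos by (metis exp_less_cancel_iff exp_ln norm_exp_eq_Re)
    have lnR1: "ln R\<^sub>1 < ln R - 2 * ln (2 / cos \<psi>)"
    proof -
      have "ln R\<^sub>1 < ln (R * (cos \<psi> / 2)\<^sup>2)" using R1 by simp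
      also have "\<dots> = ln R + 2 * ln (cos \<psi> / 2)" using R_pos cs by (simp add: ln_mult_pos ln_realpow)
      also have "\<dots> = ln R - 2 * ln (2 / cos \<psi>)" using cs by (simp add: ln_div)
      finally show ?thesis .
    qed
    have \<zeta>U: "- exp \<zeta> \<in> U"
    proof -
      have "cos \<psi> \<le> 2" using cs(2) by linarith
      then have "0 \<le> ln (2 / cos \<psi>)" using cs(1) by simp
      then have "Re \<zeta> < ln R" using \<zeta> lnR1 by linarith
      then show ?thesis using exp_less[of \<zeta>] \<zeta> \<delta> by (auto simp: U_def)
    qed
    have "B - ln (norm (?D (- exp \<zeta>))) \<le> K * exp ((Re \<zeta> - ln r) / \<gamma>) * (B - ln (norm (?D (- of_real r))))"
      unfolding K_def \<psi>_def \<gamma>_def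
    proof (rule sector_harnack[OF \<delta> _ D_hol])
      show "- exp \<xi> \<in> U" if "\<bar>Im \<xi>\<bar> < pi - \<delta>" "Re \<xi> < ln R" for \<xi>
        using that exp_less[of \<xi>] by (auto simp: U_def)
      show "Re \<zeta> < ln R - 2 * ln (2 / cos ((pi - 2 * \<delta>) / (2 - 2 * \<delta> / pi)))"
        using \<zeta> lnR1 unfolding \<psi>_def by linarith
    qed (use F_nz D_le r \<zeta> in auto)
    also have "\<dots> \<le> K * exp ((Re \<zeta> - ln r) / \<gamma>) * (3 * B)"
      using near[of "- of_real r"] r K by (intro mult_left_mono) auto
    also have "\<dots> \<le> K * exp ((ln R - ln r) / \<gamma>) * (3 * B)"
    proof -
      have "ln R\<^sub>1 \<le> ln R" using R1 R_pos by simp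
      then have "Re \<zeta> \<le> ln R" using \<zeta> by linarith
      then show ?thesis using K B0 \<gamma> by (intro mult_right_mono mult_left_mono) (auto simp: divide_right_mono)
    qed
    also have "\<dots> = m" by (simp add: m_def K_def)
    finally have "- ln (norm (?D (- exp \<zeta>))) \<le> m" using B0 by linarith
    then have "ln (norm (F (- exp \<zeta>))) \<le> m" by (simp add: norm_inverse ln_inverse)
    then show ?thesis using F_nz[OF \<zeta>U] by (metis exp_le_cancel_iff exp_ln zero_less_norm_iff)
  qed
  have inner: "norm (F z) \<le> exp m" if "norm z = r" for z
  proof (cases "F z = 0")
    case False
    have "- ln (norm (?D z)) \<le> m" using near[of z] that m_B B0 by linarith
    then have "ln (norm (F z)) \<le> m" by (simp add: norm_inverse ln_inverse)
    then show ?thesis using False by (metis exp_le_cancel_iff exp_ln zero_less_norm_iff)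
  qed simp
  define \<zeta> where "\<zeta> = Ln z"
  have z0: "z \<noteq> 0" using z r by auto
  have exp_\<zeta>: "exp \<zeta> = z" using z0 by (simp add: \<zeta>_def)
  have Re_\<zeta>: "Re \<zeta> = ln (norm z)" using z0 by (simp add: \<zeta>_def)
  have Re_le: "ln r \<le> Re \<zeta>" "Re \<zeta> \<le> ln R\<^sub>1" using z r R1 z0 by (auto simp: Re_\<zeta>)
  have rot: "norm (F (exp \<xi>)) \<le> exp m"
    if \<xi>: "2 * \<delta> \<le> \<bar>Im \<xi>\<bar>" "\<bar>Im \<xi>\<bar> \<le> pi" "ln r \<le> Re \<xi>" "Re \<xi> \<le> ln R\<^sub>1" for \<xi>
  proof -
    \<comment> \<open>A shift by \<pi> towards the real line, matching the parametrization
      \<open>- exp\<close> of \<open>sector\<close>, in which the argument is measured from the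
      negative half-axis.\<close>
    define \<xi>' where "\<xi>' = \<xi> - (if 0 \<le> Im \<xi> then \<i> * pi else - (\<i> * pi))"
    have "exp \<xi>' = - exp \<xi>" by (simp add: \<xi>'_def exp_diff exp_add exp_minus)
    then have "- exp \<xi>' = exp \<xi>" by simp
    moreover have "\<bar>Im \<xi>'\<bar> \<le> pi - 2 * \<delta>" "Re \<xi>' = Re \<xi>" using \<xi> \<delta> by (auto simp: \<xi>'_def)
    ultimately show ?thesis using sector[of \<xi>'] \<xi> by simp
  qed
  have "norm (F (exp \<zeta>)) \<le> exp (m + 2 * M * exp (\<beta> * (Re \<zeta> - ln R\<^sub>1)))"
  proof (cases "\<bar>Im \<zeta>\<bar> \<le> 2 * \<delta>")
    case True
    show ?thesis
    proof (rule phragmen_lindelof_sector[OF \<beta>(1) _ \<beta>(2) r(1) r(3) _ M(1) m0 _ _ _ True Re_le])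
      show "F holomorphic_on cball 0 R\<^sub>1" by (rule holomorphic_on_subset[OF F_hol]) (use R1 R_pos in auto)
      show "norm (F z) \<le> exp M" if "norm z \<le> R\<^sub>1" for z using that R1 R_pos by (intro M(2)) auto
      show "norm (F (exp \<xi>)) \<le> exp m" if "\<bar>Im \<xi>\<bar> = 2 * \<delta>" "ln r \<le> Re \<xi>" "Re \<xi> \<le> ln R\<^sub>1" for \<xi>
        using that \<delta> by (intro rot) auto
    qed (use \<delta> inner in auto)
  next
    case False
    have "\<bar>Im \<zeta>\<bar> \<le> pi" using mpi_less_Im_Ln[OF z0] Im_Ln_le_pi[OF z0] by (simp add: \<zeta>_def abs_le_iff)
    then have "norm (F (exp \<zeta>)) \<le> exp m" using False Re_le by (intro rot) auto
    also have "\<dots> \<le> exp (m + 2 * M * exp (\<beta> * (Re \<zeta> - ln R\<^sub>1)))" using M by simp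
    finally show ?thesis .
  qed
  then show ?thesis by (simp add: exp_\<zeta> Re_\<zeta>)
qed

end

section \<open>Choice of parameters and contradiction between growth and number of zeros\<close>

lemma eventually_powr_dominates:
  fixes A B E a q x c :: real
  assumes lt: "a + q < x" "a < x" "0 < x" and c: "0 < c"
  shows "\<forall>\<^sub>F R in at_top. A * R powr a * (B * R powr q + 1) + E < c * R powr x"
proof -
  have "((\<lambda>R. A * B * R powr (a + q - x) + A * R powr (a - x) + E * R powr (- x)) \<longlongrightarrow> 0 + 0 + 0) at_top"
    using lt by (intro tendsto_add tendsto_mult_right_zero tendsto_neg_powr filterlim_ident) auto
  then have "((\<lambda>R. A * B * R powr (a + q - x) + A * R powr (a - x) + E * R powr (- x)) \<longlongrightarrow> 0) at_top" by simp
  then have "\<forall>\<^sub>F R in at_top. A * B * R powr (a + q - x) + A * R powr (a - x) + E * R powr (- x) < c"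
    using c by (rule order_tendstoD)
  then show ?thesis using eventually_gt_at_top[of 0]
  proof eventually_elim
    case (elim R)
    have p: "0 < R powr x" using elim by simp
    from elim(1) have "(A * B * R powr (a + q - x) + A * R powr (a - x) + E * R powr (- x)) * R powr x < c * R powr x"
      using p by (intro mult_strict_right_mono)
    moreover have "R powr (a + q - x) * R powr x = R powr a * R powr q" "R powr (a - x) * R powr x = R powr a"
      "R powr (- x) * R powr x = 1"
      using elim(2) by (simp_all add: powr_add[symmetric])
    ultimately show ?case by (simp add: distrib_right distrib_left mult.assoc mult.left_commute)
  qed
qed

text \<open>The zeros of \<open>F\<close> have density \<open>1 / \<alpha>\<close>, whereas \<open>F_growth\<close> bounds the order of \<open>F\<close> by
  \<open>1 / \<gamma> + q\<close>, which can be chosen arbitrarily close to \<open>1 / 2\<close>.\<close>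

theorem no_zero_free_perturbations:
  fixes lam :: "nat \<Rightarrow> real" and \<alpha> b\<^sub>1 b\<^sub>2 q\<^sub>0 :: real
  assumes \<alpha>: "0 < \<alpha>" "\<alpha> < 2" and b: "0 < b\<^sub>1" "0 < b\<^sub>2"
    and lower: "\<And>l. b\<^sub>1 * real (l + 1) powr - \<alpha> \<le> lam l"
    and upper: "\<And>l. lam l \<le> b\<^sub>2 * real (l + 1) powr - \<alpha>"
    and q\<^sub>0: "0 < q\<^sub>0"
    and family: "\<And>q. 0 < q \<Longrightarrow> q \<le> q\<^sub>0 \<Longrightarrow> \<exists>C\<ge>0. \<forall>R>0. \<exists>N\<^sub>0. \<forall>N\<ge>N\<^sub>0. \<exists>P.
      (\<forall>S. P holomorphic_on S) \<and> P 0 = 1 \<and> (\<forall>z. norm z \<le> R \<longrightarrow> P z \<noteq> 0) \<and>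
      (\<forall>z c. 0 < c \<longrightarrow> (\<forall>l<N. c \<le> norm (1 - z * complex_of_real (lam l))) \<longrightarrow>
        norm (P z) \<le> (\<Prod>l\<in>{0..<N}. norm (1 - z * complex_of_real (lam l))) * exp (C * (norm z / c) powr q))"
  shows False
proof -
  define \<rho> where "\<rho> = 1 / \<alpha>"
  have \<rho>: "1 / 2 < \<rho>" using \<alpha> by (simp add: \<rho>_def field_simps)
  \<comment> \<open>Half the surplus of the density exponent over 1/2. The choice of \<epsilon> then
    leaves the count of zeros at exponent \<open>1 / 2 + \<tau>\<close> after the loss
    \<open>R powr - \<epsilon>\<close> in the radius.\<close>
  define \<tau> where "\<tau> = (\<rho> - 1 / 2) / 2"
  have \<tau>: "0 < \<tau>" using \<rho> by (simp add: \<tau>_def)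
  define \<epsilon> where "\<epsilon> = \<tau> / \<rho>"
  have \<epsilon>: "0 < \<epsilon>" "(1 - \<epsilon>) * \<rho> = 1 / 2 + \<tau>" "\<epsilon> < 1"
    using \<tau> \<rho> by (auto simp: \<epsilon>_def \<tau>_def field_simps)
  \<comment> \<open>Chosen so that the damping \<open>(R powr - \<epsilon>) powr \<beta>\<close> is
    exactly the reciprocal of the growth \<open>R powr (\<rho> + 1)\<close> of the a priori exponent
    \<open>M\<close>.\<close>
  define \<beta> where "\<beta> = (\<rho> + 1) / \<epsilon>"
  have \<beta>: "0 < \<beta>" "\<epsilon> * \<beta> = \<rho> + 1" using \<epsilon> \<rho> by (auto simp: \<beta>_def)
  \<comment> \<open>The first bound keeps \<delta> below \<open>pi / 4\<close>, the second gives the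
    Phragmen-Lindelof condition on a sector of half-angle \<open>2 * \<delta>\<close>, the third
    makes \<open>1 / \<gamma>\<close> at most \<open>1 / 2 + \<tau> / 3\<close>.\<close>
  define \<delta> where "\<delta> = min (pi / 8) (min (pi / (6 * \<beta>)) (pi * \<tau> / 3))"
  have \<delta>8: "\<delta> \<le> pi / 8" by (simp add: \<delta>_def)
  have \<delta>: "0 < \<delta>" "\<delta> < pi / 4" using \<beta> \<tau> \<delta>8 pi_gt_zero by (simp add: \<delta>_def, linarith)
  have \<beta>\<delta>: "\<beta> * (2 * \<delta>) \<le> pi / 3"
  proof -
    have "\<delta> \<le> pi / (6 * \<beta>)" by (simp add: \<delta>_def)
    then show ?thesis using \<beta> by (simp add: field_simps)
  qed
  define \<gamma> where "\<gamma> = 2 - 2 * \<delta> / pi"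
  have \<gamma>: "1 < \<gamma>" using \<delta> by (simp add: \<gamma>_def field_simps)
  have inv_\<gamma>: "1 / \<gamma> \<le> 1 / 2 + \<tau> / 3"
  proof -
    define x where "x = \<delta> / pi"
    have "\<delta> \<le> pi * \<tau> / 3" by (simp add: \<delta>_def)
    then have x: "0 < x" "x \<le> 1 / 8" "x \<le> \<tau> / 3" using \<delta> \<delta>8 by (simp_all add: x_def field_simps)
    have "1 \<le> (1 / 2 + x) * (2 - 2 * x)" using x mult_nonneg_nonneg[of x "1 - 2 * x"] by (simp add: algebra_simps)
    then have "1 / (2 - 2 * x) \<le> 1 / 2 + x" using x by (simp add: divide_le_eq)
    moreover have "\<gamma> = 2 - 2 * x" by (simp add: \<gamma>_def x_def)
    ultimately show ?thesis using x(3) by simp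
  qed
  \<comment> \<open>With \<open>q \<le> \<tau> / 3\<close> the order \<open>1 / \<gamma> + q\<close>
    of the bound for \<open>F\<close> is at most \<open>1 / 2 + 2 * \<tau> / 3\<close>, below
    \<open>1 / 2 + \<tau>\<close>. The bound by 1 lets the \<open>q\<close>-th power in
    \<open>M\<close> be estimated linearly.\<close>
  define q where "q = min 1 (min q\<^sub>0 (\<tau> / 3))"
  have q: "0 < q" "q \<le> 1" "q \<le> q\<^sub>0" "q \<le> \<tau> / 3" using q\<^sub>0 \<tau> by (auto simp: q_def)
  obtain C where C: "0 \<le> C" and fam: "\<And>R. 0 < R \<Longrightarrow> \<exists>N\<^sub>0. \<forall>N\<ge>N\<^sub>0. \<exists>P.
      (\<forall>S. P holomorphic_on S) \<and> P 0 = 1 \<and> (\<forall>z. norm z \<le> R \<longrightarrow> P z \<noteq> 0) \<and>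
      (\<forall>z c. 0 < c \<longrightarrow> (\<forall>l<N. c \<le> norm (1 - z * complex_of_real (lam l))) \<longrightarrow>
        norm (P z) \<le> (\<Prod>l\<in>{0..<N}. norm (1 - z * complex_of_real (lam l))) * exp (C * (norm z / c) powr q))"
    using family[OF q(1) q(3)] by blast
  define \<psi> where "\<psi> = (pi - 2 * \<delta>) / (2 - 2 * \<delta> / pi)"
  define s where "s = min (sin \<delta>) (1 / 2)"
  have s: "0 < s" using \<delta> by (auto simp: s_def intro!: sin_gt_zero)
  define \<kappa> where "\<kappa> = (cos \<psi> / 2)\<^sup>2 / 2"
  have \<psi>: "0 < \<psi>" "\<psi> < pi / 2"
  proof -
    show "0 < \<psi>" using \<delta> \<gamma> by (auto simp: \<psi>_def \<gamma>_def[symmetric])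
    have "\<gamma> * (pi / 2) = pi - \<delta>" by (simp add: \<gamma>_def field_simps)
    then have "pi - 2 * \<delta> < \<gamma> * (pi / 2)" using \<delta> by simp
    then show "\<psi> < pi / 2" using \<gamma> unfolding \<psi>_def \<gamma>_def[symmetric] by (simp add: field_simps)
  qed
  have cs: "0 < cos \<psi>" "0 < sin \<psi>" "sin \<psi> < 1"
    using \<psi> sin_monotone_2pi[of \<psi> "pi / 2"] by (auto intro!: cos_gt_zero_pi sin_gt_zero2)
  have \<kappa>: "0 < \<kappa>" using cs by (simp add: \<kappa>_def)
  define r where "r = 1 / (4 * b\<^sub>2)"
  have r: "0 < r" "2 * r * b\<^sub>2 \<le> 1 / 2" using b by (auto simp: r_def)
  define K where "K = 3 * (4 / (cos \<psi> * (1 - sin \<psi>)))"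
  have K: "0 < K" using cs by (simp add: K_def)
  define B where "B R = C * (R / s) powr q + 1" for R :: real
  define m where "m R = K * exp ((ln R - ln r) / \<gamma>) * B R" for R :: real
  define D where "D = (2 * b\<^sub>2) powr \<rho>"
  define C\<^sub>U where "C\<^sub>U = D * b\<^sub>2 + C * (8 * (D + 1)) + 1"
  have D: "0 < D" using b by (simp add: D_def)
  have CU: "0 < C\<^sub>U" using D b C by (simp add: C\<^sub>U_def add_nonneg_pos)
  \<comment> \<open>The count of zeros is made at radius
    \<open>R\<^sub>2 = R\<^sub>1 * R powr - \<epsilon>\<close>: the left side estimates from below
    the zeros visible there, the right side is the exponent of the growth bound, in which
    \<open>6 * C\<^sub>U\<close> is what remains of the outer arc.\<close>
  have main: "((b\<^sub>1 * \<kappa> / 3) powr \<rho> * R powr ((1 - \<epsilon>) * \<rho>) - 1) * ln 2 \<le> m R + 6 * C\<^sub>U"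
    if R: "1 \<le> R" "r < R * \<kappa>" "r \<le> R * \<kappa> * R powr - \<epsilon>" for R
  proof -
    define R\<^sub>1 where "R\<^sub>1 = R * \<kappa>"
    define R\<^sub>2 where "R\<^sub>2 = R\<^sub>1 * R powr - \<epsilon>"
    have R0: "0 < R" using R by simp
    have R1: "0 < R\<^sub>1" using R0 \<kappa> by (simp add: R\<^sub>1_def)
    have R2: "0 < R\<^sub>2" "R\<^sub>2 \<le> R\<^sub>1"
    proof -
      show "0 < R\<^sub>2" using R1 R0 by (simp add: R\<^sub>2_def)
      have "R powr - \<epsilon> \<le> 1" using powr_mono[of "- \<epsilon>" 0 R] R \<epsilon> by simp
      then show "R\<^sub>2 \<le> R\<^sub>1" using R1 by (simp add: R\<^sub>2_def mult_left_le)
    qed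
    have "cos \<psi> / 2 \<le> 1" using cos_le_one[of \<psi>] by linarith
    then have "(cos \<psi> / 2)\<^sup>2 \<le> 1" using cs by (intro power_le_one) auto
    then have "\<kappa> \<le> 1" by (simp add: \<kappa>_def)
    then have R1R: "R\<^sub>1 \<le> R" using R0 by (simp add: R\<^sub>1_def mult_left_le)
    have pr: "(x * R) powr \<rho> = x powr \<rho> * R powr \<rho>" if "0 < x" for x using that R0 by (simp add: powr_mult)
    have powr_inv: "real (l + 1) \<le> x powr \<rho>" if "real (l + 1) powr \<alpha> \<le> x" for l x
    proof -
      have "real (l + 1) = (real (l + 1) powr \<alpha>) powr \<rho>" using \<alpha> by (simp add: powr_powr \<rho>_def)
      also have "\<dots> \<le> x powr \<rho>" using that \<rho> by (intro powr_mono2) auto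
      finally show ?thesis .
    qed
    define n\<^sub>1 where "n\<^sub>1 = nat \<lfloor>(b\<^sub>1 * R\<^sub>2 / 3) powr \<rho>\<rfloor>"
    have n1: "(b\<^sub>1 * R\<^sub>2 / 3) powr \<rho> - 1 \<le> real n\<^sub>1" unfolding n\<^sub>1_def by linarith
    have n1_lam: "3 / R\<^sub>2 \<le> lam l" if "l < n\<^sub>1" for l
    proof -
      have "real (l + 1) \<le> (b\<^sub>1 * R\<^sub>2 / 3) powr \<rho>" using that unfolding n\<^sub>1_def by linarith
      then have "real (l + 1) powr \<alpha> \<le> ((b\<^sub>1 * R\<^sub>2 / 3) powr \<rho>) powr \<alpha>" using \<alpha> by (intro powr_mono2) auto
      also have "\<dots> = b\<^sub>1 * R\<^sub>2 / 3" using \<alpha> b R2 by (simp add: powr_powr \<rho>_def)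
      finally have "3 / R\<^sub>2 \<le> b\<^sub>1 / real (l + 1) powr \<alpha>" using R2 by (simp add: field_simps)
      also have "\<dots> = b\<^sub>1 * real (l + 1) powr - \<alpha>" by (simp add: powr_minus_divide)
      also have "\<dots> \<le> lam l" by (rule lower)
      finally show ?thesis .
    qed
    obtain N\<^sub>0 where N0: "\<forall>N\<ge>N\<^sub>0. \<exists>P. (\<forall>S. P holomorphic_on S) \<and> P 0 = 1 \<and> (\<forall>z. norm z \<le> R \<longrightarrow> P z \<noteq> 0) \<and>
      (\<forall>z c. 0 < c \<longrightarrow> (\<forall>l<N. c \<le> norm (1 - z * complex_of_real (lam l))) \<longrightarrow>
        norm (P z) \<le> (\<Prod>l\<in>{0..<N}. norm (1 - z * complex_of_real (lam l))) * exp (C * (norm z / c) powr q))"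
      using fam[OF R0] by blast
    \<comment> \<open>Large enough for a zero-free \<open>P\<close> to exist and for the section to
      contain all \<open>n\<^sub>1\<close> eigenvalues that are to be counted.\<close>
    define N where "N = max N\<^sub>0 n\<^sub>1"
    obtain P where P: "\<And>S. P holomorphic_on S" "P 0 = 1" "\<And>z. norm z \<le> R \<Longrightarrow> P z \<noteq> 0"
      "\<And>z c. 0 < c \<Longrightarrow> (\<forall>l<N. c \<le> norm (1 - z * complex_of_real (lam l))) \<Longrightarrow>
        norm (P z) \<le> (\<Prod>l\<in>{0..<N}. norm (1 - z * complex_of_real (lam l))) * exp (C * (norm z / c) powr q)"
      using N0[rule_format, of N] by (auto simp: N_def)
    interpret zero_free_perturbation P lam N R C q b\<^sub>2
    proof
      show "lam l \<le> b\<^sub>2" for l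
      proof -
        have "real (l + 1) powr - \<alpha> \<le> 1" using powr_mono[of "- \<alpha>" 0 "real (l + 1)"] \<alpha> by simp
        then have "b\<^sub>2 * real (l + 1) powr - \<alpha> \<le> b\<^sub>2 * 1" using b by (intro mult_left_mono) auto
        then show ?thesis using upper[of l] by linarith
      qed
      show "0 < lam l" for l
        using lower[of l] b by (intro less_le_trans[OF _ lower[of l]] mult_pos_pos) auto
    qed (use P C q R0 b in auto)
    define n where "n = card {l\<in>{0..<N}. 1 / (2 * R) \<le> lam l}"
    define M where "M = 3 * (n * ln (1 + R * b\<^sub>2) + C * (8 * (n + 1) * R) powr q + 1)"
    have n_le: "real n \<le> D * R powr \<rho>"
    proof -
      have "{l\<in>{0..<N}. 1 / (2 * R) \<le> lam l} \<subseteq> {..<nat \<lfloor>(2 * b\<^sub>2 * R) powr \<rho>\<rfloor>}"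
      proof clarify
        fix l assume l: "1 / (2 * R) \<le> lam l"
        also have "\<dots> \<le> b\<^sub>2 * real (l + 1) powr - \<alpha>" by (rule upper)
        also have "\<dots> = b\<^sub>2 / real (l + 1) powr \<alpha>" by (simp add: powr_minus_divide)
        finally have "real (l + 1) powr \<alpha> \<le> 2 * b\<^sub>2 * R" using R0 by (simp add: field_simps)
        then have "real (l + 1) \<le> (2 * b\<^sub>2 * R) powr \<rho>" by (rule powr_inv)
        then show "l < nat \<lfloor>(2 * b\<^sub>2 * R) powr \<rho>\<rfloor>" by linarith
      qed
      from card_mono[OF _ this] have "n \<le> nat \<lfloor>(2 * b\<^sub>2 * R) powr \<rho>\<rfloor>" by (simp add: n_def)
      also have "real \<dots> \<le> (2 * b\<^sub>2 * R) powr \<rho>" by simp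
      also have "\<dots> = D * R powr \<rho>" using b pr[of "2 * b\<^sub>2"] by (simp add: D_def)
      finally show ?thesis by simp
    qed
    have Rp: "1 \<le> R powr \<rho>" using R \<rho> by (intro ge_one_powr_ge_zero) auto
    have RpR: "R powr \<rho> * R = R powr (\<rho> + 1)" using R0 by (simp add: powr_add)
    have M_le: "M \<le> 3 * C\<^sub>U * R powr (\<rho> + 1)"
    proof -
      have "n * ln (1 + R * b\<^sub>2) \<le> (D * R powr \<rho>) * (R * b\<^sub>2)"
        using n_le R0 b D ln_add_one_self_le_self[of "R * b\<^sub>2"] by (intro mult_mono) auto
      also have "\<dots> = D * b\<^sub>2 * R powr (\<rho> + 1)" by (simp add: RpR[symmetric])
      finally have 1: "n * ln (1 + R * b\<^sub>2) \<le> D * b\<^sub>2 * R powr (\<rho> + 1)" .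
      have "(8 * (real n + 1) * R) powr q \<le> (8 * (real n + 1) * R) powr 1"
        using R q by (intro powr_mono) (auto intro!: mult_ge1_I)
      also have "\<dots> = 8 * (real n + 1) * R" using R0 by simp
      also have "\<dots> \<le> 8 * (D * R powr \<rho> + R powr \<rho>) * R" using n_le Rp R0 by (intro mult_right_mono) auto
      also have "\<dots> = 8 * (D + 1) * (R powr \<rho> * R)" by (simp add: algebra_simps)
      also have "\<dots> = 8 * (D + 1) * R powr (\<rho> + 1)" by (simp only: RpR)
      finally have 2: "C * (8 * (n + 1) * R) powr q \<le> C * (8 * (D + 1)) * R powr (\<rho> + 1)"
        using C by (simp add: mult_left_mono mult.assoc add.commute)
      have 3: "1 \<le> R powr (\<rho> + 1)" using R \<rho> by (intro ge_one_powr_ge_zero) auto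
      have "n * ln (1 + R * b\<^sub>2) + C * (8 * (n + 1) * R) powr q + 1
          \<le> D * b\<^sub>2 * R powr (\<rho> + 1) + C * (8 * (D + 1)) * R powr (\<rho> + 1) + R powr (\<rho> + 1)"
        using 1 2 3 by linarith
      then show ?thesis by (simp add: M_def C\<^sub>U_def algebra_simps)
    qed
    have M0: "0 \<le> M" unfolding M_def using C R0 b by (intro mult_nonneg_nonneg add_nonneg_nonneg) auto
    have tail: "2 * M * exp (\<beta> * (ln R\<^sub>2 - ln R\<^sub>1)) \<le> 6 * C\<^sub>U"
    proof -
      have "ln R\<^sub>2 - ln R\<^sub>1 = - \<epsilon> * ln R" using R1 R0 by (simp add: R\<^sub>2_def ln_mult_pos ln_powr)
      then have "\<beta> * (ln R\<^sub>2 - ln R\<^sub>1) = - (\<epsilon> * \<beta>) * ln R" by simp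
      then have "exp (\<beta> * (ln R\<^sub>2 - ln R\<^sub>1)) = R powr - (\<rho> + 1)" using R0 by (simp add: powr_def \<beta>)
      moreover have "M * R powr - (\<rho> + 1) \<le> (3 * C\<^sub>U * R powr (\<rho> + 1)) * R powr - (\<rho> + 1)"
        using M_le by (intro mult_right_mono) auto
      moreover have "R powr (\<rho> + 1) * R powr - (\<rho> + 1) = 1" using R0 by (simp add: powr_add[symmetric])
      ultimately show ?thesis by (simp add: mult.assoc)
    qed
    have "real (card {l\<in>{0..<N}. 3 / R\<^sub>2 \<le> lam l}) * ln 2 \<le> m R + 6 * C\<^sub>U"
    proof (rule zero_count_le)
      show "0 < R\<^sub>2" "R\<^sub>2 \<le> R" using R2 R1R by auto
      fix z :: complex assume z: "norm z = R\<^sub>2"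
      have R1_alt: "R * (cos \<psi> / 2)\<^sup>2 / 2 = R\<^sub>1" by (simp add: R\<^sub>1_def \<kappa>_def)
      have m_alt: "3 * (4 / (cos \<psi> * (1 - sin \<psi>))) * exp ((ln R - ln r) / \<gamma>) * B R = m R"
        by (simp add: m_def K_def)
      have "norm (F z) \<le> exp (m R + 2 * M * exp (\<beta> * (ln (norm z) - ln R\<^sub>1)))"
      proof (rule F_growth[OF \<delta> \<beta>(1) \<beta>\<delta> r, folded \<psi>_def, folded \<gamma>_def s_def, where B = "B R", unfolded R1_alt m_alt])
        show "r < R\<^sub>1" using R by (simp add: R\<^sub>1_def)
        show "C * (R / s) powr q < B R" by (simp add: B_def)
        show "norm (F w) \<le> exp M" if "norm w \<le> R / 4" for w
          using F_a_priori[OF n_def[symmetric] that] by (simp add: M_def add.commute)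
        show "r \<le> norm z" "norm z \<le> R\<^sub>1" using R R2 by (auto simp: z R\<^sub>2_def R\<^sub>1_def)
      qed (rule M0)
      also have "\<dots> \<le> exp (m R + 6 * C\<^sub>U)" using tail by (simp add: z)
      finally show "norm (F z) \<le> exp (m R + 6 * C\<^sub>U)" .
    qed
    moreover have "n\<^sub>1 \<le> card {l\<in>{0..<N}. 3 / R\<^sub>2 \<le> lam l}"
    proof -
      have "{..<n\<^sub>1} \<subseteq> {l\<in>{0..<N}. 3 / R\<^sub>2 \<le> lam l}" using n1_lam by (auto simp: N_def)
      from card_mono[OF _ this] show ?thesis by simp
    qed
    then have "((b\<^sub>1 * R\<^sub>2 / 3) powr \<rho> - 1) * ln 2 \<le> real (card {l\<in>{0..<N}. 3 / R\<^sub>2 \<le> lam l}) * ln 2"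
      using n1 by (intro mult_right_mono) auto
    ultimately have "((b\<^sub>1 * R\<^sub>2 / 3) powr \<rho> - 1) * ln 2 \<le> m R + 6 * C\<^sub>U" by linarith
    moreover have "(b\<^sub>1 * R\<^sub>2 / 3) powr \<rho> = (b\<^sub>1 * \<kappa> / 3) powr \<rho> * R powr ((1 - \<epsilon>) * \<rho>)"
    proof -
      have "R * R powr - \<epsilon> = R powr (1 - \<epsilon>)" using R0 powr_add[of R 1 "- \<epsilon>"] by simp
      then have e: "b\<^sub>1 * R\<^sub>2 / 3 = (b\<^sub>1 * \<kappa> / 3) * R powr (1 - \<epsilon>)" by (simp add: R\<^sub>2_def R\<^sub>1_def algebra_simps)
      show ?thesis unfolding e using b \<kappa> by (subst powr_mult) (auto simp: powr_powr)
    qed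
    ultimately show ?thesis by simp
  qed
  define c\<^sub>1 where "c\<^sub>1 = (b\<^sub>1 * \<kappa> / 3) powr \<rho> * ln 2"
  have c1: "0 < c\<^sub>1" using b \<kappa> by (simp add: c\<^sub>1_def)
  have m_eq: "m R = K * r powr - (1 / \<gamma>) * R powr (1 / \<gamma>) * (C * s powr - q * R powr q + 1)" if "0 < R" for R
  proof -
    have "exp ((ln R - ln r) / \<gamma>) = r powr - (1 / \<gamma>) * R powr (1 / \<gamma>)"
      using that r by (simp add: powr_def diff_divide_distrib exp_add[symmetric])
    moreover have "(R / s) powr q = s powr - q * R powr q"
      using that s by (simp add: powr_divide powr_minus_divide)
    ultimately show ?thesis by (simp add: m_def B_def)
  qed
  have "\<forall>\<^sub>F R in at_top. K * r powr - (1 / \<gamma>) * R powr (1 / \<gamma>) * (C * s powr - q * R powr q + 1)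
      + (6 * C\<^sub>U + ln 2) < c\<^sub>1 * R powr (1 / 2 + \<tau>)"
    using inv_\<gamma> q \<tau> c1 by (intro eventually_powr_dominates) auto
  moreover have "\<forall>\<^sub>F R in at_top. r < R * \<kappa>"
    using \<kappa> by real_asymp
  moreover have "\<forall>\<^sub>F R in at_top. r < R * \<kappa> * R powr - \<epsilon>"
    using \<kappa> \<epsilon>(1,3) by real_asymp
  moreover have "\<forall>\<^sub>F R::real in at_top. 1 \<le> R" by (rule eventually_ge_at_top)
  \<comment> \<open>The count grows with exponent \<open>1 / 2 + \<tau>\<close> and the bound for it
    more slowly, so every large \<open>R\<close> gives a contradiction, recorded as
    \<open>R < R\<close>.\<close>
  ultimately have "\<forall>\<^sub>F R :: real in at_top. R < R"
  proof eventually_elim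
    case (elim R)
    have "m R + 6 * C\<^sub>U + ln 2 < c\<^sub>1 * R powr (1 / 2 + \<tau>)"
      using elim(1,4) m_eq[of R] by simp
    moreover have "c\<^sub>1 * R powr (1 / 2 + \<tau>) \<le> m R + 6 * C\<^sub>U + ln 2"
      using main[of R] elim(2-4) unfolding \<epsilon>(2) c\<^sub>1_def by (simp add: algebra_simps)
    ultimately show "R < R" by simp
  qed
  then show False by simp
qed

section \<open>Complex inner product spaces\<close>

lemma scaleC_one [simp]: "1 *\<^sub>C x = (x :: 'a::complex_inner)"
  using scaleR_conv_scaleC[of 1 x] by simp

interpretation complex_vs: vector_space "(*\<^sub>C) :: complex \<Rightarrow> 'a::complex_inner \<Rightarrow> 'a"
  by unfold_locales (simp_all add: scaleC_add_right scaleC_add_left scaleC_scaleC)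

lemma cinner_add_right: "cinner x (y + z) = cinner x y + cinner x (z :: 'a::complex_inner)"
  by (metis cinner_add_left cinner_commute complex_cnj_add)

lemma cinner_scaleC_right: "cinner x (c *\<^sub>C y) = cnj c * cinner x (y :: 'a::complex_inner)"
  by (metis cinner_commute cinner_scaleC_left complex_cnj_mult)

lemma Re_cinner: "Re (cinner x y) = inner x (y :: 'a::complex_inner)"
  by (simp add: inner_conv_cinner)

lemma Im_cinner: "Im (cinner x y) = inner x (\<i> *\<^sub>C (y :: 'a::complex_inner))"
  by (simp add: inner_conv_cinner cinner_scaleC_right)

lemma cinner_self: "cinner x x = complex_of_real ((norm (x :: 'a::complex_inner))\<^sup>2)"
proof (rule complex_eqI)
  show "Im (cinner x x) = Im (complex_of_real ((norm x)\<^sup>2))"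
    using arg_cong[OF cinner_commute[of x x], of Im] by simp
qed (simp add: Re_cinner power2_norm_eq_inner)

lemma norm_scaleC: "norm (c *\<^sub>C (x :: 'a::complex_inner)) = norm c * norm x"
proof -
  have "cinner (c *\<^sub>C x) (c *\<^sub>C x) = (c * cnj c) * cinner x x"
    by (simp add: cinner_scaleC_left cinner_scaleC_right mult.assoc)
  also have "\<dots> = complex_of_real ((norm c)\<^sup>2) * complex_of_real ((norm x)\<^sup>2)"
    unfolding cinner_self complex_norm_square ..
  finally have "complex_of_real ((norm (c *\<^sub>C x))\<^sup>2) = complex_of_real ((norm c * norm x)\<^sup>2)"
    unfolding cinner_self by (simp only: of_real_mult power_mult_distrib)
  then have "(norm (c *\<^sub>C x))\<^sup>2 = (norm c * norm x)\<^sup>2" by (simp only: of_real_eq_iff)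
  then show ?thesis by (simp add: power2_eq_iff_nonneg)
qed

lemma norm_cinner_le: "norm (cinner x y) \<le> norm x * norm (y :: 'a::complex_inner)"
proof (cases "cinner x y = 0")
  case False
  define c where "c = cnj (cinner x y) / norm (cinner x y)"
  have c: "norm c = 1" using False by (simp add: c_def norm_divide)
  have "c * cinner x y = complex_of_real (norm (cinner x y))"
    using False by (simp add: c_def mult.commute[of _ "cinner x y"] complex_norm_square[symmetric] power2_eq_square)
  then have "norm (cinner x y) = Re (cinner (c *\<^sub>C x) y)"
    by (simp add: cinner_scaleC_left)
  also have "\<dots> \<le> norm (c *\<^sub>C x) * norm y"
    unfolding Re_cinner by (rule norm_cauchy_schwarz)
  finally show ?thesis by (simp add: norm_scaleC c)
qed simp

lemma bounded_bilinear_cinner: "bounded_bilinear (cinner :: 'a::complex_inner \<Rightarrow> 'a \<Rightarrow> complex)"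
proof
  show "\<exists>K. \<forall>a b::'a. norm (cinner a b) \<le> norm a * norm b * K"
    using norm_cinner_le by (intro exI[of _ 1]) auto
qed (simp_all add: cinner_add_left cinner_add_right scaleR_conv_scaleC cinner_scaleC_left
  cinner_scaleC_right scaleR_conv_of_real)

interpretation cinner: bounded_bilinear "cinner :: 'a::complex_inner \<Rightarrow> 'a \<Rightarrow> complex"
  by (rule bounded_bilinear_cinner)

declare cinner.zero_left [simp] cinner.zero_right [simp]

lemma cinner_eq_0_commute: "cinner x y = 0 \<longleftrightarrow> cinner y (x :: 'a::complex_inner) = 0"
  by (metis cinner_commute complex_cnj_zero_iff)

lemma bounded_bilinear_scaleC: "bounded_bilinear ((*\<^sub>C) :: complex \<Rightarrow> 'a::complex_inner \<Rightarrow> 'a)"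
proof
  fix r :: real and a :: complex and b :: 'a
  show "(r *\<^sub>R a) *\<^sub>C b = r *\<^sub>R a *\<^sub>C b"
    by (simp add: scaleR_conv_scaleC scaleC_scaleC scaleR_conv_of_real)
  show "a *\<^sub>C r *\<^sub>R b = r *\<^sub>R a *\<^sub>C b"
    by (simp add: scaleR_conv_scaleC scaleC_scaleC mult.commute)
  show "\<exists>K. \<forall>(a::complex) b::'a. norm (a *\<^sub>C b) \<le> norm a * norm b * K"
    by (intro exI[of _ 1]) (simp add: norm_scaleC)
qed (simp_all add: scaleC_add_left scaleC_add_right)

interpretation scaleC: bounded_bilinear "(*\<^sub>C) :: complex \<Rightarrow> 'a::complex_inner \<Rightarrow> 'a"
  by (rule bounded_bilinear_scaleC)

declare scaleC.zero_left [simp] scaleC.zero_right [simp]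

definition ortho_system :: "(nat \<Rightarrow> 'a::complex_inner) \<Rightarrow> bool" where
  "ortho_system e \<longleftrightarrow> (\<forall>i j. i \<noteq> j \<longrightarrow> cinner (e i) (e j) = 0) \<and> (\<forall>i. e i \<noteq> 0 \<longrightarrow> norm (e i) = 1)"

lemma ortho_system_cinner:
  assumes "ortho_system e"
  shows "cinner (e i) (e j) = (if i = j \<and> e i \<noteq> 0 then 1 else 0)"
  using assms by (auto simp: ortho_system_def cinner_self)

lemma ortho_system_norm_le: "ortho_system e \<Longrightarrow> norm (e i) \<le> 1"
  by (cases "e i = 0") (auto simp: ortho_system_def)

lemma norm_sum_ortho_system:
  assumes e: "ortho_system e" and "finite I"
  shows "(norm (\<Sum>i\<in>I. c i *\<^sub>C e i))\<^sup>2 = (\<Sum>i\<in>I. (norm (c i))\<^sup>2 * (norm (e i))\<^sup>2)"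
proof -
  have "complex_of_real ((norm (\<Sum>i\<in>I. c i *\<^sub>C e i))\<^sup>2) = (\<Sum>i\<in>I. \<Sum>j\<in>I. c i * (cnj (c j) * cinner (e i) (e j)))"
    unfolding cinner_self[symmetric]
    by (simp add: cinner.sum_left cinner.sum_right cinner_scaleC_left cinner_scaleC_right sum_distrib_left)
      (subst sum.swap, simp add: mult.left_commute)
  also have "\<dots> = (\<Sum>i\<in>I. \<Sum>j\<in>I. if i = j then c i * (cnj (c i) * cinner (e i) (e i)) else 0)"
    using e by (intro sum.cong refl) (auto simp: ortho_system_def)
  also have "\<dots> = (\<Sum>i\<in>I. c i * (cnj (c i) * cinner (e i) (e i)))"
    using assms by (simp)
  also have "\<dots> = complex_of_real (\<Sum>i\<in>I. (norm (c i))\<^sup>2 * (norm (e i))\<^sup>2)"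
    by (simp add: cinner_self complex_norm_square[symmetric] mult.assoc[symmetric])
  finally show ?thesis by (simp only: of_real_eq_iff)
qed

lemma bessel:
  assumes e: "ortho_system e" and "finite I"
  shows "(\<Sum>i\<in>I. (norm (cinner x (e i)))\<^sup>2) \<le> (norm x)\<^sup>2"
proof -
  let ?p = "\<Sum>i\<in>I. cinner x (e i) *\<^sub>C e i"
  have n: "(norm (cinner x (e i)))\<^sup>2 * (norm (e i))\<^sup>2 = (norm (cinner x (e i)))\<^sup>2" for i
    using e by (cases "e i = 0") (auto simp: ortho_system_def)
  have pp: "(norm ?p)\<^sup>2 = (\<Sum>i\<in>I. (norm (cinner x (e i)))\<^sup>2)"
    using norm_sum_ortho_system[OF assms] by (simp add: n)
  have "cinner x ?p = (\<Sum>i\<in>I. cnj (cinner x (e i)) * cinner x (e i))"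
    by (simp add: cinner.sum_right cinner_scaleC_right)
  also have "\<dots> = complex_of_real (\<Sum>i\<in>I. (norm (cinner x (e i)))\<^sup>2)"
    by (simp add: complex_norm_square[symmetric] mult.commute[of "cnj _"])
  finally have "inner x ?p = (\<Sum>i\<in>I. (norm (cinner x (e i)))\<^sup>2)"
    by (metis Re_cinner Re_complex_of_real)
  then have "(norm (x - ?p))\<^sup>2 = (norm x)\<^sup>2 - (\<Sum>i\<in>I. (norm (cinner x (e i)))\<^sup>2)"
    using pp by (simp add: power2_norm_eq_inner inner_diff_left inner_diff_right inner_commute)
  then show ?thesis using zero_le_power2[of "norm (x - ?p)"] by linarith
qed

lemma bessel_summable:
  assumes "ortho_system e"
  shows "summable (\<lambda>i. (norm (cinner x (e i)))\<^sup>2)"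
  by (rule summableI_nonneg_bounded[where x = "(norm x)\<^sup>2"]) (auto intro: bessel[OF assms])

text \<open>Completeness is a property of the carrier \<open>H\<close>, since the type class
  provides only an inner product.\<close>

locale hilbert_subspace =
  fixes H :: "'a::complex_inner set"
  assumes zero_mem: "0 \<in> H" and add_mem: "\<And>x y. x \<in> H \<Longrightarrow> y \<in> H \<Longrightarrow> x + y \<in> H"
    and scaleC_mem: "\<And>c x. x \<in> H \<Longrightarrow> c *\<^sub>C x \<in> H" and complete: "complete H"
begin

lemma closed: "closed H"
  by (rule complete_imp_closed[OF complete])

lemma uminus_mem: "x \<in> H \<Longrightarrow> - x \<in> H"
  using scaleC_mem[of x "- 1"] by simp

lemma diff_mem: "x \<in> H \<Longrightarrow> y \<in> H \<Longrightarrow> x - y \<in> H"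
  using add_mem[of x "- y"] uminus_mem by simp

lemma sum_mem: "(\<And>i. i \<in> I \<Longrightarrow> f i \<in> H) \<Longrightarrow> sum f I \<in> H"
  by (induction I rule: infinite_finite_induct) (auto simp: zero_mem add_mem)

lemma sums_mem: "f sums x \<Longrightarrow> (\<And>i. f i \<in> H) \<Longrightarrow> x \<in> H"
  unfolding sums_def by (rule closed_sequentially[OF closed]) (auto intro: sum_mem)

lemma eqI: "x \<in> H \<Longrightarrow> y \<in> H \<Longrightarrow> (\<And>z. z \<in> H \<Longrightarrow> cinner z x = cinner z y) \<Longrightarrow> x = y"
  using cinner_self[of "x - y"] diff_mem[of x y] by (simp add: cinner.diff_right)

lemma summable_ortho_system:
  assumes e: "ortho_system e" "\<And>i. e i \<in> H" and c: "summable (\<lambda>i. (norm (c i))\<^sup>2)"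
  shows "summable (\<lambda>i. c i *\<^sub>C e i)"
proof -
  let ?S = "\<lambda>n. \<Sum>i<n. c i *\<^sub>C e i"
  have "Cauchy ?S"
  proof (rule CauchyI')
    fix \<epsilon> :: real assume "0 < \<epsilon>"
    then have "0 < \<epsilon>\<^sup>2" by simp
    then obtain N where N: "\<And>m n. N \<le> m \<Longrightarrow> norm (\<Sum>i=m..<n. (norm (c i))\<^sup>2) < \<epsilon>\<^sup>2"
      using c unfolding summable_Cauchy by blast
    have "dist (?S m) (?S n) < \<epsilon>" if "N \<le> m" "m < n" for m n
    proof -
      have "?S n - ?S m = (\<Sum>i=m..<n. c i *\<^sub>C e i)"
        using that(2) sum_diff_nat_ivl[of 0 m n "\<lambda>i. c i *\<^sub>C e i"] by (simp add: lessThan_atLeast0)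
      then have "(dist (?S m) (?S n))\<^sup>2 = (\<Sum>i=m..<n. (norm (c i))\<^sup>2 * (norm (e i))\<^sup>2)"
        using norm_sum_ortho_system[OF e(1), of "{m..<n}" c] by (simp add: dist_norm norm_minus_commute[of "?S m" "?S n"])
      also have "\<dots> \<le> (\<Sum>i=m..<n. (norm (c i))\<^sup>2)"
        using ortho_system_norm_le[OF e(1)] by (intro sum_mono mult_left_le) (auto simp: power_le_one)
      also have "\<dots> < \<epsilon>\<^sup>2" using N[OF that(1), of n] by simp
      finally show ?thesis using \<open>0 < \<epsilon>\<close> by (simp add: power2_less_imp_less)
    qed
    then show "\<exists>M. \<forall>m\<ge>M. \<forall>n>m. dist (?S m) (?S n) < \<epsilon>" by blast
  qed
  moreover have "\<forall>n. ?S n \<in> H" by (auto intro!: sum_mem scaleC_mem e)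
  ultimately obtain l where "?S \<longlonglongrightarrow> l" using complete[unfolded complete_def, rule_format, of ?S] by blast
  then show ?thesis by (auto simp: summable_def sums_def)
qed

text \<open>The diagonal operator with eigenvalues \<open>w n\<close> on \<open>e n\<close>, and 0
  on the orthogonal complement of the system. The constant weight 1 gives the orthogonal projection
  onto the closed span.\<close>

definition mult_op :: "(nat \<Rightarrow> 'a) \<Rightarrow> (nat \<Rightarrow> real) \<Rightarrow> 'a \<Rightarrow> 'a" where
  "mult_op e w x = (\<Sum>n. (w n * cinner x (e n)) *\<^sub>C e n)"

context
  fixes e :: "nat \<Rightarrow> 'a" and w :: "nat \<Rightarrow> real" and B :: real
  assumes e: "ortho_system e" "\<And>i. e i \<in> H" and w: "\<And>n. \<bar>w n\<bar> \<le> B"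
begin

lemma mult_op_sums: "(\<lambda>n. (w n * cinner x (e n)) *\<^sub>C e n) sums mult_op e w x"
  unfolding mult_op_def
proof (intro summable_sums summable_ortho_system[OF e])
  show "summable (\<lambda>n. (norm (complex_of_real (w n) * cinner x (e n)))\<^sup>2)"
  proof (rule summable_comparison_test')
    show "summable (\<lambda>n. B\<^sup>2 * (norm (cinner x (e n)))\<^sup>2)"
      by (rule summable_mult[OF bessel_summable[OF e(1)]])
    fix n
    have "(w n)\<^sup>2 \<le> B\<^sup>2" using w[of n] by (intro abs_le_square_iff[THEN iffD1]) auto
    then show "norm ((norm (complex_of_real (w n) * cinner x (e n)))\<^sup>2) \<le> B\<^sup>2 * (norm (cinner x (e n)))\<^sup>2"
      by (simp add: norm_mult power_mult_distrib mult_right_mono)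
  qed
qed

lemma mult_op_mem: "mult_op e w x \<in> H"
  by (rule sums_mem[OF mult_op_sums]) (auto intro: scaleC_mem e)

lemma cinner_mult_op_left: "(\<lambda>n. w n * cinner x (e n) * cinner (e n) y) sums cinner (mult_op e w x) y"
  using bounded_linear.sums[OF cinner.bounded_linear_left mult_op_sums[of x], of y] by (simp add: cinner_scaleC_left)

lemma mult_op_symmetric: "cinner (mult_op e w x) y = cinner x (mult_op e w y)"
proof -
  have "(\<lambda>n. cnj (w n * cinner y (e n) * cinner (e n) x)) sums cnj (cinner (mult_op e w y) x)"
    by (rule sums_cnj[THEN iffD2, OF cinner_mult_op_left])
  then have "(\<lambda>n. w n * cinner x (e n) * cinner (e n) y) sums cinner x (mult_op e w y)"
    by (simp add: cinner_commute[symmetric] mult_ac)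
  then show ?thesis using cinner_mult_op_left sums_unique2 by blast
qed

lemma cinner_mult_op_system: "cinner (mult_op e w x) (e k) = w k * cinner x (e k)"
proof -
  have "(\<lambda>n. if n = k then w k * cinner x (e k) else 0) sums (w k * cinner x (e k))"
    by (rule sums_single)
  moreover have "(\<lambda>n. w n * cinner x (e n) * cinner (e n) (e k)) = (\<lambda>n. if n = k then w k * cinner x (e k) else 0)"
    using ortho_system_cinner[OF e(1)] by (auto simp: fun_eq_iff)
  ultimately show ?thesis using cinner_mult_op_left[of x "e k"] sums_unique2 by metis
qed

lemma mult_op_add: "mult_op e w (x + y) = mult_op e w x + mult_op e w y"
proof -
  have "(\<lambda>n. (w n * cinner (x + y) (e n)) *\<^sub>C e n) sums (mult_op e w x + mult_op e w y)"
    using sums_add[OF mult_op_sums mult_op_sums, of x y]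
    by (simp add: cinner_add_left distrib_left scaleC_add_left)
  then show ?thesis using mult_op_sums sums_unique2 by blast
qed

lemma mult_op_scaleC: "mult_op e w (c *\<^sub>C x) = c *\<^sub>C mult_op e w x"
proof -
  have "(\<lambda>n. (w n * cinner (c *\<^sub>C x) (e n)) *\<^sub>C e n) sums (c *\<^sub>C mult_op e w x)"
    using bounded_linear.sums[OF scaleC.bounded_linear_right mult_op_sums[of x], of c]
    by (simp add: cinner_scaleC_left scaleC_scaleC mult_ac)
  then show ?thesis using mult_op_sums sums_unique2 by blast
qed

lemma mult_op_mult_op: "mult_op e w (mult_op e w x) = mult_op e (\<lambda>n. (w n)\<^sup>2) x"
proof -
  have "(\<lambda>n. (w n * cinner (mult_op e w x) (e n)) *\<^sub>C e n) sums mult_op e w (mult_op e w x)"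
    by (rule mult_op_sums)
  then have "(\<lambda>n. ((w n)\<^sup>2 * cinner x (e n)) *\<^sub>C e n) sums mult_op e w (mult_op e w x)"
    by (simp add: cinner_mult_op_system power2_eq_square mult.assoc)
  from sums_unique[OF this] show ?thesis by (simp only: mult_op_def[of e "\<lambda>n. (w n)\<^sup>2" x])
qed

end

end

section \<open>Compact operators and their singular values\<close>

text \<open>The functional counterpart of \<open>bounded_operator\<close>; the values of
  \<open>f\<close> outside \<open>H\<close> are unconstrained, so all arguments must be shown to lie
  in \<open>H\<close>.\<close>

locale bounded_map = hilbert_subspace H for H :: "'a::complex_inner set" +
  fixes f :: "'a \<Rightarrow> 'a" and B :: real
  assumes f_mem: "\<And>x. x \<in> H \<Longrightarrow> f x \<in> H"
    and f_add: "\<And>x y. x \<in> H \<Longrightarrow> y \<in> H \<Longrightarrow> f (x + y) = f x + f y"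
    and f_scaleC: "\<And>c x. x \<in> H \<Longrightarrow> f (c *\<^sub>C x) = c *\<^sub>C f x"
    and f_bound: "\<And>x. x \<in> H \<Longrightarrow> norm (f x) \<le> B * norm x"
begin

lemma f_zero: "f 0 = 0"
  using f_scaleC[of 0 0] zero_mem by simp

lemma f_diff: "x \<in> H \<Longrightarrow> y \<in> H \<Longrightarrow> f (x - y) = f x - f y"
  using f_add[of x "(-1) *\<^sub>C y"] f_scaleC[of y "-1"] scaleC_mem[of y "-1"] by (simp add: scaleC.minus_left)

lemma f_scaleR: "x \<in> H \<Longrightarrow> f (r *\<^sub>R x) = r *\<^sub>R f x"
  by (simp add: scaleR_conv_scaleC f_scaleC)

lemma f_sum: "(\<And>i. i \<in> I \<Longrightarrow> g i \<in> H) \<Longrightarrow> f (\<Sum>i\<in>I. g i) = (\<Sum>i\<in>I. f (g i))"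
  by (induction I rule: infinite_finite_induct) (simp_all add: f_zero f_add sum_mem)

lemma f_tendsto:
  assumes "X \<longlonglongrightarrow> x" "\<And>n. X n \<in> H" "x \<in> H"
  shows "(\<lambda>n. f (X n)) \<longlonglongrightarrow> f x"
proof (rule LIM_zero_cancel, rule tendsto_0_le[where K = B])
  show "(\<lambda>n. X n - x) \<longlonglongrightarrow> 0" using assms(1) by (rule LIM_zero)
  show "\<forall>\<^sub>F n in sequentially. norm (f (X n) - f x) \<le> norm (X n - x) * B"
    using f_bound[of "X _ - x"] assms by (simp add: f_diff diff_mem mult.commute)
qed

end

locale compact_map = bounded_map +
  assumes f_compact: "\<And>X. (\<And>n. X n \<in> H \<and> norm (X n) \<le> 1) \<Longrightarrow>
    \<exists>r y. strict_mono (r :: nat \<Rightarrow> nat) \<and> (\<lambda>n. f (X (r n))) \<longlonglongrightarrow> y"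
begin

text \<open>A maximizing sequence is Cauchy by the parallelogram law, so no weak compactness is needed.\<close>

lemma norm_attained:
  assumes W: "W \<subseteq> H" "closed W" "\<And>x y. x \<in> W \<Longrightarrow> y \<in> W \<Longrightarrow> x + y \<in> W"
      "\<And>c x. x \<in> W \<Longrightarrow> c *\<^sub>C x \<in> W"
    and nz: "x\<^sub>0 \<in> W" "f x\<^sub>0 \<noteq> 0"
  obtains x where "x \<in> W" "norm x = 1" "f x \<noteq> 0" "\<And>z. z \<in> W \<Longrightarrow> norm (f z) \<le> norm (f x) * norm z"
proof -
  define S where "S = (\<lambda>z. norm (f z)) ` {z \<in> W. norm z \<le> 1}"
  define M where "M = Sup S"
  have W_scaleR: "r *\<^sub>R x \<in> W" if "x \<in> W" for r x using W(4)[OF that] by (simp add: scaleR_conv_scaleC)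
  have bdd: "bdd_above S"
  proof (rule bdd_aboveI[of _ "\<bar>B\<bar>"])
    fix y assume "y \<in> S"
    then obtain z where z: "z \<in> W" "norm z \<le> 1" "y = norm (f z)" by (auto simp: S_def)
    have "norm (f z) \<le> B * norm z" using f_bound z W by auto
    also have "\<dots> \<le> \<bar>B\<bar> * 1" using z by (intro mult_mono) auto
    finally show "y \<le> \<bar>B\<bar>" using z by simp
  qed
  have le_M: "norm (f z) \<le> M * norm z" if "z \<in> W" for z
  proof (cases "z = 0")
    case False
    have "norm (f ((1 / norm z) *\<^sub>R z)) \<in> S" unfolding S_def using W_scaleR[OF that] False by (intro imageI) auto
    then have "norm (f ((1 / norm z) *\<^sub>R z)) \<le> M" unfolding M_def using bdd by (rule cSup_upper)
    then show ?thesis using False that W by (subst (asm) f_scaleR) (auto simp: field_simps)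
  qed (simp add: f_zero)
  have "x\<^sub>0 \<noteq> 0" using nz f_zero by auto
  then have M_pos: "0 < M" using le_M[OF nz(1)] nz(2)
    by (meson less_le_trans zero_less_norm_iff zero_less_mult_pos2)
  have "0 *\<^sub>C x\<^sub>0 \<in> W" using W(4) nz by blast
  then have S_ne: "S \<noteq> {}" by (auto simp: S_def intro!: exI[of _ 0])
  have "\<exists>z. z \<in> W \<and> norm z \<le> 1 \<and> M - 1 / Suc n < norm (f z)" for n
    using less_cSup_iff[OF S_ne bdd, of "M - 1 / Suc n"] by (auto simp: S_def M_def)
  then obtain X where X: "\<And>n. X n \<in> W" "\<And>n. norm (X n) \<le> 1" "\<And>n. M - 1 / Suc n < norm (f (X n))" by metis
  obtain r y where r: "strict_mono (r :: nat \<Rightarrow> nat)" and y: "(\<lambda>n. f (X (r n))) \<longlonglongrightarrow> y"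
    using f_compact[of X] X W by blast
  define Y where "Y n = X (r n)" for n
  have Y: "Y n \<in> W" "norm (Y n) \<le> 1" for n using X by (auto simp: Y_def)
  have fY_le: "norm (f (Y n)) \<le> M" for n
    using le_M[OF Y(1)[of n]] mult_left_mono[OF Y(2)[of n], of M] M_pos by linarith
  have fY: "(\<lambda>n. norm (f (Y n))) \<longlonglongrightarrow> M"
  proof (rule tendsto_sandwich)
    show "(\<lambda>n. M - 1 / Suc n) \<longlonglongrightarrow> M" using tendsto_diff[OF tendsto_const LIMSEQ_inverse_real_of_nat] by (simp add: inverse_eq_divide)
    show "\<forall>\<^sub>F n in sequentially. M - 1 / Suc n \<le> norm (f (Y n))"
    proof (rule always_eventually, rule allI)
      fix n
      have "1 / Suc (r n) \<le> 1 / Suc n" using seq_suble[OF r, of n] by (intro divide_left_mono) auto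
      then show "M - 1 / Suc n \<le> norm (f (Y n))" using X(3)[of "r n"] by (simp add: Y_def)
    qed
  qed (use fY_le in auto)
  have y: "(\<lambda>n. f (Y n)) \<longlonglongrightarrow> y" using y by (simp add: Y_def)
  have norm_y: "norm y = M" using tendsto_norm[OF y] fY by (rule LIMSEQ_unique)
  have "Cauchy Y"
  proof (rule metric_CauchyI)
    fix \<epsilon> :: real assume \<epsilon>: "0 < \<epsilon>"
    \<comment> \<open>The bound by \<open>M\<close> keeps \<open>2 * M - \<eta>\<close> positive
      before squaring. The other bound is what the parallelogram law needs: the squared distance
      comes out below \<open>4 * \<eta> / M\<close>, at most
      \<open>\<epsilon>\<^sup>2 / 2\<close>.\<close>
    define \<eta> where "\<eta> = min M (M * \<epsilon>\<^sup>2 / 8)"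
    have \<eta>: "0 < \<eta>" "\<eta> \<le> M" "8 * \<eta> \<le> M * \<epsilon>\<^sup>2" using M_pos \<epsilon> by (auto simp: \<eta>_def)
    obtain N where N: "\<And>n. N \<le> n \<Longrightarrow> norm (f (Y n) - y) < \<eta> / 2"
      using LIMSEQ_D[OF y, of "\<eta> / 2"] \<eta> by auto
    have "dist (Y m) (Y n) < \<epsilon>" if "N \<le> m" "N \<le> n" for m n
    proof -
      have "2 * M = norm ((f (Y m) + f (Y n)) - ((f (Y m) - y) + (f (Y n) - y)))"
        using norm_y norm_scaleR[of 2 y] by (simp add: scaleR_2)
      also have "\<dots> \<le> norm (f (Y m) + f (Y n)) + norm ((f (Y m) - y) + (f (Y n) - y))" by (rule norm_triangle_ineq4)
      also have "norm ((f (Y m) - y) + (f (Y n) - y)) \<le> norm (f (Y m) - y) + norm (f (Y n) - y)" by (rule norm_triangle_ineq)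
      also have "\<dots> < \<eta>" using N[OF that(1)] N[OF that(2)] by simp
      finally have "2 * M - \<eta> < norm (f (Y m) + f (Y n))" by simp
      also have "f (Y m) + f (Y n) = f (Y m + Y n)" using Y W by (intro f_add[symmetric]) auto
      also have "norm \<dots> \<le> M * norm (Y m + Y n)" using Y W by (intro le_M) auto
      finally have "2 * M - \<eta> < M * norm (Y m + Y n)" .
      then have "(2 * M - \<eta>)\<^sup>2 < (M * norm (Y m + Y n))\<^sup>2" using \<eta> M_pos by (intro power_strict_mono) auto
      moreover have "(2 * M - \<eta>)\<^sup>2 = 4 * M\<^sup>2 - 4 * (M * \<eta>) + \<eta>\<^sup>2" by (simp add: power2_eq_square algebra_simps)
      ultimately have 1: "4 * M\<^sup>2 - 4 * (M * \<eta>) < M\<^sup>2 * (norm (Y m + Y n))\<^sup>2"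
        using zero_le_power2[of \<eta>] unfolding power_mult_distrib by linarith
      have "(norm (Y m - Y n))\<^sup>2 = 2 * (norm (Y m))\<^sup>2 + 2 * (norm (Y n))\<^sup>2 - (norm (Y m + Y n))\<^sup>2"
        by (simp add: power2_norm_eq_inner inner_add_left inner_add_right inner_diff_left inner_diff_right inner_commute)
      also have "\<dots> \<le> 4 - (norm (Y m + Y n))\<^sup>2" using power_le_one[OF norm_ge_zero Y(2)[of m], of 2] power_le_one[OF norm_ge_zero Y(2)[of n], of 2] by linarith
      finally have "M\<^sup>2 * (norm (Y m - Y n))\<^sup>2 \<le> M\<^sup>2 * (4 - (norm (Y m + Y n))\<^sup>2)" by (intro mult_left_mono) auto
      then have "M\<^sup>2 * (norm (Y m - Y n))\<^sup>2 < 4 * (M * \<eta>)" using 1 by (simp add: algebra_simps)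
      also have "\<dots> = M / 2 * (8 * \<eta>)" by simp
      also have "\<dots> \<le> M / 2 * (M * \<epsilon>\<^sup>2)" using \<eta> M_pos by (intro mult_left_mono) auto
      also have "\<dots> \<le> M\<^sup>2 * \<epsilon>\<^sup>2" using M_pos \<epsilon> by (simp add: power2_eq_square)
      finally have "(norm (Y m - Y n))\<^sup>2 < \<epsilon>\<^sup>2" using M_pos by simp
      then show ?thesis using \<epsilon> by (simp add: dist_norm power2_less_imp_less)
    qed
    then show "\<exists>N. \<forall>m\<ge>N. \<forall>n\<ge>N. dist (Y m) (Y n) < \<epsilon>" by blast
  qed
  moreover have "\<forall>n. Y n \<in> H" using Y W by auto
  ultimately obtain x where x: "x \<in> H" "Y \<longlonglongrightarrow> x" using complete[unfolded complete_def, rule_format, of Y] by blast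
  have xW: "x \<in> W" using closed_sequentially[OF W(2) Y(1) x(2)] .
  have "(\<lambda>n. f (Y n)) \<longlonglongrightarrow> f x" using x Y W by (intro f_tendsto) auto
  then have fx: "f x = y" using y LIMSEQ_unique by blast
  have "norm x \<le> 1" using x(2) Y(2) by (intro LIMSEQ_le_const2[OF tendsto_norm[OF x(2)]]) auto
  moreover have "M * 1 \<le> M * norm x" using le_M[OF xW] by (simp add: fx norm_y)
  ultimately have "norm x = 1" using M_pos by simp
  then show thesis using that[of x] xW le_M fx norm_y M_pos by auto
qed

text \<open>First variation: the nonnegative function \<open>(norm (f x))\<^sup>2 * (norm (x + t
  z))\<^sup>2 - (norm (f (x + t z)))\<^sup>2\<close> of real \<open>t\<close> vanishes at 0, so its
  linear coefficient does too. This gives the real part; replacing \<open>z\<close> by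
  \<open>i z\<close> gives the imaginary part.\<close>

lemma maximizer_orthogonality:
  assumes W: "W \<subseteq> H" "\<And>x y. x \<in> W \<Longrightarrow> y \<in> W \<Longrightarrow> x + y \<in> W" "\<And>c x. x \<in> W \<Longrightarrow> c *\<^sub>C x \<in> W"
    and x: "x \<in> W" "norm x = 1" "\<And>z. z \<in> W \<Longrightarrow> norm (f z) \<le> norm (f x) * norm z"
    and z: "z \<in> W"
  shows "cinner (f x) (f z) = (norm (f x))\<^sup>2 * cinner x z"
proof -
  let ?M = "norm (f x)"
  have real: "inner (f x) (f z) = ?M\<^sup>2 * inner x z" if z: "z \<in> W" for z
  proof -
    define A where "A = ?M\<^sup>2 * inner x z - inner (f x) (f z)"
    define C where "C = ?M\<^sup>2 * (norm z)\<^sup>2 - (norm (f z))\<^sup>2"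
    have nonneg: "0 \<le> 2 * t * A + t\<^sup>2 * C" for t :: real
    proof -
      have tz: "t *\<^sub>R z \<in> W" using W(3)[OF z] by (simp add: scaleR_conv_scaleC)
      have "norm (f (x + t *\<^sub>R z)) \<le> ?M * norm (x + t *\<^sub>R z)" using x W tz by auto
      then have "(norm (f (x + t *\<^sub>R z)))\<^sup>2 \<le> ?M\<^sup>2 * (norm (x + t *\<^sub>R z))\<^sup>2"
        by (metis norm_ge_zero power_mono power_mult_distrib)
      moreover have "f (x + t *\<^sub>R z) = f x + t *\<^sub>R f z"
        using x z W tz by (subst f_add) (auto simp: f_scaleR subset_iff)
      moreover have sq: "(norm (u + t *\<^sub>R v))\<^sup>2 = (norm u)\<^sup>2 + 2 * t * inner u v + t\<^sup>2 * (norm v)\<^sup>2" for u v :: 'a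
        by (simp add: power2_norm_eq_inner inner_add_left inner_add_right inner_commute) (simp add: power2_eq_square algebra_simps)
      ultimately show ?thesis using x(2) by (simp add: sq A_def C_def algebra_simps)
    qed
    have "A = 0"
    proof (rule ccontr)
      assume "A \<noteq> 0"
      \<comment> \<open>Near 0 the linear term beats the quadratic one: at
        \<open>t = - A / D\<close> the polynomial is at most \<open>- A\<^sup>2 / D\<close>,
        negative unless \<open>A\<close> is 0.\<close>
      define D where "D = \<bar>C\<bar> + 1"
      have D: "0 < D" by (simp add: D_def)
      have "0 \<le> 2 * (- A / D) * A + (- A / D)\<^sup>2 * C" by (rule nonneg)
      also have "\<dots> \<le> 2 * (- A / D) * A + (- A / D)\<^sup>2 * D" by (intro add_left_mono mult_left_mono) (auto simp: D_def)
      also have "\<dots> = - (A\<^sup>2 / D)" using D by (simp add: power2_eq_square field_simps)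
      finally have "A\<^sup>2 / D \<le> 0" by simp
      then show False using \<open>A \<noteq> 0\<close> D by (simp add: divide_le_0_iff)
    qed
    then show ?thesis by (simp add: A_def)
  qed
  show ?thesis
  proof (rule complex_eqI)
    show "Re (cinner (f x) (f z)) = Re ((norm (f x))\<^sup>2 * cinner x z)"
      using real[OF z] by (simp add: Re_cinner)
    have "f (\<i> *\<^sub>C z) = \<i> *\<^sub>C f z" using z W by (intro f_scaleC) auto
    then show "Im (cinner (f x) (f z)) = Im ((norm (f x))\<^sup>2 * cinner x z)"
      using real[OF W(3)[OF z, of \<i>]] by (simp add: Im_cinner)
  qed
qed

end

section \<open>Singular vectors and singular values by successive maximization\<close>

context compact_map
begin

definition ortho_compl :: "'a set \<Rightarrow> 'a set" where
  "ortho_compl S = {x \<in> H. \<forall>y\<in>S. cinner x y = 0}"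

definition maximizer :: "'a set \<Rightarrow> 'a \<Rightarrow> bool" where
  "maximizer W x \<longleftrightarrow> x \<in> W \<and> norm x = 1 \<and> f x \<noteq> 0 \<and> (\<forall>z\<in>W. norm (f z) \<le> norm (f x) * norm z)"

definition pick :: "'a set \<Rightarrow> 'a" where
  "pick S = (if \<exists>x\<in>ortho_compl S. f x \<noteq> 0 then SOME x. maximizer (ortho_compl S) x else 0)"

text \<open>Each choice depends on all earlier ones, so the recursion carries the list of vectors
  picked so far.\<close>

primrec prefix :: "nat \<Rightarrow> 'a list" where
  "prefix 0 = []"
| "prefix (Suc n) = prefix n @ [pick (set (prefix n))]"

text \<open>Right singular vectors of \<open>f\<close>, padded with zeros if \<open>f\<close> has finite rank.\<close>

definition sv :: "nat \<Rightarrow> 'a" where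
  "sv n = pick (set (prefix n))"

definition sval :: "nat \<Rightarrow> real" where
  "sval n = norm (f (sv n))"

lemma set_prefix: "set (prefix n) = sv ` {..<n}"
  by (induction n) (auto simp: sv_def lessThan_Suc)

lemma ortho_compl_subspace:
  shows "ortho_compl S \<subseteq> H" "closed (ortho_compl S)" "0 \<in> ortho_compl S"
    and "x \<in> ortho_compl S \<Longrightarrow> y \<in> ortho_compl S \<Longrightarrow> x + y \<in> ortho_compl S"
    and "x \<in> ortho_compl S \<Longrightarrow> c *\<^sub>C x \<in> ortho_compl S"
proof -
  have "ortho_compl S = H \<inter> (\<Inter>y\<in>S. (\<lambda>x. cinner x y) -` {0})" by (auto simp: ortho_compl_def)
  moreover have "closed ((\<lambda>x. cinner x y) -` {0})" for y :: 'a
    by (rule continuous_closed_vimage) (auto intro: linear_continuous_at[OF cinner.bounded_linear_left])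
  ultimately show "closed (ortho_compl S)" using closed by (simp add: closed_Int closed_INT)
qed (auto simp: ortho_compl_def zero_mem add_mem scaleC_mem cinner_add_left cinner_scaleC_left)

lemma sv_eq: "sv n = pick (sv ` {..<n})"
  unfolding sv_def[of n] set_prefix ..

lemma sv_cases:
  obtains "sv n \<noteq> 0" "maximizer (ortho_compl (sv ` {..<n})) (sv n)"
  | "sv n = 0" "\<And>x. x \<in> ortho_compl (sv ` {..<n}) \<Longrightarrow> f x = 0"
proof (cases "\<exists>x\<in>ortho_compl (sv ` {..<n}). f x \<noteq> 0")
  case True
  then obtain x\<^sub>0 where x0: "x\<^sub>0 \<in> ortho_compl (sv ` {..<n})" "f x\<^sub>0 \<noteq> 0" by blast
  obtain x where "x \<in> ortho_compl (sv ` {..<n})" "norm x = 1" "f x \<noteq> 0"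
      "\<And>z. z \<in> ortho_compl (sv ` {..<n}) \<Longrightarrow> norm (f z) \<le> norm (f x) * norm z"
    by (rule norm_attained[OF ortho_compl_subspace(1,2,4,5) x0]) auto
  then have "\<exists>x. maximizer (ortho_compl (sv ` {..<n})) x" by (auto simp: maximizer_def)
  then have "maximizer (ortho_compl (sv ` {..<n})) (sv n)"
    using True someI_ex[of "maximizer (ortho_compl (sv ` {..<n}))"] unfolding sv_eq[of n] pick_def by presburger
  moreover from this have "sv n \<noteq> 0" by (auto simp: maximizer_def)
  ultimately show ?thesis using that(1) by blast
next
  case False
  then have "sv n = 0" unfolding sv_eq[of n] pick_def by (rule if_not_P)
  with False show ?thesis using that(2) by blast
qed

lemma sv_mem_ortho_compl: "sv n \<in> ortho_compl (sv ` {..<n})"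
  by (rule sv_cases[of n]) (auto simp: maximizer_def intro: ortho_compl_subspace(3))

lemma sv_mem: "sv n \<in> H"
  by (rule subsetD[OF ortho_compl_subspace(1) sv_mem_ortho_compl])

lemma ortho_system_sv: "ortho_system sv"
  unfolding ortho_system_def
proof (intro conjI allI impI)
  fix i j :: nat assume "i \<noteq> j"
  have *: "cinner (sv j) (sv i) = 0" if "i < j" for i j
    using sv_mem_ortho_compl[of j] that by (auto simp: ortho_compl_def)
  show "cinner (sv i) (sv j) = 0"
    using \<open>i \<noteq> j\<close> *[of i j] *[of j i] cinner_eq_0_commute[of "sv i" "sv j"] by (cases "i < j") simp_all
next
  fix i assume "sv i \<noteq> 0"
  then show "norm (sv i) = 1" by (rule_tac sv_cases[of i]) (auto simp: maximizer_def)
qed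

lemma sval_nonneg: "0 \<le> sval n"
  by (simp add: sval_def)

lemma sval_eq_0_iff: "sval n = 0 \<longleftrightarrow> sv n = 0"
  by (rule sv_cases[of n]) (auto simp: sval_def maximizer_def f_zero)

lemma norm_f_le_sval:
  assumes "x \<in> ortho_compl (sv ` {..<n})"
  shows "norm (f x) \<le> sval n * norm x"
  by (rule sv_cases[of n]) (use assms in \<open>auto simp: maximizer_def sval_def\<close>)

lemma decseq_sval: "decseq sval"
proof (rule decseq_SucI)
  fix n
  have "sv (Suc n) \<in> ortho_compl (sv ` {..<n})"
    using sv_mem_ortho_compl[of "Suc n"] by (auto simp: ortho_compl_def)
  then have "sval (Suc n) \<le> sval n * norm (sv (Suc n))"
    using norm_f_le_sval by (simp add: sval_def[of "Suc n"])
  also have "\<dots> \<le> sval n * 1"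
    using ortho_system_norm_le[OF ortho_system_sv] sval_nonneg by (intro mult_left_mono) auto
  finally show "sval (Suc n) \<le> sval n" by simp
qed

lemma cinner_f_sv_sv: "i \<noteq> j \<Longrightarrow> cinner (f (sv i)) (f (sv j)) = 0"
proof -
  have *: "cinner (f (sv i)) (f (sv j)) = 0" if "i < j" for i j
  proof (rule sv_cases[of i])
    assume "sv i \<noteq> 0" "maximizer (ortho_compl (sv ` {..<i})) (sv i)"
    moreover have "sv j \<in> ortho_compl (sv ` {..<i})"
      using sv_mem_ortho_compl[of j] that by (auto simp: ortho_compl_def)
    ultimately have "cinner (f (sv i)) (f (sv j)) = (norm (f (sv i)))\<^sup>2 * cinner (sv i) (sv j)"
      using ortho_compl_subspace by (intro maximizer_orthogonality[of "ortho_compl (sv ` {..<i})"]) (auto simp: maximizer_def)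
    then show ?thesis using that ortho_system_sv by (simp add: ortho_system_def)
  qed (simp add: f_zero)
  assume "i \<noteq> j"
  then show ?thesis using *[of i j] *[of j i] cinner_eq_0_commute[of "f (sv i)" "f (sv j)"] by (cases "i < j") simp_all
qed

text \<open>The weak form of the eigenvalue equation of \<open>f* f\<close> at \<open>sv n\<close>.
  Maximality gives it only on the complement of the earlier vectors; the projection of
  \<open>z\<close> onto those contributes 0 to both sides, since the images \<open>f (sv i)\<close>
  are orthogonal as well.\<close>

lemma cinner_f_sv:
  assumes z: "z \<in> H"
  shows "cinner (f (sv n)) (f z) = (sval n)\<^sup>2 * cinner (sv n) z"
proof (rule sv_cases[of n])
  assume n: "sv n \<noteq> 0" "maximizer (ortho_compl (sv ` {..<n})) (sv n)"
  let ?p = "\<Sum>i<n. cinner z (sv i) *\<^sub>C sv i"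
  have p: "?p \<in> H" by (intro sum_mem scaleC_mem sv_mem)
  have "z - ?p \<in> ortho_compl (sv ` {..<n})"
  proof -
    have "cinner (z - ?p) (sv j) = 0" if "j < n" for j
    proof -
      have "cinner ?p (sv j) = (\<Sum>i<n. if i = j then cinner z (sv j) else 0)"
        unfolding cinner.sum_left
        by (intro sum.cong refl) (auto simp: cinner_scaleC_left ortho_system_cinner[OF ortho_system_sv])
      then show ?thesis using that by (simp add: cinner.diff_left)
    qed
    then show ?thesis using z p by (auto simp: ortho_compl_def diff_mem)
  qed
  then have "cinner (f (sv n)) (f (z - ?p)) = (sval n)\<^sup>2 * cinner (sv n) (z - ?p)"
    using n ortho_compl_subspace unfolding sval_def
    by (intro maximizer_orthogonality[of "ortho_compl (sv ` {..<n})"]) (auto simp: maximizer_def)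
  moreover have "cinner (f (sv n)) (f ?p) = 0"
  proof -
    have "f ?p = (\<Sum>i<n. cinner z (sv i) *\<^sub>C f (sv i))"
      by (subst f_sum) (auto simp: scaleC_mem sv_mem f_scaleC)
    then show ?thesis by (simp add: cinner.sum_right cinner_scaleC_right cinner_f_sv_sv)
  qed
  moreover have "cinner (sv n) ?p = 0"
    by (simp add: cinner.sum_right cinner_scaleC_right ortho_system_cinner[OF ortho_system_sv])
  ultimately show ?thesis using z p by (simp add: f_diff cinner.diff_right)
qed (simp add: f_zero)

text \<open>The images \<open>f (sv n)\<close> are pairwise orthogonal. Were their norms bounded
  below by some positive \<open>L\<close>, they would be \<open>L\<close>-separated, contrary to
  compactness.\<close>

lemma sval_tendsto_0: "sval \<longlonglongrightarrow> 0"
proof -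
  obtain L where L: "sval \<longlonglongrightarrow> L" "\<And>n. L \<le> sval n"
    using decseq_convergent[OF decseq_sval, of 0] sval_nonneg by blast
  have "0 \<le> L" by (rule LIMSEQ_le_const[OF L(1)]) (simp add: sval_nonneg)
  moreover have "\<not> 0 < L"
  proof
    assume "0 < L"
    obtain r y where r: "strict_mono (r :: nat \<Rightarrow> nat)" and y: "(\<lambda>n. f (sv (r n))) \<longlonglongrightarrow> y"
      using f_compact[of sv] sv_mem ortho_system_norm_le[OF ortho_system_sv] by blast
    have "Cauchy (\<lambda>n. f (sv (r n)))" using y by (rule LIMSEQ_imp_Cauchy)
    then obtain N where N: "\<And>m n. N \<le> m \<Longrightarrow> N \<le> n \<Longrightarrow> norm (f (sv (r m)) - f (sv (r n))) < L"
      using \<open>0 < L\<close> unfolding Cauchy_iff by blast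
    let ?u = "f (sv (r N))" and ?v = "f (sv (r (Suc N)))"
    have "r N \<noteq> r (Suc N)" using r using strict_mono_less[OF r, of N "Suc N"] by simp
    then have "inner ?u ?v = 0" using cinner_f_sv_sv[of "r N" "r (Suc N)"] Re_cinner[of ?u ?v] by simp
    then have "(norm (?u - ?v))\<^sup>2 = (norm ?u)\<^sup>2 + (norm ?v)\<^sup>2"
      by (simp add: power2_norm_eq_inner inner_diff_left inner_diff_right inner_commute)
    also have "\<dots> \<ge> L\<^sup>2 + 0"
      using L(2)[of "r N"] \<open>0 < L\<close> by (intro add_mono power_mono) (auto simp: sval_def)
    finally have "L\<^sup>2 \<le> (norm (?u - ?v))\<^sup>2" by simp
    then have "L \<le> norm (?u - ?v)" by (rule power2_le_imp_le) simp
    then show False using N[of N "Suc N"] by simp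
  qed
  ultimately show ?thesis using L(1) by simp
qed

lemma f_eq_0_if_orthogonal:
  assumes x: "x \<in> H" "\<And>n. cinner x (sv n) = 0"
  shows "f x = 0"
proof -
  have "norm (f x) \<le> sval n * norm x" for n
    using x by (intro norm_f_le_sval) (auto simp: ortho_compl_def)
  moreover have "(\<lambda>n. sval n * norm x) \<longlonglongrightarrow> 0 * norm x" by (intro tendsto_mult sval_tendsto_0 tendsto_const)
  ultimately have "norm (f x) \<le> 0 * norm x" by (intro LIMSEQ_le_const[of "\<lambda>n. sval n * norm x"]) auto
  then show ?thesis by simp
qed

lemma sval_bound: "\<bar>sval n\<bar> \<le> sval 0"
  using decseqD[OF decseq_sval, of 0 n] sval_nonneg[of n] by simp

lemma sval_square_bound: "\<bar>(sval n)\<^sup>2\<bar> \<le> (sval 0)\<^sup>2"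
  using sval_bound[of n] by (simp add: power_mono sval_nonneg)

text \<open>The Schmidt expansion: the part of \<open>x\<close> orthogonal to all singular vectors
  lies in the kernel of \<open>f\<close>, because \<open>f\<close> is bounded there by every
  singular value.\<close>

lemma f_eq_sum:
  assumes x: "x \<in> H"
  shows "(\<lambda>n. cinner x (sv n) *\<^sub>C f (sv n)) sums f x"
proof -
  define p where "p = mult_op sv (\<lambda>_. 1) x"
  note one = ortho_system_sv sv_mem order_refl[of "\<bar>1::real\<bar>"]
  have p: "p \<in> H" unfolding p_def by (rule mult_op_mem[OF one])
  have "cinner (x - p) (sv k) = 0" for k
    using cinner_mult_op_system[OF one, of x k] by (simp add: p_def cinner.diff_left)
  then have "f (x - p) = 0" using x p by (intro f_eq_0_if_orthogonal) (auto intro: diff_mem)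
  then have fx: "f x = f p" using f_diff[OF x p] by simp
  have S: "(\<lambda>n. \<Sum>k<n. cinner x (sv k) *\<^sub>C sv k) \<longlonglongrightarrow> p"
    using mult_op_sums[OF one, of x] by (simp add: sums_def p_def)
  have "(\<lambda>n. f (\<Sum>k<n. cinner x (sv k) *\<^sub>C sv k)) \<longlonglongrightarrow> f p"
    by (rule f_tendsto[OF S]) (auto intro!: sum_mem scaleC_mem sv_mem p)
  then show ?thesis unfolding sums_def fx
    by (subst (asm) f_sum) (auto simp: scaleC_mem sv_mem f_scaleC)
qed

text \<open>This says that \<open>f* f\<close> is diagonal in the singular vectors, phrased without
  \<open>f*\<close>: the adjoint never has to be constructed as a function.\<close>

lemma cinner_f_f:
  assumes a: "a \<in> H" and x: "x \<in> H"
  shows "cinner (f a) (f x) = cinner a (mult_op sv (\<lambda>n. (sval n)\<^sup>2) x)"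
proof -
  have "(\<lambda>n. cinner (cinner a (sv n) *\<^sub>C f (sv n)) (f x)) sums cinner (f a) (f x)"
    by (rule bounded_linear.sums[OF cinner.bounded_linear_left f_eq_sum[OF a]])
  then have "(\<lambda>n. (sval n)\<^sup>2 * cinner a (sv n) * cinner (sv n) x) sums cinner (f a) (f x)"
    by (simp add: cinner_scaleC_left cinner_f_sv[OF x] mult_ac)
  moreover have "(\<lambda>n. (sval n)\<^sup>2 * cinner a (sv n) * cinner (sv n) x) sums cinner (mult_op sv (\<lambda>n. (sval n)\<^sup>2) a) x"
    by (rule cinner_mult_op_left[OF ortho_system_sv sv_mem sval_square_bound])
  ultimately have "cinner (f a) (f x) = cinner (mult_op sv (\<lambda>n. (sval n)\<^sup>2) a) x"
    by (rule sums_unique2)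
  then show ?thesis
    using mult_op_symmetric[OF ortho_system_sv sv_mem sval_square_bound] by simp
qed

end

section \<open>The modulus of a compact operator\<close>

definition graph_on :: "'a set \<Rightarrow> ('a \<Rightarrow> 'a) \<Rightarrow> ('a \<times> 'a) set" where
  "graph_on H f = (\<lambda>x. (x, f x)) ` H"

lemma graph_on_iff [simp]: "(x, y) \<in> graph_on H f \<longleftrightarrow> x \<in> H \<and> y = f x"
  by (auto simp: graph_on_def)

lemma graph_on_ball [simp]: "(\<forall>p\<in>graph_on H f. P p) \<longleftrightarrow> (\<forall>x\<in>H. P (x, f x))"
  by (auto simp: graph_on_def)

lemma (in bounded_map) linear_operator_graph: "linear_operator H (graph_on H f)"
  unfolding linear_operator_def
  by (auto simp: single_valued_def f_mem f_add f_scaleC f_zero zero_mem add_mem scaleC_mem graph_on_def)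

context hilbert_subspace
begin

lemma bounded_operator_imp_graph:
  assumes "bounded_operator H T"
  obtains f B where "T = graph_on H f" "bounded_map H f B"
proof -
  have lin: "linear_operator H T" using assms by (simp add: bounded_operator_def)
  obtain B where B: "\<forall>(x, y)\<in>T. norm y \<le> B * norm x" using assms by (auto simp: bounded_operator_def)
  have T: "T \<subseteq> H \<times> H" "single_valued T" "Domain T = H"
      "\<And>x y x' y'. (x, y) \<in> T \<Longrightarrow> (x', y') \<in> T \<Longrightarrow> (x + x', y + y') \<in> T"
      "\<And>c x y. (x, y) \<in> T \<Longrightarrow> (c *\<^sub>C x, c *\<^sub>C y) \<in> T" "\<And>x y. (x, y) \<in> T \<Longrightarrow> norm y \<le> B * norm x"
    using lin B assms by (auto simp: linear_operator_def bounded_operator_def)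
  define f where "f x = (THE y. (x, y) \<in> T)" for x
  have fI: "f x = y" if "(x, y) \<in> T" for x y
    unfolding f_def using T(2) that by (auto simp: single_valued_def intro!: the_equality)
  have f: "(x, f x) \<in> T" if "x \<in> H" for x
  proof -
    have "x \<in> Domain T" using that T(3) by simp
    then obtain y where "(x, y) \<in> T" by (rule DomainE)
    then show ?thesis using fI by simp
  qed
  have "T = graph_on H f"
  proof (intro Set.set_eqI iffI)
    fix p assume "p \<in> T"
    then show "p \<in> graph_on H f" using fI T(1) by (cases p) auto
  next
    fix p assume "p \<in> graph_on H f"
    then show "p \<in> T" using f by (cases p) simp
  qed
  moreover have "bounded_map H f B"
  proof
    show "f x \<in> H" if "x \<in> H" for x using f[OF that] T(1) by blast
    show "f (x + y) = f x + f y" if "x \<in> H" "y \<in> H" for x y by (intro fI T(4) f that)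
    show "f (c *\<^sub>C x) = c *\<^sub>C f x" if "x \<in> H" for c x by (intro fI T(5) f that)
    show "norm (f x) \<le> B * norm x" if "x \<in> H" for x by (intro T(6) f that)
  qed
  ultimately show thesis by (rule that)
qed

lemma compact_operator_graph_imp_compact_map:
  assumes "compact_operator H (graph_on H f)" "bounded_map H f B"
  shows "compact_map H f B"
proof -
  interpret bounded_map H f B by fact
  show ?thesis
  proof
    fix X :: "nat \<Rightarrow> 'a" assume X: "\<And>n. X n \<in> H \<and> norm (X n) \<le> 1"
    let ?S = "graph_on H f `` (H \<inter> cball 0 1)"
    have "seq_compact (closure ?S)"
      using assms(1) unfolding compact_operator_def by (simp add: compact_eq_seq_compact_metric)
    moreover have "f (X n) \<in> closure ?S" for n
      using X[of n] by (intro subsetD[OF closure_subset] ImageI[of "X n"]) simp_all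
    ultimately obtain y r where "strict_mono (r :: nat \<Rightarrow> nat)" "((\<lambda>n. f (X n)) \<circ> r) \<longlonglongrightarrow> y"
      using seq_compactE[of "closure ?S" "\<lambda>n. f (X n)"] by blast
    then show "\<exists>r y. strict_mono (r :: nat \<Rightarrow> nat) \<and> (\<lambda>n. f (X (r n))) \<longlonglongrightarrow> y"
      by (auto simp: o_def)
  qed
qed

end

context compact_map
begin

abbreviation "T \<equiv> graph_on H f"

definition absf :: "'a \<Rightarrow> 'a" where
  "absf = mult_op sv sval"

lemmas absf_mem = mult_op_mem[where w = sval, OF ortho_system_sv sv_mem sval_bound, folded absf_def]
lemmas absf_symmetric = mult_op_symmetric[where w = sval, OF ortho_system_sv sv_mem sval_bound, folded absf_def]
lemmas absf_add = mult_op_add[where w = sval, OF ortho_system_sv sv_mem sval_bound, folded absf_def]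
lemmas absf_scaleC = mult_op_scaleC[where w = sval, OF ortho_system_sv sv_mem sval_bound, folded absf_def]
lemmas cinner_absf_sv = cinner_mult_op_system[where w = sval, OF ortho_system_sv sv_mem sval_bound, folded absf_def]

lemma absf_absf: "absf (absf x) = mult_op sv (\<lambda>n. (sval n)\<^sup>2) x"
  unfolding absf_def by (rule mult_op_mult_op[where w = sval, OF ortho_system_sv sv_mem sval_bound])

lemma linear_operator_absf: "linear_operator H (graph_on H absf)"
  unfolding linear_operator_def
  using absf_scaleC[of 0 0]
  by (auto simp: single_valued_def absf_mem absf_add absf_scaleC zero_mem add_mem scaleC_mem graph_on_def)

lemma nonneg_operator_absf: "nonneg_operator H (graph_on H absf)"
  unfolding nonneg_operator_def self_adjoint_operator_def
proof (intro conjI linear_operator_absf)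
  show "adjoint_operator H (graph_on H absf) = graph_on H absf"
  proof (intro Set.set_eqI iffI)
    fix p assume "p \<in> adjoint_operator H (graph_on H absf)"
    then obtain v w where p: "p = (v, w)" "v \<in> H" "w \<in> H" "\<And>x. x \<in> H \<Longrightarrow> cinner (absf x) v = cinner x w"
      by (auto simp: adjoint_operator_def)
    have "w = absf v" by (rule eqI) (auto simp: p absf_mem absf_symmetric[symmetric])
    then show "p \<in> graph_on H absf" using p by simp
  next
    fix p assume "p \<in> graph_on H absf"
    then show "p \<in> adjoint_operator H (graph_on H absf)"
      by (cases p) (auto simp: adjoint_operator_def absf_mem absf_symmetric)
  qed
  have "cinner (absf x) x \<in> \<real>\<^sub>\<ge>\<^sub>0" for x
  proof -
    have "(\<lambda>n. sval n * cinner x (sv n) * cinner (sv n) x) sums cinner (absf x) x"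
      unfolding absf_def by (rule cinner_mult_op_left[OF ortho_system_sv sv_mem sval_bound])
    moreover have "sval n * cinner x (sv n) * cinner (sv n) x = complex_of_real (sval n * (norm (cinner x (sv n)))\<^sup>2)" for n
      using cinner_commute[of "sv n" x] by (simp add: complex_norm_square[symmetric] mult.assoc)
    ultimately have s: "(\<lambda>n. complex_of_real (sval n * (norm (cinner x (sv n)))\<^sup>2)) sums cinner (absf x) x" by simp
    have "(\<lambda>n. sval n * (norm (cinner x (sv n)))\<^sup>2) sums Re (cinner (absf x) x)"
      using sums_Re[OF s] by simp
    then have "0 \<le> Re (cinner (absf x) x)"
      by (rule sums_le[OF _ sums_zero, rotated]) (simp add: sval_nonneg)
    moreover have "(\<lambda>n. 0) sums Im (cinner (absf x) x)" using sums_Im[OF s] by simp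
    then have "Im (cinner (absf x) x) = 0" by (rule sums_unique2[OF _ sums_zero])
    ultimately show ?thesis by (simp add: complex_nonneg_Reals_iff)
  qed
  then show "\<forall>(x, y)\<in>graph_on H absf. cinner y x \<in> \<real>\<^sub>\<ge>\<^sub>0" by auto
qed

lemma T_adjoint_T: "T O adjoint_operator H T = graph_on H (\<lambda>x. absf (absf x))"
proof (intro Set.set_eqI iffI)
  fix p assume "p \<in> T O adjoint_operator H T"
  then obtain x z where p: "p = (x, z)" "x \<in> H" "z \<in> H" "\<And>a. a \<in> H \<Longrightarrow> cinner (f a) (f x) = cinner a z"
    by (auto simp: adjoint_operator_def)
  have "z = absf (absf x)"
    by (rule eqI) (use p in \<open>auto simp: absf_absf cinner_f_f[symmetric]
      mult_op_mem[where w = "\<lambda>n. (sval n)\<^sup>2", OF ortho_system_sv sv_mem sval_square_bound]\<close>)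
  then show "p \<in> graph_on H (\<lambda>x. absf (absf x))" using p by simp
next
  fix p assume "p \<in> graph_on H (\<lambda>x. absf (absf x))"
  then show "p \<in> T O adjoint_operator H T"
    by (cases p) (auto simp: adjoint_operator_def f_mem cinner_f_f absf_absf
      mult_op_mem[where w = "\<lambda>n. (sval n)\<^sup>2", OF ortho_system_sv sv_mem sval_square_bound] intro!: relcompI)
qed

text \<open>The definition by \<open>THE\<close> demands uniqueness of the nonnegative square root
  among relations that are a priori neither bounded nor everywhere defined. A competitor
  \<open>C\<close> is first identified on the singular vectors and then on all of \<open>H\<close>;
  every point is in its domain because \<open>C O C\<close> is defined everywhere.\<close>

lemma abs_operator_eq: "abs_operator H T = graph_on H absf"
  unfolding abs_operator_def T_adjoint_T
proof (rule the_equality)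
  show "nonneg_operator H (graph_on H absf) \<and> graph_on H absf O graph_on H absf = graph_on H (\<lambda>x. absf (absf x))"
    using nonneg_operator_absf absf_mem by (auto simp: graph_on_def relcomp_unfold)
next
  fix C assume C: "nonneg_operator H C \<and> C O C = graph_on H (\<lambda>x. absf (absf x))"
  have lin: "linear_operator H C" and adj: "adjoint_operator H C = C"
    and nn: "\<And>x y. (x, y) \<in> C \<Longrightarrow> cinner y x \<in> \<real>\<^sub>\<ge>\<^sub>0"
    using C by (auto simp: nonneg_operator_def self_adjoint_operator_def)
  have CH: "C \<subseteq> H \<times> H" and sv_C: "\<And>x y y'. (x, y) \<in> C \<Longrightarrow> (x, y') \<in> C \<Longrightarrow> y = y'"
    and addC: "\<And>x y x' y'. (x, y) \<in> C \<Longrightarrow> (x', y') \<in> C \<Longrightarrow> (x + x', y + y') \<in> C"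
    and scC: "\<And>c x y. (x, y) \<in> C \<Longrightarrow> (c *\<^sub>C x, c *\<^sub>C y) \<in> C"
    using lin by (auto simp: linear_operator_def single_valued_def)
  have ex: "\<exists>y. (x, y) \<in> C \<and> (y, absf (absf x)) \<in> C" if "x \<in> H" for x
  proof -
    have "(x, absf (absf x)) \<in> C O C" using C that by simp
    then show ?thesis by blast
  qed
  have sym: "cinner y v = cinner x w" if "(x, y) \<in> C" "(v, w) \<in> C" for x y v w
  proof -
    have "(v, w) \<in> adjoint_operator H C" using that(2) adj by simp
    then show ?thesis using that(1) by (auto simp: adjoint_operator_def)
  qed
  have C_sv: "(sv n, complex_of_real (sval n) *\<^sub>C sv n) \<in> C" for n
  proof -
    obtain y where y: "(sv n, y) \<in> C" "(y, absf (absf (sv n))) \<in> C" using ex sv_mem by blast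
    have abs2: "absf (absf (sv n)) = complex_of_real ((sval n)\<^sup>2) *\<^sub>C sv n"
    proof (rule eqI)
      fix z assume "z \<in> H"
      have "cinner z (absf (absf (sv n))) = cinner (f z) (f (sv n))"
        unfolding absf_absf by (rule cinner_f_f[OF \<open>z \<in> H\<close> sv_mem, symmetric])
      also have "\<dots> = cnj (cinner (f (sv n)) (f z))" by (rule cinner_commute)
      also have "\<dots> = cinner z (complex_of_real ((sval n)\<^sup>2) *\<^sub>C sv n)"
        by (simp add: cinner_f_sv[OF \<open>z \<in> H\<close>] cinner_scaleC_right cinner_commute[symmetric])
      finally show "cinner z (absf (absf (sv n))) = cinner z (complex_of_real ((sval n)\<^sup>2) *\<^sub>C sv n)" .
    qed (auto simp: absf_mem scaleC_mem sv_mem)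
    \<comment> \<open>Factorization of \<open>C\<^sup>2 - s\<^sup>2\<close>: the vector
      \<open>u = (C - s) (sv n)\<close> satisfies \<open>C u = - s u\<close>, which nonnegativity of
      \<open>C\<close> permits only if \<open>s\<close> or \<open>u\<close> is 0.\<close>
    define u where "u = y - complex_of_real (sval n) *\<^sub>C sv n"
    have "(u, - complex_of_real (sval n) *\<^sub>C u) \<in> C"
    proof -
      have "(y + (- complex_of_real (sval n)) *\<^sub>C sv n, absf (absf (sv n)) + (- complex_of_real (sval n)) *\<^sub>C y) \<in> C"
        by (intro addC scC y)
      moreover have "absf (absf (sv n)) + (- complex_of_real (sval n)) *\<^sub>C y = - complex_of_real (sval n) *\<^sub>C u"
        by (simp add: abs2 u_def scaleC.diff_right scaleC.minus_left scaleC_scaleC power2_eq_square)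
      ultimately show ?thesis by (simp add: u_def scaleC.minus_left)
    qed
    then have "cinner (- complex_of_real (sval n) *\<^sub>C u) u \<in> \<real>\<^sub>\<ge>\<^sub>0" by (rule nn)
    moreover have "cinner (- complex_of_real (sval n) *\<^sub>C u) u = complex_of_real (- (sval n * (norm u)\<^sup>2))"
      unfolding cinner_scaleC_left cinner_self by simp
    ultimately have "- (sval n * (norm u)\<^sup>2) \<ge> 0"
      by (simp only: nonneg_Reals_of_real_iff)
    then have "sval n = 0 \<or> u = 0" using sval_nonneg[of n] by (auto simp: mult_le_0_iff)
    then show ?thesis
    proof
      assume "sval n = 0"
      then have "sv n = 0" by (simp add: sval_eq_0_iff)
      then show ?thesis using scC[OF y(1), of 0] by simp
    next
      assume "u = 0"
      then show ?thesis using y(1) by (simp add: u_def)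
    qed
  qed
  have eq: "y = absf x" if xy: "(x, y) \<in> C" for x y
  proof -
    have xH: "x \<in> H" "y \<in> H" using xy CH by auto
    \<comment> \<open>This difference is orthogonal to every singular vector, hence killed by
      \<open>absf\<close> and by \<open>C O C\<close>. By symmetry \<open>C u\<close> is then 0 as
      well, and \<open>u\<close> is orthogonal to both \<open>y\<close> and \<open>absf x\<close>,
      hence to itself.\<close>
    define u where "u = y - absf x"
    have uH: "u \<in> H" using xH by (simp add: u_def diff_mem absf_mem)
    have u_sv: "cinner u (sv n) = 0" for n
      using sym[OF xy C_sv[of n]] by (simp add: u_def cinner.diff_left cinner_absf_sv cinner_scaleC_right)
    obtain v where v: "(u, v) \<in> C" "(v, absf (absf u)) \<in> C" using ex[OF uH] by blast
    have absf0: "absf u = 0"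
      by (rule eqI) (auto simp: absf_mem zero_mem absf_def mult_op_def u_sv)
    have "cinner v v = cinner u (absf (absf u))" using sym[OF v(1) v(2)] by simp
    also have "\<dots> = 0" using absf_symmetric[of u "absf u"] absf0 by simp
    finally have "v = 0" using cinner_self[of v] by simp
    then have "cinner y u = 0" using sym[OF xy v(1)] by simp
    moreover have "cinner (absf x) u = 0" using absf_symmetric[of x u] absf0 by simp
    ultimately have "cinner u u = 0" by (simp add: u_def cinner.diff_left)
    then have "u = 0" using cinner_self[of u] by simp
    then show ?thesis by (simp add: u_def)
  qed
  show "C = graph_on H absf"
  proof (intro Set.set_eqI iffI)
    fix p assume "p \<in> C"
    then show "p \<in> graph_on H absf" using eq CH by (cases p) auto
  next
    fix p assume "p \<in> graph_on H absf"
    then obtain x where x: "x \<in> H" "p = (x, absf x)" by (auto simp: graph_on_def)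
    obtain y where "(x, y) \<in> C" using ex[OF x(1)] by blast
    then show "p \<in> C" using eq x(2) by simp
  qed
qed

end

section \<open>Identification of the \<open>s\<close>-numbers with the maximal values\<close>

lemma downward_closed_eq_lessThan_card:
  fixes A :: "nat set"
  assumes "finite A" and down: "\<And>x y. x \<in> A \<Longrightarrow> y \<le> x \<Longrightarrow> y \<in> A"
  shows "A = {..<card A}"
proof -
  define k where "k = (LEAST n. n \<notin> A)"
  have "\<exists>n. n \<notin> A" using ex_new_if_finite[OF infinite_UNIV_nat assms(1)] by blast
  then have k: "k \<notin> A" unfolding k_def by (rule LeastI_ex)
  have "A = {..<k}"
  proof (intro Set.set_eqI iffI)
    fix n assume "n \<in> A"
    then show "n \<in> {..<k}" using down[of n k] k by (cases "k \<le> n") auto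
  next
    fix n assume "n \<in> {..<k}"
    then show "n \<in> A" using not_less_Least[of n "\<lambda>n. n \<notin> A"] by (auto simp: k_def)
  qed
  then show ?thesis by simp
qed

lemma finite_ge_if_tendsto_0:
  fixes t :: "nat \<Rightarrow> real"
  assumes "t \<longlonglongrightarrow> 0" "0 < \<mu>"
  shows "finite {n. \<mu> \<le> t n}"
proof -
  have "\<forall>\<^sub>F n in sequentially. t n < \<mu>" by (rule order_tendstoD(2)[OF assms])
  then obtain N where N: "\<And>n. N \<le> n \<Longrightarrow> t n < \<mu>" by (auto simp: eventually_sequentially)
  have "{n. \<mu> \<le> t n} \<subseteq> {..<N}"
  proof
    fix n assume "n \<in> {n. \<mu> \<le> t n}"
    then have "\<not> N \<le> n" using N[of n] by auto
    then show "n \<in> {..<N}" by simp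
  qed
  then show ?thesis by (rule finite_subset) simp
qed

text \<open>The sets where a decreasing sequence is at least \<mu> are initial segments, so they are
  determined by their sizes, and these are sums of finitely many level set sizes. The convergence of
  \<open>t\<close> to 0 makes the set of relevant values finite.\<close>

lemma decseq_eq_if_level_sets:
  fixes s t :: "nat \<Rightarrow> real"
  assumes s: "decseq s" "\<And>n. 0 \<le> s n" and t: "decseq t" "\<And>n. 0 \<le> t n" "t \<longlonglongrightarrow> 0"
    and fin: "\<And>\<mu>. 0 < \<mu> \<Longrightarrow> finite {n. s n = \<mu>}"
    and level: "\<And>\<mu>. 0 < \<mu> \<Longrightarrow> card {n. s n = \<mu>} = card {n. t n = \<mu>}"
  shows "s n = t n"
proof -
  have level_eq: "{n. \<mu> \<le> u n} = {..<card {n. \<mu> \<le> u n}}"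
    if "decseq u" "finite {n. \<mu> \<le> u n}" for u :: "nat \<Rightarrow> real" and \<mu>
  proof (rule downward_closed_eq_lessThan_card[OF that(2)])
    fix x y :: nat assume "x \<in> {n. \<mu> \<le> u n}" "y \<le> x"
    then show "y \<in> {n. \<mu> \<le> u n}" using decseqD[OF that(1), of y x] by simp
  qed
  have eq: "{n. \<mu> \<le> s n} = {n. \<mu> \<le> t n}" if \<mu>: "0 < \<mu>" for \<mu>
  proof -
    have fint: "finite {n. \<mu> \<le> t n}" by (rule finite_ge_if_tendsto_0[OF t(3) \<mu>])
    define V where "V = t ` {n. \<mu> \<le> t n}"
    have V: "finite V" "\<And>v. v \<in> V \<Longrightarrow> \<mu> \<le> v" using fint by (auto simp: V_def)
    have s_un: "{n. \<mu> \<le> s n} = (\<Union>v\<in>V. {n. s n = v})"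
    proof (intro Set.set_eqI iffI)
      fix n assume "n \<in> {n. \<mu> \<le> s n}"
      then have n: "\<mu> \<le> s n" "0 < s n" using \<mu> by auto
      have "0 < card {m. s m = s n}" using fin[OF n(2)] by (subst card_gt_0_iff) auto
      then have "0 < card {m. t m = s n}" unfolding level[OF n(2)] .
      then obtain m where "t m = s n" unfolding card_gt_0_iff by blast
      then have "s n \<in> V" unfolding V_def using n(1) by (intro image_eqI[of _ _ m]) simp_all
      then show "n \<in> (\<Union>v\<in>V. {n. s n = v})" by blast
    qed (use V in auto)
    have t_un: "{n. \<mu> \<le> t n} = (\<Union>v\<in>V. {n. t n = v})"
    proof (intro Set.set_eqI iffI)
      fix n assume "n \<in> {n. \<mu> \<le> t n}"
      then have "t n \<in> V" unfolding V_def by (rule imageI)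
      then show "n \<in> (\<Union>v\<in>V. {n. t n = v})" by blast
    next
      fix n assume "n \<in> (\<Union>v\<in>V. {n. t n = v})"
      then have "t n \<in> V" by blast
      then show "n \<in> {n. \<mu> \<le> t n}" using V(2) by simp
    qed
    have fs: "finite {n. s n = v}" if "v \<in> V" for v
      using V(2)[OF that] \<mu> by (intro fin) simp
    have ft: "finite {n. t n = v}" if "v \<in> V" for v
      by (rule finite_subset[OF _ fint]) (use V(2)[OF that] in auto)
    have "card {n. \<mu> \<le> s n} = (\<Sum>v\<in>V. card {n. s n = v})"
      unfolding s_un by (rule card_UN_disjoint) (use V(1) fs in auto)
    also have "\<dots> = (\<Sum>v\<in>V. card {n. t n = v})"
    proof (rule sum.cong[OF refl])
      fix v assume "v \<in> V"
      then show "card {n. s n = v} = card {n. t n = v}" using V(2)[of v] \<mu> by (intro level) simp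
    qed
    also have "\<dots> = card {n. \<mu> \<le> t n}"
      unfolding t_un by (rule card_UN_disjoint[symmetric]) (use V(1) ft in auto)
    finally have "card {n. \<mu> \<le> s n} = card {n. \<mu> \<le> t n}" .
    moreover have "finite {n. \<mu> \<le> s n}" unfolding s_un using V(1) fs by (intro finite_UN_I)
    then have "{n. \<mu> \<le> s n} = {..<card {n. \<mu> \<le> s n}}" by (rule level_eq[OF s(1)])
    moreover have "{n. \<mu> \<le> t n} = {..<card {n. \<mu> \<le> t n}}" by (rule level_eq[OF t(1) fint])
    ultimately show ?thesis by simp
  qed
  show ?thesis
  proof (rule linorder_cases[of "s n" "t n"])
    assume "s n < t n"
    then have "n \<in> {m. t n \<le> s m}" using eq[of "t n"] s(2)[of n] by simp
    then show ?thesis using \<open>s n < t n\<close> by simp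
  next
    assume "t n < s n"
    then have "n \<in> {m. s n \<le> t m}" using eq[of "s n", symmetric] t(2)[of n] by simp
    then show ?thesis using \<open>t n < s n\<close> by simp
  qed
qed

context compact_map
begin

lemma absf_sv: "absf (sv n) = complex_of_real (sval n) *\<^sub>C sv n"
proof (rule eqI[OF absf_mem scaleC_mem[OF sv_mem]])
  fix z
  have "cinner z (absf (sv n)) = cinner (absf z) (sv n)" by (rule absf_symmetric[symmetric])
  also have "cinner (absf z) (sv n) = sval n * cinner z (sv n)" by (rule cinner_absf_sv)
  also have "sval n * cinner z (sv n) = cinner z (complex_of_real (sval n) *\<^sub>C sv n)"
    by (simp only: cinner_scaleC_right complex_cnj_complex_of_real)
  finally show "cinner z (absf (sv n)) = cinner z (complex_of_real (sval n) *\<^sub>C sv n)" .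
qed

lemma finite_level_set: "0 < \<mu> \<Longrightarrow> finite {n. sval n = \<mu>}"
proof -
  assume \<mu>: "0 < \<mu>"
  show "finite {n. sval n = \<mu>}"
    by (rule finite_subset[OF _ finite_ge_if_tendsto_0[OF sval_tendsto_0 \<mu>]]) auto
qed

text \<open>By symmetry an eigenvector for \<mu> is orthogonal to every \<open>sv n\<close> with
  another singular value, so the series for \<open>absf x\<close> collapses to the finitely many
  remaining terms.\<close>

lemma eigenvalue_multiplicity_absf:
  assumes \<mu>: "0 < \<mu>"
  shows "eigenvalue_multiplicity (graph_on H absf) (complex_of_real \<mu>) = card {n. sval n = \<mu>}"
proof -
  define I where "I = {n. sval n = \<mu>}"
  have finI: "finite I" using finite_level_set[OF \<mu>] by (simp add: I_def)
  have nz: "sv n \<noteq> 0" if "n \<in> I" for n using that \<mu> sval_eq_0_iff[of n] by (auto simp: I_def)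
  have inj: "inj_on sv I"
  proof (rule inj_onI, rule ccontr)
    fix i j assume ij: "i \<in> I" "j \<in> I" "sv i = sv j" "i \<noteq> j"
    then have "cinner (sv i) (sv i) = 0" using ortho_system_cinner[OF ortho_system_sv, of i j] by simp
    then show False using nz[OF ij(1)] by (simp add: cinner_self)
  qed
  show ?thesis
    unfolding eigenvalue_multiplicity_def I_def[symmetric]
  proof (rule complex_vs.dim_unique[of "sv ` I"])
    show "sv ` I \<subseteq> {x. (x, complex_of_real \<mu> *\<^sub>C x) \<in> graph_on H absf}"
      by (auto simp: I_def sv_mem absf_sv)
    show "{x. (x, complex_of_real \<mu> *\<^sub>C x) \<in> graph_on H absf} \<subseteq> complex_vs.span (sv ` I)"
    proof
      fix x assume "x \<in> {x. (x, complex_of_real \<mu> *\<^sub>C x) \<in> graph_on H absf}"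
      then have x: "x \<in> H" "absf x = complex_of_real \<mu> *\<^sub>C x" by auto
      have "cinner x (sv n) = 0" if "n \<notin> I" for n
      proof -
        have "complex_of_real \<mu> * cinner x (sv n) = sval n * cinner x (sv n)"
          using cinner_absf_sv[of x n] by (simp add: x(2) cinner_scaleC_left)
        then show ?thesis using that by (auto simp: I_def)
      qed
      then have "(\<lambda>n. (sval n * cinner x (sv n)) *\<^sub>C sv n) sums (\<Sum>n\<in>I. (sval n * cinner x (sv n)) *\<^sub>C sv n)"
        using finI by (intro sums_finite) auto
      then have "absf x = (\<Sum>n\<in>I. (sval n * cinner x (sv n)) *\<^sub>C sv n)"
        unfolding absf_def
        by (rule sums_unique2[OF mult_op_sums[where w = sval, OF ortho_system_sv sv_mem sval_bound]])
      also have "\<dots> \<in> complex_vs.span (sv ` I)"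
        by (intro complex_vs.span_sum complex_vs.span_scale complex_vs.span_base) auto
      finally have "(1 / complex_of_real \<mu>) *\<^sub>C absf x \<in> complex_vs.span (sv ` I)"
        by (rule complex_vs.span_scale)
      then show "x \<in> complex_vs.span (sv ` I)" using \<mu> by (simp add: x scaleC_scaleC)
    qed
    show "complex_vs.independent (sv ` I)"
    proof (rule complex_vs.independent_if_scalars_zero)
      fix c x assume sum0: "(\<Sum>x\<in>sv ` I. c x *\<^sub>C x) = 0" and "x \<in> sv ` I"
      then obtain k where k: "k \<in> I" "x = sv k" by blast
      have "(\<Sum>x\<in>sv ` I. c x *\<^sub>C x) = (\<Sum>n\<in>I. c (sv n) *\<^sub>C sv n)" by (simp add: sum.reindex[OF inj])
      then have "0 = cinner (\<Sum>n\<in>I. c (sv n) *\<^sub>C sv n) (sv k)" using sum0 by simp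
      also have "\<dots> = (\<Sum>n\<in>I. if n = k then c (sv k) else 0)"
        unfolding cinner.sum_left using nz
        by (intro sum.cong refl) (auto simp: cinner_scaleC_left ortho_system_cinner[OF ortho_system_sv])
      also have "\<dots> = c x" using k finI by simp
      finally show "c x = 0" by simp
    qed (use finI in simp)
    show "card (sv ` I) = card I" by (rule card_image[OF inj])
  qed
qed

text \<open>\<open>sval\<close> enumerates the eigenvalues, so the enumeration chosen by
  \<open>SOME\<close> has the required property, and any two such enumerations agree from index 1
  on. The shift by \<open>Suc\<close> reflects that \<open>sval\<close> starts at 0.\<close>

lemma s_number_eq_sval: "s_number H T (Suc n) = sval n"
proof -
  have eig: "enumerates_eigenvalues (graph_on H absf) s \<longleftrightarrow> (\<forall>n. 0 \<le> s (Suc n) \<and> s (Suc (Suc n)) \<le> s (Suc n)) \<and>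
     (\<forall>\<mu>>0. finite {n. s (Suc n) = \<mu>} \<and> card {n. s (Suc n) = \<mu>} = card {n. sval n = \<mu>})" for s
  proof -
    have "{n. 1 \<le> n \<and> s n = \<mu>} = Suc ` {n. s (Suc n) = \<mu>}" for \<mu>
      by (auto simp: image_iff Suc_le_eq gr0_conv_Suc)
    then have "finite {n. 1 \<le> n \<and> s n = \<mu>} \<longleftrightarrow> finite {n. s (Suc n) = \<mu>}"
        "card {n. 1 \<le> n \<and> s n = \<mu>} = card {n. s (Suc n) = \<mu>}" for \<mu>
      by (simp_all add: finite_image_iff card_image)
    moreover have "(\<forall>n\<ge>1. 0 \<le> s n \<and> s (Suc n) \<le> s n) \<longleftrightarrow> (\<forall>n. 0 \<le> s (Suc n) \<and> s (Suc (Suc n)) \<le> s (Suc n))"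
      by (auto simp: Suc_le_eq gr0_conv_Suc)
    ultimately show ?thesis by (simp add: enumerates_eigenvalues_def eigenvalue_multiplicity_absf)
  qed
  define s where "s = s_number H T"
  have "enumerates_eigenvalues (graph_on H absf) (\<lambda>n. sval (n - 1))"
    unfolding eig using decseqD[OF decseq_sval] finite_level_set sval_nonneg by simp
  then have "enumerates_eigenvalues (graph_on H absf) s"
    unfolding s_def s_number_def abs_operator_eq
    by (rule someI[of "enumerates_eigenvalues (graph_on H absf)"])
  then show ?thesis
    unfolding s_def[symmetric] eig
    by (intro decseq_eq_if_level_sets decseq_sval sval_nonneg sval_tendsto_0 decseq_SucI) auto
qed

end

section \<open>Perturbations of positive compact operators\<close>

lemma pert_mat_0: "Determinant.det (pert_mat n lam s g f 0) = 1"
proof -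
  have "pert_mat n lam s g f 0 = 1\<^sub>m n"
    by (rule eq_matI) (auto simp: pert_mat_def)
  then show ?thesis by simp
qed

text \<open>A replacement for \<open>1 + x \<le> exp x\<close> whose exponent grows only like
  \<open>x powr q\<close>. For large \<open>x\<close> it is the bound of the logarithm of
  \<open>(2 * x) powr q\<close> by its argument, whence the constant \<open>2 / q\<close>.\<close>

lemma one_plus_le_exp_powr:
  fixes x q :: real
  assumes x: "0 \<le> x" and q: "0 < q" "q \<le> 1"
  shows "1 + x \<le> exp (2 / q * x powr q)"
proof (cases "x \<le> 1")
  case True
  have "x \<le> 2 / q * x powr q"
  proof (cases "x = 0")
    case False
    have "x powr 1 \<le> x powr q" using x False True q by (intro powr_mono') auto
    also have "\<dots> \<le> 2 / q * x powr q" using q mult_right_mono[of 1 "2 / q" "x powr q"] by simp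
    finally show ?thesis using x False by simp
  qed simp
  then show ?thesis using exp_ge_add_one_self[of "2 / q * x powr q"] by linarith
next
  case False
  then have x1: "1 < x" by simp
  have "1 + x \<le> 2 * x" using x1 by simp
  also have "\<dots> = exp (1 / q * ln ((2 * x) powr q))" using x1 q by (simp add: ln_powr)
  also have "\<dots> \<le> exp (1 / q * (2 * x powr q))"
  proof -
    have "ln ((2 * x) powr q) \<le> (2 * x) powr q" using x1 by (intro ln_bound) auto
    also have "\<dots> = 2 powr q * x powr q" using x1 by (simp add: powr_mult)
    also have "\<dots> \<le> 2 powr 1 * x powr q" using q by (intro mult_right_mono powr_mono) auto
    finally have "ln ((2 * x) powr q) \<le> 2 * x powr q" by simp
    then show ?thesis using q by (intro exp_le_cancel_iff[THEN iffD2] mult_left_mono) auto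
  qed
  finally show ?thesis by (simp add: field_simps)
qed

text \<open>Turns the product from the determinant estimate into growth of order \<open>q\<close>,
  uniformly in \<open>N\<close>. The square roots of the singular values are responsible for the
  exponents 1/2 and \<open>q / 2\<close> in the summability assumptions.\<close>

lemma prod_one_plus_le_exp_powr:
  fixes s :: "nat \<Rightarrow> real"
  assumes s: "\<And>j. 0 \<le> s j" and q: "0 < q" "q \<le> 1"
    and summ: "summable (\<lambda>j. s j powr (1 / 2))" "summable (\<lambda>j. s j powr (q / 2))"
  obtains C where "0 \<le> C"
    "\<And>N y. 0 \<le> y \<Longrightarrow> (\<Prod>j\<in>{0..<N}. 1 + y * sqrt (s j) * (\<Sum>i\<in>{0..<N}. sqrt (s i))) \<le> exp (C * y powr q)"
proof
  define S where "S = (\<Sum>j. s j powr (1 / 2))"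
  define S' where "S' = (\<Sum>j. s j powr (q / 2))"
  have S: "0 \<le> S" "0 \<le> S'" unfolding S_def S'_def by (intro suminf_nonneg summ; simp)+
  define C where "C = 2 / q * (S powr q * S')"
  show "0 \<le> C" using q S by (simp add: C_def)
  fix N and y :: real assume y: "0 \<le> y"
  have sqrt_le: "(\<Sum>i\<in>{0..<N}. sqrt (s i)) \<le> S"
    unfolding S_def using s sum_le_suminf[OF summ(1), of "{0..<N}"] by (simp add: powr_half_sqrt)
  have "(\<Prod>j\<in>{0..<N}. 1 + y * sqrt (s j) * (\<Sum>i\<in>{0..<N}. sqrt (s i)))
      \<le> (\<Prod>j\<in>{0..<N}. exp (2 / q * (y powr q * S powr q * s j powr (q / 2))))"
  proof (intro prod_mono conjI)
    fix j
    have "1 + y * sqrt (s j) * (\<Sum>i\<in>{0..<N}. sqrt (s i)) \<le> 1 + y * sqrt (s j) * S"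
      using y s sqrt_le by (intro add_left_mono mult_left_mono) auto
    also have "\<dots> \<le> exp (2 / q * (y * sqrt (s j) * S) powr q)"
      using y s S q by (intro one_plus_le_exp_powr) auto
    also have "(y * sqrt (s j) * S) powr q = y powr q * S powr q * s j powr (q / 2)"
      using y s S by (simp add: powr_mult powr_half_sqrt[symmetric] powr_powr)
    finally show "1 + y * sqrt (s j) * (\<Sum>i\<in>{0..<N}. sqrt (s i)) \<le> exp (2 / q * (y powr q * S powr q * s j powr (q / 2)))" .
    show "0 \<le> 1 + y * sqrt (s j) * (\<Sum>i\<in>{0..<N}. sqrt (s i))"
      using y s by (intro add_nonneg_nonneg mult_nonneg_nonneg sum_nonneg) auto
  qed
  also have "\<dots> = exp (2 / q * (y powr q * S powr q * (\<Sum>j\<in>{0..<N}. s j powr (q / 2))))"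
    by (simp add: exp_sum[symmetric] sum_distrib_left)
  also have "\<dots> \<le> exp (2 / q * (y powr q * S powr q * S'))"
    using q sum_le_suminf[OF summ(2), of "{0..<N}"] by (simp add: S'_def mult_left_mono divide_right_mono)
  finally show "(\<Prod>j\<in>{0..<N}. 1 + y * sqrt (s j) * (\<Sum>i\<in>{0..<N}. sqrt (s i))) \<le> exp (C * y powr q)"
    by (simp add: C_def mult_ac)
qed

text \<open>Injectivity makes the eigenvectors of \<open>A\<close> complete, and positivity of all
  singular values makes each of them a unit vector rather than padding.\<close>

locale perturbed_positive = A: compact_map H A B\<^sub>A + K: compact_map H K B\<^sub>K
  for H :: "'a::complex_inner set" and A B\<^sub>A K B\<^sub>K +
  assumes A_sym: "\<And>x y. x \<in> H \<Longrightarrow> y \<in> H \<Longrightarrow> cinner (A x) y = cinner x (A y)"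
    and A_nonneg: "\<And>x. x \<in> H \<Longrightarrow> 0 \<le> Re (cinner (A x) x)"
    and A_inj: "\<And>x. x \<in> H \<Longrightarrow> A x = 0 \<Longrightarrow> x = 0"
    and A_sval_pos: "\<And>n. 0 < A.sval n"
begin

text \<open>For a nonnegative operator the right singular vectors are eigenvectors:
  \<open>u = (A - s) e\<close> satisfies \<open>A u = - s u\<close>, and nonnegativity forces it to
  be 0 since \<open>s\<close> is positive.\<close>

lemma A_sv: "A (A.sv n) = complex_of_real (A.sval n) *\<^sub>C A.sv n"
proof -
  let ?e = "A.sv n" and ?t = "complex_of_real (A.sval n)"
  have AA: "A (A ?e) = complex_of_real ((A.sval n)\<^sup>2) *\<^sub>C ?e"
  proof (rule A.eqI)
    fix z assume z: "z \<in> H"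
    have "cinner z (A (A ?e)) = cnj (cinner (A ?e) (A z))"
      unfolding A_sym[OF z A.f_mem[OF A.sv_mem], symmetric] by (rule cinner_commute)
    also have "\<dots> = cinner z (complex_of_real ((A.sval n)\<^sup>2) *\<^sub>C ?e)"
      by (simp add: A.cinner_f_sv[OF z] cinner_scaleC_right cinner_commute[symmetric])
    finally show "cinner z (A (A ?e)) = cinner z (complex_of_real ((A.sval n)\<^sup>2) *\<^sub>C ?e)" .
  qed (auto simp: A.f_mem A.sv_mem A.scaleC_mem)
  define u where "u = A ?e - ?t *\<^sub>C ?e"
  have uH: "u \<in> H" by (simp add: u_def A.diff_mem A.f_mem A.sv_mem A.scaleC_mem)
  have "A u = - ?t *\<^sub>C u"
    by (simp add: u_def A.f_diff A.f_mem A.sv_mem A.scaleC_mem A.f_scaleC AA scaleC.diff_right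
        scaleC.minus_left scaleC_scaleC power2_eq_square)
  then have "cinner (A u) u = complex_of_real (- (A.sval n * (norm u)\<^sup>2))"
    by (simp only: cinner_scaleC_left cinner_self of_real_mult of_real_minus mult_minus_left)
  then have "0 \<le> - (A.sval n * (norm u)\<^sup>2)"
    using A_nonneg[OF uH] by (simp only: Re_complex_of_real)
  then have "A.sval n * (norm u)\<^sup>2 \<le> 0" by simp
  then have "u = 0" using A_sval_pos[of n] by (simp add: mult_le_0_iff)
  then show ?thesis by (simp add: u_def)
qed

lemma A_sv_norm: "norm (A.sv n) = 1"
  using A.ortho_system_sv A.sval_eq_0_iff[of n] A_sval_pos[of n] by (auto simp: ortho_system_def)

section \<open>Finite sections of the perturbed operator\<close>

definition proj :: "nat \<Rightarrow> 'a \<Rightarrow> 'a" where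
  "proj N x = (\<Sum>i\<in>{0..<N}. cinner x (A.sv i) *\<^sub>C A.sv i)"

lemma proj_diff: "proj N (x - y) = proj N x - proj N y"
  by (simp add: proj_def cinner.diff_left scaleC.diff_left sum_subtractf)

lemma norm_proj_le: "norm (proj N x) \<le> norm x"
proof (rule power2_le_imp_le)
  have "(norm (proj N x))\<^sup>2 = (\<Sum>i\<in>{0..<N}. (norm (cinner x (A.sv i)))\<^sup>2)"
    unfolding proj_def by (subst norm_sum_ortho_system[OF A.ortho_system_sv]) (auto simp: A_sv_norm)
  then show "(norm (proj N x))\<^sup>2 \<le> (norm x)\<^sup>2" using bessel[OF A.ortho_system_sv, of "{0..<N}" x] by simp
qed simp

lemma proj_tendsto:
  assumes x: "x \<in> H"
  shows "(\<lambda>N. proj N x) \<longlonglongrightarrow> x"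
proof -
  note one = A.ortho_system_sv A.sv_mem order_refl[of "\<bar>1::real\<bar>"]
  define p where "p = A.mult_op A.sv (\<lambda>_. 1) x"
  have p: "p \<in> H" unfolding p_def by (rule A.mult_op_mem[OF one])
  have "cinner (x - p) (A.sv k) = 0" for k
    using A.cinner_mult_op_system[OF one, of x k] by (simp add: p_def cinner.diff_left)
  then have "A (x - p) = 0" using x p by (intro A.f_eq_0_if_orthogonal) (auto intro: A.diff_mem)
  then have "x = p" using A_inj[of "x - p"] x p by (simp add: A.diff_mem)
  then show ?thesis
    using A.mult_op_sums[OF one, of x] by (simp add: sums_def p_def proj_def lessThan_atLeast0)
qed

definition K_trunc :: "nat \<Rightarrow> 'a \<Rightarrow> 'a" where
  "K_trunc N x = (\<Sum>j\<in>{0..<N}. cinner x (K.sv j) *\<^sub>C K (K.sv j))"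

text \<open>\<open>K_trunc N\<close> is \<open>K\<close> after the projection onto the first
  \<open>N\<close> singular vectors, so the difference is \<open>K\<close> applied to a vector in
  their complement, where \<open>K\<close> is bounded by \<open>sval N\<close>.\<close>

lemma norm_K_diff_K_trunc:
  assumes x: "x \<in> H"
  shows "norm (K x - K_trunc N x) \<le> K.sval N * norm x"
proof -
  let ?p = "\<Sum>i\<in>{0..<N}. cinner x (K.sv i) *\<^sub>C K.sv i"
  have p: "?p \<in> H" by (intro A.sum_mem A.scaleC_mem K.sv_mem)
  have K_p: "K ?p = K_trunc N x"
    unfolding K_trunc_def by (subst K.f_sum) (auto simp: A.scaleC_mem K.sv_mem K.f_scaleC)
  have c: "cinner (x - ?p) (K.sv j) = 0" if "j < N" for j
  proof -
    have "cinner ?p (K.sv j) = (\<Sum>i\<in>{0..<N}. if i = j then cinner x (K.sv j) else 0)"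
      unfolding cinner.sum_left
      by (intro sum.cong refl) (auto simp: cinner_scaleC_left ortho_system_cinner[OF K.ortho_system_sv])
    then show ?thesis using that by (simp add: cinner.diff_left)
  qed
  have "norm (K (x - ?p)) \<le> K.sval N * norm (x - ?p)"
    by (rule K.norm_f_le_sval) (use x p c in \<open>auto simp: K.ortho_compl_def A.diff_mem\<close>)
  also have "norm (x - ?p) \<le> norm x"
  proof (rule power2_le_imp_le)
    have "cinner (x - ?p) ?p = 0"
      unfolding cinner.sum_right by (rule sum.neutral) (auto simp: cinner_scaleC_right c)
    then have "inner (x - ?p) ?p = 0" using Re_cinner[of "x - ?p" ?p] by simp
    then have "(norm ((x - ?p) + ?p))\<^sup>2 = (norm (x - ?p))\<^sup>2 + (norm ?p)\<^sup>2"
      by (simp only: power2_norm_eq_inner inner_add_left inner_add_right) (simp add: inner_commute)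
    then show "(norm (x - ?p))\<^sup>2 \<le> (norm x)\<^sup>2" by simp
  qed simp
  finally show ?thesis using x p K.sval_nonneg by (simp add: K.f_diff K_p mult_left_mono)
qed

text \<open>The left singular vectors of \<open>K\<close>, set to 0 where the singular value
  vanishes, so that \<open>sval j\<close> times \<open>left_sv j\<close> is always
  \<open>K (sv j)\<close>.\<close>

definition left_sv :: "nat \<Rightarrow> 'a" where
  "left_sv j = (if K.sval j = 0 then 0 else (1 / complex_of_real (K.sval j)) *\<^sub>C K (K.sv j))"

lemma norm_left_sv_le: "norm (left_sv j) \<le> 1"
  using K.sval_nonneg[of j] by (simp add: left_sv_def norm_scaleC norm_divide K.sval_def)

lemma sval_left_sv: "complex_of_real (K.sval j) *\<^sub>C left_sv j = K (K.sv j)"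
  by (auto simp: left_sv_def scaleC_scaleC K.sval_def)

definition gc :: "nat \<Rightarrow> nat \<Rightarrow> complex" where "gc j i = cinner (left_sv j) (A.sv i)"
definition fc :: "nat \<Rightarrow> nat \<Rightarrow> complex" where "fc j i = cinner (K.sv j) (A.sv i)"

lemma gc_fc_bound:
  "(\<Sum>i\<in>{0..<N}. (norm (gc j i))\<^sup>2) \<le> 1" "(\<Sum>i\<in>{0..<N}. (norm (fc j i))\<^sup>2) \<le> 1"
proof -
  have "(norm x)\<^sup>2 \<le> 1" if "norm x \<le> 1" for x :: 'a using that by (simp add: power_le_one)
  then show "(\<Sum>i\<in>{0..<N}. (norm (gc j i))\<^sup>2) \<le> 1" "(\<Sum>i\<in>{0..<N}. (norm (fc j i))\<^sup>2) \<le> 1"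
    unfolding gc_def fc_def
    by (intro order_trans[OF bessel[OF A.ortho_system_sv]]; simp add: norm_left_sv_le ortho_system_norm_le[OF K.ortho_system_sv])+
qed

lemma pert_mat_singular:
  assumes "Determinant.det (pert_mat N A.sval K.sval gc fc z) = 0"
  obtains x where "x \<in> H" "norm x = 1" "x = z *\<^sub>C proj N (A x + K_trunc N x)"
proof -
  obtain v :: "nat \<Rightarrow> complex" where v0: "\<exists>i<N. v i \<noteq> 0" and v: "\<And>i. i < N \<Longrightarrow> v i = z * (A.sval i * v i +
      (\<Sum>j\<in>{0..<N}. K.sval j * gc j i * (\<Sum>l\<in>{0..<N}. cnj (fc j l) * v l)))"
    by (rule pert_mat_det_eq_0[OF assms]) blast
  define y where "y = (\<Sum>i\<in>{0..<N}. v i *\<^sub>C A.sv i)"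
  have yH: "y \<in> H" unfolding y_def by (intro A.sum_mem A.scaleC_mem A.sv_mem)
  have y_sv: "cinner y (A.sv i) = v i" if "i < N" for i
  proof -
    have "cinner y (A.sv i) = (\<Sum>l\<in>{0..<N}. if l = i then v i else 0)"
      unfolding y_def cinner.sum_left using A_sv_norm[of i]
      by (intro sum.cong refl) (auto simp: cinner_scaleC_left ortho_system_cinner[OF A.ortho_system_sv])
    then show ?thesis using that by simp
  qed
  have y_K: "cinner y (K.sv j) = (\<Sum>l\<in>{0..<N}. cnj (fc j l) * v l)" for j
    unfolding y_def cinner.sum_left
    by (intro sum.cong refl) (simp add: cinner_scaleC_left fc_def cinner_commute[symmetric] mult.commute)
  have coord: "z * cinner (A y + K_trunc N y) (A.sv i) = v i" if i: "i < N" for i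
  proof -
    have "cinner (A y) (A.sv i) = A.sval i * v i"
      using A_sym[OF yH A.sv_mem] by (simp add: A_sv cinner_scaleC_right y_sv[OF i])
    moreover have "cinner (K_trunc N y) (A.sv i) = (\<Sum>j\<in>{0..<N}. K.sval j * gc j i * (\<Sum>l\<in>{0..<N}. cnj (fc j l) * v l))"
      unfolding K_trunc_def cinner.sum_left
      by (intro sum.cong refl) (simp add: sval_left_sv[symmetric] cinner_scaleC_left gc_def y_K mult_ac)
    ultimately show ?thesis using v[OF i] by (simp add: cinner_add_left)
  qed
  have fix_y: "y = z *\<^sub>C proj N (A y + K_trunc N y)"
    unfolding proj_def scaleC.sum_right y_def[symmetric]
    by (subst (1) y_def) (auto intro!: sum.cong simp: scaleC_scaleC coord)
  have "y \<noteq> 0"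
  proof
    assume "y = 0"
    then show False using v0 y_sv by auto
  qed
  define c where "c = complex_of_real (1 / norm y)"
  have cK: "K_trunc N (c *\<^sub>C y) = c *\<^sub>C K_trunc N y"
    by (simp add: K_trunc_def cinner_scaleC_left scaleC.sum_right scaleC_scaleC)
  have cP: "proj N (c *\<^sub>C u) = c *\<^sub>C proj N u" for u
    by (simp add: proj_def cinner_scaleC_left scaleC.sum_right scaleC_scaleC)
  show thesis
  proof (rule that[of "c *\<^sub>C y"])
    show "c *\<^sub>C y \<in> H" by (rule A.scaleC_mem[OF yH])
    show "norm (c *\<^sub>C y) = 1" using \<open>y \<noteq> 0\<close> by (simp add: c_def norm_scaleC norm_divide)
    have "A (c *\<^sub>C y) + K_trunc N (c *\<^sub>C y) = c *\<^sub>C (A y + K_trunc N y)"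
      by (simp add: A.f_scaleC[OF yH] cK scaleC_add_right)
    then have "z *\<^sub>C proj N (A (c *\<^sub>C y) + K_trunc N (c *\<^sub>C y)) = c *\<^sub>C (z *\<^sub>C proj N (A y + K_trunc N y))"
      by (simp add: cP scaleC_scaleC mult.commute)
    then show "c *\<^sub>C y = z *\<^sub>C proj N (A (c *\<^sub>C y) + K_trunc N (c *\<^sub>C y))"
      using fix_y by simp
  qed
qed

end

context perturbed_positive
begin

text \<open>Singular sections of arbitrarily large size, at points of the disc, provide unit vectors
  fixed by \<open>z\<close> times the section. Compactness of \<open>A\<close>, of \<open>K\<close>
  and of the disc gives a common convergent subsequence, and its limit would be a unit
  eigenvector.\<close>

lemma eventually_nonsingular:
  assumes no_eigenvalue: "\<And>x z. x \<in> H \<Longrightarrow> x = z *\<^sub>C (A x + K x) \<Longrightarrow> x = 0"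
  shows "\<exists>N\<^sub>0. \<forall>N\<ge>N\<^sub>0. \<forall>z. norm z \<le> R \<longrightarrow> Determinant.det (pert_mat N A.sval K.sval gc fc z) \<noteq> 0"
proof (rule ccontr)
  assume "\<not> ?thesis"
  then have "\<forall>k. \<exists>N z. k \<le> N \<and> norm z \<le> R \<and> Determinant.det (pert_mat N A.sval K.sval gc fc z) = 0" by auto
  then have "\<forall>k. \<exists>p. k \<le> fst p \<and> norm (snd p) \<le> R \<and> Determinant.det (pert_mat (fst p) A.sval K.sval gc fc (snd p)) = 0"
    by simp
  from choice[OF this] obtain p where p: "\<And>k. k \<le> fst (p k)" "\<And>k. norm (snd (p k)) \<le> R"
      "\<And>k. Determinant.det (pert_mat (fst (p k)) A.sval K.sval gc fc (snd (p k))) = 0" by blast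
  define N where "N k = fst (p k)" for k
  define z where "z k = snd (p k)" for k
  have "\<forall>k. \<exists>x. x \<in> H \<and> norm x = 1 \<and> x = z k *\<^sub>C proj (N k) (A x + K_trunc (N k) x)"
  proof
    fix k
    show "\<exists>x. x \<in> H \<and> norm x = 1 \<and> x = z k *\<^sub>C proj (N k) (A x + K_trunc (N k) x)"
      by (rule pert_mat_singular[OF p(3)[of k]]) (auto simp: N_def z_def)
  qed
  from choice[OF this] obtain x where x: "\<And>k. x k \<in> H" "\<And>k. norm (x k) = 1"
      "\<And>k. x k = z k *\<^sub>C proj (N k) (A (x k) + K_trunc (N k) (x k))" by blast
  obtain r\<^sub>1 y\<^sub>1 where r1: "strict_mono (r\<^sub>1 :: nat \<Rightarrow> nat)" "(\<lambda>k. A (x (r\<^sub>1 k))) \<longlonglongrightarrow> y\<^sub>1"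
    using A.f_compact[of x] x(1,2) by auto
  obtain r\<^sub>2 y\<^sub>2 where r2: "strict_mono (r\<^sub>2 :: nat \<Rightarrow> nat)" "(\<lambda>k. K (x (r\<^sub>1 (r\<^sub>2 k)))) \<longlonglongrightarrow> y\<^sub>2"
    using K.f_compact[of "\<lambda>k. x (r\<^sub>1 k)"] x(1,2) by auto
  have "\<forall>k. z (r\<^sub>1 (r\<^sub>2 k)) \<in> cball 0 R" using p(2) by (simp add: z_def)
  then obtain \<zeta> r\<^sub>3 where r3: "strict_mono (r\<^sub>3 :: nat \<Rightarrow> nat)" "((\<lambda>k. z (r\<^sub>1 (r\<^sub>2 k))) \<circ> r\<^sub>3) \<longlonglongrightarrow> \<zeta>"
    using seq_compactE[of "cball 0 R" "\<lambda>k. z (r\<^sub>1 (r\<^sub>2 k))"] compact_cball[of "0::complex" R]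
    unfolding compact_eq_seq_compact_metric by blast
  define r where "r k = r\<^sub>1 (r\<^sub>2 (r\<^sub>3 k))" for k
  have r: "strict_mono r" using r1(1) r2(1) r3(1) by (simp add: strict_mono_def r_def)
  have r23: "strict_mono (\<lambda>k. r\<^sub>2 (r\<^sub>3 k))" using r2(1) r3(1) by (simp add: strict_mono_def)
  have Ax: "(\<lambda>k. A (x (r k))) \<longlonglongrightarrow> y\<^sub>1"
    using LIMSEQ_subseq_LIMSEQ[OF r1(2) r23] by (simp add: r_def o_def)
  have Kx: "(\<lambda>k. K (x (r k))) \<longlonglongrightarrow> y\<^sub>2"
    using LIMSEQ_subseq_LIMSEQ[OF r2(2) r3(1)] by (simp add: r_def o_def)
  have zr: "(\<lambda>k. z (r k)) \<longlonglongrightarrow> \<zeta>" using r3(2) by (simp add: r_def o_def)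
  define y where "y = y\<^sub>1 + y\<^sub>2"
  have Nr: "filterlim (\<lambda>k. N (r k)) at_top sequentially"
  proof (rule filterlim_at_top_mono[OF filterlim_subseq[OF r]])
    show "\<forall>\<^sub>F k in sequentially. r k \<le> N (r k)" using p(1) by (simp add: N_def)
  qed
  have y1H: "y\<^sub>1 \<in> H" by (rule closed_sequentially[OF A.closed _ Ax]) (simp add: A.f_mem x(1))
  have y2H: "y\<^sub>2 \<in> H" by (rule closed_sequentially[OF A.closed _ Kx]) (simp add: K.f_mem x(1))
  have yH: "y \<in> H" using y1H y2H by (simp add: y_def A.add_mem)
  have trunc: "(\<lambda>k. K (x (r k)) - K_trunc (N (r k)) (x (r k))) \<longlonglongrightarrow> 0"
  proof (rule tendsto_0_le[where K = 1])
    show "(\<lambda>k. K.sval (N (r k))) \<longlonglongrightarrow> 0" by (rule filterlim_compose[OF K.sval_tendsto_0 Nr])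
    show "\<forall>\<^sub>F k in sequentially. norm (K (x (r k)) - K_trunc (N (r k)) (x (r k))) \<le> norm (K.sval (N (r k))) * 1"
      using norm_K_diff_K_trunc[OF x(1)] x(2) K.sval_nonneg by simp
  qed
  define w where "w k = A (x (r k)) + K_trunc (N (r k)) (x (r k))" for k
  have "(\<lambda>k. A (x (r k)) + (K (x (r k)) - (K (x (r k)) - K_trunc (N (r k)) (x (r k))))) \<longlonglongrightarrow> y\<^sub>1 + (y\<^sub>2 - 0)"
    by (intro tendsto_intros Ax Kx trunc)
  then have w: "w \<longlonglongrightarrow> y" by (simp add: w_def[abs_def] y_def)
  have Pw: "(\<lambda>k. proj (N (r k)) (w k)) \<longlonglongrightarrow> y"
  proof -
    have Py: "(\<lambda>k. proj (N (r k)) y) \<longlonglongrightarrow> y" by (rule filterlim_compose[OF proj_tendsto[OF yH] Nr])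
    have "(\<lambda>k. proj (N (r k)) (w k - y)) \<longlonglongrightarrow> 0"
    proof (rule tendsto_0_le[where K = 1])
      show "(\<lambda>k. w k - y) \<longlonglongrightarrow> 0" using w by (rule LIM_zero)
    qed (simp add: norm_proj_le)
    from tendsto_add[OF this Py] show ?thesis by (simp add: proj_diff)
  qed
  have "(\<lambda>k. z (r k) *\<^sub>C proj (N (r k)) (w k)) \<longlonglongrightarrow> \<zeta> *\<^sub>C y"
    by (rule scaleC.tendsto[OF zr Pw])
  \<comment> \<open>The vectors themselves need not be assumed convergent: the fixed point equation
    expresses them through quantities already known to converge in norm.\<close>
  then have xr: "(\<lambda>k. x (r k)) \<longlonglongrightarrow> \<zeta> *\<^sub>C y"
    by (simp only: w_def x(3)[symmetric])
  define u where "u = \<zeta> *\<^sub>C y"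
  have uH: "u \<in> H" using yH by (simp add: u_def A.scaleC_mem)
  have "A u = y\<^sub>1" using LIMSEQ_unique[OF A.f_tendsto[OF xr] Ax] x(1) uH by (simp add: u_def)
  moreover have "K u = y\<^sub>2" using LIMSEQ_unique[OF K.f_tendsto[OF xr] Kx] x(1) uH by (simp add: u_def)
  ultimately have "u = \<zeta> *\<^sub>C (A u + K u)" by (simp only: y_def[symmetric] u_def[symmetric])
  then have "u = 0" by (rule no_eigenvalue[OF uH])
  moreover have "norm u = 1"
  proof (rule LIMSEQ_unique)
    show "(\<lambda>k. norm (x (r k))) \<longlonglongrightarrow> norm u" unfolding u_def by (rule tendsto_norm[OF xr])
  qed (simp add: x(2))
  ultimately show False by simp
qed

theorem has_nonzero_eigenvalue:
  assumes \<alpha>: "0 < \<alpha>" "\<alpha> < 2" and a: "0 < a"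
    and lim: "(\<lambda>n. real (Suc n) powr \<alpha> * A.sval n) \<longlonglongrightarrow> a"
    and summ: "\<And>q. 0 < q \<Longrightarrow> q \<le> 1 / \<alpha> \<Longrightarrow> summable (\<lambda>j. K.sval j powr q)"
  shows "\<exists>x z. x \<in> H \<and> x \<noteq> 0 \<and> x = z *\<^sub>C (A x + K x)"
proof (rule ccontr)
  assume "\<not> ?thesis"
  then have no_eigenvalue: "x = 0" if "x \<in> H" "x = z *\<^sub>C (A x + K x)" for x z using that by blast
  define u where "u n = real (Suc n) powr \<alpha> * A.sval n" for n
  have u_pos: "0 < u n" for n using A_sval_pos[of n] by (simp add: u_def)
  have u_lim: "u \<longlonglongrightarrow> a" using lim by (simp add: u_def[abs_def])
  obtain b\<^sub>2 where b2: "0 < b\<^sub>2" "\<And>n. norm (u n) \<le> b\<^sub>2"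
    using convergent_imp_Bseq[OF convergentI[OF u_lim]] by (auto simp: Bseq_def)
  have "\<forall>\<^sub>F n in sequentially. a / 2 < u n" using a by (intro order_tendstoD(1)[OF u_lim]) simp
  then obtain n\<^sub>0 where n0: "\<And>n. n\<^sub>0 \<le> n \<Longrightarrow> a / 2 < u n" by (auto simp: eventually_sequentially)
  define b\<^sub>1 where "b\<^sub>1 = Min (insert (a / 2) (u ` {..<n\<^sub>0}))"
  have b1: "0 < b\<^sub>1" using a u_pos by (simp add: b\<^sub>1_def)
  have b1_le: "b\<^sub>1 \<le> u n" for n
  proof (cases "n < n\<^sub>0")
    case True
    then show ?thesis unfolding b\<^sub>1_def by (intro Min_le) auto
  next
    case False
    have "b\<^sub>1 \<le> a / 2" unfolding b\<^sub>1_def by (intro Min_le) auto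
    then show ?thesis using n0[of n] False by simp
  qed
  have sval_u: "A.sval n = u n * real (n + 1) powr - \<alpha>" for n
    by (simp add: u_def powr_minus_divide)
  \<comment> \<open>Since \<alpha> < 2, the exponent 1/2 does not exceed
    \<open>1 / \<alpha>\<close>, so the Schatten assumption covers both exponents 1/2 and
    \<open>q / 2\<close> of the product estimate for every \<open>q \<le> 1\<close>.\<close>
  have min: "1 / 2 \<le> 1 / \<alpha>" using \<alpha> by (simp add: divide_left_mono)
  show False
  proof (rule no_zero_free_perturbations[OF \<alpha> b1 b2(1), of A.sval 1])
    show "b\<^sub>1 * real (l + 1) powr - \<alpha> \<le> A.sval l" for l
      unfolding sval_u using b1_le[of l] by (intro mult_right_mono) auto
    show "A.sval l \<le> b\<^sub>2 * real (l + 1) powr - \<alpha>" for l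
      unfolding sval_u using b2(2)[of l] by (intro mult_right_mono) auto
    fix q :: real assume q: "0 < q" "q \<le> 1"
    have s1: "summable (\<lambda>j. K.sval j powr (1 / 2))" by (rule summ[OF _ min]) simp
    have s2: "summable (\<lambda>j. K.sval j powr (q / 2))" by (rule summ) (use q min in auto)
    obtain C where C: "0 \<le> C" "\<And>N y. 0 \<le> y \<Longrightarrow>
        (\<Prod>j\<in>{0..<N}. 1 + y * sqrt (K.sval j) * (\<Sum>i\<in>{0..<N}. sqrt (K.sval i))) \<le> exp (C * y powr q)"
      using prod_one_plus_le_exp_powr[OF K.sval_nonneg q s1 s2] by blast
    show "\<exists>C\<ge>0. \<forall>R>0. \<exists>N\<^sub>0. \<forall>N\<ge>N\<^sub>0. \<exists>P.
      (\<forall>S. P holomorphic_on S) \<and> P 0 = 1 \<and> (\<forall>z. norm z \<le> R \<longrightarrow> P z \<noteq> 0) \<and>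
      (\<forall>z c. 0 < c \<longrightarrow> (\<forall>l<N. c \<le> norm (1 - z * complex_of_real (A.sval l))) \<longrightarrow>
        norm (P z) \<le> (\<Prod>l\<in>{0..<N}. norm (1 - z * complex_of_real (A.sval l))) * exp (C * (norm z / c) powr q))"
    proof (intro exI[of _ C] conjI C(1) allI impI)
      fix R :: real
      have nonsing: "\<exists>N\<^sub>0. \<forall>N\<ge>N\<^sub>0. \<forall>z. norm z \<le> R \<longrightarrow> Determinant.det (pert_mat N A.sval K.sval gc fc z) \<noteq> 0"
        by (rule eventually_nonsingular) (rule no_eigenvalue)
      obtain N\<^sub>0 where N0: "\<forall>N\<ge>N\<^sub>0. \<forall>z. norm z \<le> R \<longrightarrow> Determinant.det (pert_mat N A.sval K.sval gc fc z) \<noteq> 0"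
        using nonsing by (elim exE)
      show "\<exists>N\<^sub>0. \<forall>N\<ge>N\<^sub>0. \<exists>P. (\<forall>S. P holomorphic_on S) \<and> P 0 = 1 \<and> (\<forall>z. norm z \<le> R \<longrightarrow> P z \<noteq> 0) \<and>
        (\<forall>z c. 0 < c \<longrightarrow> (\<forall>l<N. c \<le> norm (1 - z * complex_of_real (A.sval l))) \<longrightarrow>
          norm (P z) \<le> (\<Prod>l\<in>{0..<N}. norm (1 - z * complex_of_real (A.sval l))) * exp (C * (norm z / c) powr q))"
      proof (rule exI[of _ N\<^sub>0], intro allI impI)
        fix N assume N: "N\<^sub>0 \<le> N"
        let ?P = "\<lambda>z. Determinant.det (pert_mat N A.sval K.sval gc fc z)"
        have "norm (?P z) \<le> (\<Prod>l\<in>{0..<N}. norm (1 - z * complex_of_real (A.sval l))) * exp (C * (norm z / c) powr q)"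
          if c: "0 < c" "\<forall>l<N. c \<le> norm (1 - z * complex_of_real (A.sval l))" for z c
        proof -
          have "norm (?P z) \<le> (\<Prod>l\<in>{0..<N}. norm (1 - z * complex_of_real (A.sval l))) *
            (\<Prod>j\<in>{0..<N}. 1 + norm z / c * sqrt (K.sval j) * (\<Sum>i\<in>{0..<N}. sqrt (K.sval i)))"
            by (rule norm_det_pert_mat_le) (use c gc_fc_bound K.sval_nonneg in auto)
          also have "\<dots> \<le> (\<Prod>l\<in>{0..<N}. norm (1 - z * complex_of_real (A.sval l))) * exp (C * (norm z / c) powr q)"
            using C(2)[of "norm z / c" N] c by (intro mult_left_mono prod_nonneg) auto
          finally show ?thesis .
        qed
        then show "\<exists>P. (\<forall>S. P holomorphic_on S) \<and> P 0 = 1 \<and> (\<forall>z. norm z \<le> R \<longrightarrow> P z \<noteq> 0) \<and>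
          (\<forall>z c. 0 < c \<longrightarrow> (\<forall>l<N. c \<le> norm (1 - z * complex_of_real (A.sval l))) \<longrightarrow>
            norm (P z) \<le> (\<Prod>l\<in>{0..<N}. norm (1 - z * complex_of_real (A.sval l))) * exp (C * (norm z / c) powr q))"
          using N0[rule_format, OF N] holomorphic_det_pert_mat[of N A.sval K.sval gc fc] pert_mat_0[of N A.sval K.sval gc fc]
          by (intro exI[of _ ?P]) simp
      qed
    qed
  qed simp
qed

end

section \<open>The space of square-integrable functions\<close>

lemma L2_rep:
  obtains f where "square_integrable f" "u = abs_L2 f"
  using Quotient_abs_rep[OF Quotient_L2, of u] Quotient_rep_reflp[OF Quotient_L2, of u]
  by (metis L2_eq_def)

lemma L2_eq_refl: "square_integrable f \<Longrightarrow> L2_eq f f"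
  by (simp add: L2_eq_def)

lemma abs_L2_add:
  assumes "square_integrable f" "square_integrable g"
  shows "abs_L2 f + abs_L2 g = abs_L2 (\<lambda>x. f x + g x)"
  by (rule plus_L2.abs_eq) (rule L2_eq_refl assms)+

lemma abs_L2_scaleC:
  assumes "square_integrable f"
  shows "c *\<^sub>C abs_L2 f = abs_L2 (\<lambda>x. c * f x)"
  by (rule scaleC_L2.abs_eq) (rule L2_eq_refl assms)+

lemma abs_L2_diff:
  assumes "square_integrable f" "square_integrable g"
  shows "abs_L2 f - abs_L2 g = abs_L2 (\<lambda>x. f x - g x)"
proof -
  have "abs_L2 f - abs_L2 g = abs_L2 f + (-1) *\<^sub>C abs_L2 g" by (rule minus_L2_def)
  also have "\<dots> = abs_L2 (\<lambda>x. f x + (-1) * g x)"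
    by (simp only: abs_L2_add abs_L2_scaleC assms square_integrable_mult)
  finally show ?thesis by simp
qed

lemma square_integrable_diff:
  assumes "square_integrable f" "square_integrable g"
  shows "square_integrable (\<lambda>x. f x - g x)"
  using square_integrable_add[OF assms(1) square_integrable_mult[OF assms(2), of "-1"]] by simp

lemma cinner_abs_L2:
  assumes "square_integrable f" "square_integrable g"
  shows "cinner (abs_L2 f) (abs_L2 g) = (LINT x|lborel. f x * cnj (g x))"
  by (rule cinner_L2.abs_eq) (rule L2_eq_refl assms)+

lemma norm_abs_L2:
  assumes f: "square_integrable f"
  shows "ennreal ((norm (abs_L2 f))\<^sup>2) = (\<integral>\<^sup>+x. ennreal ((norm (f x))\<^sup>2) \<partial>lborel)"
proof -
  have "complex_of_real ((norm (abs_L2 f))\<^sup>2) = (LINT x|lborel. f x * cnj (f x))"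
    unfolding cinner_self[symmetric] by (rule cinner_abs_L2[OF f f])
  also have "\<dots> = (LINT x|lborel. complex_of_real ((norm (f x))\<^sup>2))" by (simp only: complex_norm_square)
  also have "\<dots> = complex_of_real (LINT x|lborel. (norm (f x))\<^sup>2)" by (rule integral_complex_of_real)
  finally have eq: "(norm (abs_L2 f))\<^sup>2 = (LINT x|lborel. (norm (f x))\<^sup>2)" by (simp only: of_real_eq_iff)
  show ?thesis unfolding eq
    by (rule nn_integral_eq_integral[symmetric]) (use f in \<open>auto simp: square_integrable_def\<close>)
qed

lemma abs_L2_eqI:
  assumes "square_integrable f" "square_integrable g" "AE x in lborel. f x = g x"
  shows "abs_L2 f = abs_L2 g"
  using assms Quotient_rel_abs[OF Quotient_L2, of f g] by (simp add: L2_eq_def)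

lemma square_integrableI:
  assumes "f \<in> borel_measurable lborel" "(\<integral>\<^sup>+x. ennreal ((norm (f x))\<^sup>2) \<partial>lborel) < \<infinity>"
  shows "square_integrable f"
  unfolding square_integrable_def
proof
  have "(\<lambda>x. (norm (f x))\<^sup>2) \<in> borel_measurable lborel" using assms(1) by measurable
  then show "integrable lborel (\<lambda>x. (norm (f x))\<^sup>2)" using assms(2) by (intro integrableI_nonneg) auto
qed (rule assms(1))

section \<open>Completeness of the space of square-integrable functions\<close>

lemma geometric_subsequence:
  fixes X :: "nat \<Rightarrow> 'a::metric_space"
  assumes "Cauchy X"
  shows "\<exists>r :: nat \<Rightarrow> nat. strict_mono r \<and> (\<forall>m n. m \<le> n \<longrightarrow> dist (X (r m)) (X (r n)) < (1 / 2) ^ m)"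
proof -
  have "\<forall>k. \<exists>M. \<forall>m\<ge>M. \<forall>n\<ge>M. dist (X m) (X n) < (1 / 2) ^ k"
    using assms unfolding Cauchy_def by simp
  from choice[OF this] obtain M where M: "\<And>k m n. M k \<le> m \<Longrightarrow> M k \<le> n \<Longrightarrow> dist (X m) (X n) < (1 / 2) ^ k" by blast
  define r where "r k = k + (\<Sum>i\<le>k. M i)" for k
  have r: "strict_mono r" unfolding strict_mono_Suc_iff by (simp add: r_def)
  have "M k \<le> r k" for k using member_le_sum[of k "{..k}" M] by (simp add: r_def)
  then have "dist (X (r m)) (X (r n)) < (1 / 2) ^ m" if "m \<le> n" for m n
    using M[of m "r m" "r n"] strict_mono_leD[OF r that] order_trans by blast
  then show ?thesis using r by blast
qed

lemma convergent_if_summable_weighted: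
  fixes f :: "nat \<Rightarrow> complex"
  assumes "summable (\<lambda>n. 2 ^ n * (norm (f (Suc n) - f n))\<^sup>2)"
  shows "convergent f"
proof -
  let ?d = "\<lambda>n. norm (f (Suc n) - f n)"
  obtain B where B: "\<And>n. norm (2 ^ n * (?d n)\<^sup>2) \<le> B"
    using convergent_imp_Bseq[OF convergentI[OF summable_LIMSEQ_zero[OF assms]]] by (auto simp: Bseq_def)
  have d_le: "?d n \<le> sqrt B * (sqrt (1 / 2)) ^ n" for n
  proof -
    have "(?d n)\<^sup>2 * 2 ^ n \<le> B" using B[of n] by (simp add: mult.commute)
    then have "(?d n)\<^sup>2 \<le> B * (1 / 2) ^ n" by (simp add: power_one_over field_simps)
    then have "?d n \<le> sqrt (B * (1 / 2) ^ n)" by (rule real_le_rsqrt)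
    then show ?thesis by (simp add: real_sqrt_mult real_sqrt_power)
  qed
  have gsum: "summable (\<lambda>n. sqrt B * (sqrt (1 / 2)) ^ n)"
    by (intro summable_mult summable_geometric) (simp add: real_sqrt_divide)
  have "summable (\<lambda>n. f (Suc n) - f n)"
    by (rule summable_comparison_test'[OF gsum, of 0]) (rule d_le)
  then have "convergent (\<lambda>n. \<Sum>k<n. f (Suc k) - f k)" by (simp add: summable_iff_convergent)
  then have "convergent (\<lambda>n. (f n - f 0) + f 0)"
    unfolding sum_lessThan_telescope by (intro convergent_add convergent_const)
  then show ?thesis by simp
qed

text \<open>The Riesz-Fischer argument: a rapidly convergent subsequence converges almost
  everywhere, Fatou's lemma shows that its pointwise limit is also the limit in norm, and a Cauchy
  sequence follows its subsequence.\<close>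

lemma complete_L2: "complete (UNIV :: 'a::euclidean_space L2 set)"
proof (rule completeI)
  fix X :: "nat \<Rightarrow> 'a L2" assume "Cauchy X"
  obtain r where r: "strict_mono (r :: nat \<Rightarrow> nat)" "\<And>m n. m \<le> n \<Longrightarrow> dist (X (r m)) (X (r n)) < (1 / 2) ^ m"
    using geometric_subsequence[OF \<open>Cauchy X\<close>] by blast
  have "\<forall>n. \<exists>f. square_integrable f \<and> X (r n) = abs_L2 f"
  proof
    fix n
    show "\<exists>f. square_integrable f \<and> X (r n) = abs_L2 f" by (rule L2_rep[of "X (r n)"]) blast
  qed
  from choice[OF this] obtain f where f: "\<And>n. square_integrable (f n)" "\<And>n. X (r n) = abs_L2 (f n)" by blast
  have [measurable]: "f n \<in> borel_measurable lborel" for n using f(1) by (simp add: square_integrable_def)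
  have dist_f: "(\<integral>\<^sup>+x. ennreal ((norm (f n x - f m x))\<^sup>2) \<partial>lborel) = ennreal ((norm (X (r n) - X (r m)))\<^sup>2)" for m n
    using norm_abs_L2[OF square_integrable_diff[OF f(1)[of n] f(1)[of m]]] by (simp add: f(2) abs_L2_diff f(1))
  have near: "(\<integral>\<^sup>+x. ennreal ((norm (f n x - f m x))\<^sup>2) \<partial>lborel) \<le> ennreal (((1 / 2) ^ m)\<^sup>2)" if "m \<le> n" for m n
  proof -
    have "norm (X (r n) - X (r m)) \<le> (1 / 2) ^ m" using r(2)[OF that] by (simp add: dist_norm norm_minus_commute)
    then have "(norm (X (r n) - X (r m)))\<^sup>2 \<le> ((1 / 2) ^ m)\<^sup>2" by (intro power_mono) auto
    then show ?thesis unfolding dist_f by (rule ennreal_leI)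
  qed
  \<comment> \<open>The squared differences have integrals at most \<open>4 ^ (- n)\<close>, so the
    weight \<open>2 ^ n\<close> leaves a convergent series. Its finiteness at a point bounds the
    differences there by a geometric sequence.\<close>
  define h where "h n x = 2 ^ n * (norm (f (Suc n) x - f n x))\<^sup>2" for n x
  have [measurable]: "h n \<in> borel_measurable lborel" for n unfolding h_def by measurable
  have h_nonneg: "0 \<le> h n x" for n x by (simp add: h_def)
  have "(\<integral>\<^sup>+x. (\<Sum>n. ennreal (h n x)) \<partial>lborel) = (\<Sum>n. \<integral>\<^sup>+x. ennreal (h n x) \<partial>lborel)"
    by (rule nn_integral_suminf) measurable
  also have "\<dots> \<le> (\<Sum>n. ennreal ((1 / 2) ^ n))"
  proof (rule suminf_le)
    fix n
    have "(\<integral>\<^sup>+x. ennreal (h n x) \<partial>lborel) = ennreal (2 ^ n) * (\<integral>\<^sup>+x. ennreal ((norm (f (Suc n) x - f n x))\<^sup>2) \<partial>lborel)"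
      unfolding h_def by (subst nn_integral_cmult[symmetric]) (auto simp: ennreal_mult)
    also have "\<dots> \<le> ennreal (2 ^ n) * ennreal (((1 / 2) ^ n)\<^sup>2)" by (intro mult_left_mono near) auto
    also have "\<dots> = ennreal ((1 / 2) ^ n)"
      by (simp add: ennreal_mult[symmetric] power_one_over power2_eq_square)
    finally show "(\<integral>\<^sup>+x. ennreal (h n x) \<partial>lborel) \<le> ennreal ((1 / 2) ^ n)" .
  qed auto
  also have "\<dots> = ennreal (\<Sum>n. (1 / 2) ^ n)" by (intro suminf_ennreal2 summable_geometric) auto
  finally have "(\<integral>\<^sup>+x. (\<Sum>n. ennreal (h n x)) \<partial>lborel) \<noteq> \<infinity>" by (auto simp: top_unique)
  then have "AE x in lborel. (\<Sum>n. ennreal (h n x)) \<noteq> \<infinity>" by (intro nn_integral_PInf_AE) auto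
  then have conv: "AE x in lborel. convergent (\<lambda>n. f n x)"
  proof (rule eventually_mono)
    fix x assume "(\<Sum>n. ennreal (h n x)) \<noteq> \<infinity>"
    then have "summable (\<lambda>n. h n x)" using h_nonneg by (intro summable_suminf_not_top) auto
    then show "convergent (\<lambda>n. f n x)" unfolding h_def by (rule convergent_if_summable_weighted)
  qed
  define F where "F x = lim (\<lambda>n. f n x)" for x
  have F_meas [measurable]: "F \<in> borel_measurable lborel" unfolding F_def by measurable
  have F_near: "(\<integral>\<^sup>+x. ennreal ((norm (F x - f m x))\<^sup>2) \<partial>lborel) \<le> ennreal (((1 / 2) ^ m)\<^sup>2)" for m
  proof -
    have "(\<integral>\<^sup>+x. ennreal ((norm (F x - f m x))\<^sup>2) \<partial>lborel)
        = (\<integral>\<^sup>+x. liminf (\<lambda>n. ennreal ((norm (f n x - f m x))\<^sup>2)) \<partial>lborel)"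
    proof (rule nn_integral_cong_AE, rule eventually_mono[OF conv])
      fix x assume "convergent (\<lambda>n. f n x)"
      then have "(\<lambda>n. f n x) \<longlonglongrightarrow> F x" unfolding F_def by (rule convergent_LIMSEQ_iff[THEN iffD1])
      then have "(\<lambda>n. ennreal ((norm (f n x - f m x))\<^sup>2)) \<longlonglongrightarrow> ennreal ((norm (F x - f m x))\<^sup>2)"
        by (intro tendsto_intros)
      then show "ennreal ((norm (F x - f m x))\<^sup>2) = liminf (\<lambda>n. ennreal ((norm (f n x - f m x))\<^sup>2))"
        by (intro lim_imp_Liminf[symmetric]) auto
    qed
    also have "\<dots> \<le> liminf (\<lambda>n. \<integral>\<^sup>+x. ennreal ((norm (f n x - f m x))\<^sup>2) \<partial>lborel)"
      by (rule nn_integral_liminf) measurable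
    also have "\<dots> \<le> liminf (\<lambda>n. ennreal (((1 / 2) ^ m)\<^sup>2))"
      by (rule Liminf_mono) (use near in \<open>auto simp: eventually_sequentially intro!: exI[of _ m]\<close>)
    also have "\<dots> = ennreal (((1 / 2) ^ m)\<^sup>2)" by (simp add: Liminf_const)
    finally show ?thesis .
  qed
  have "square_integrable (\<lambda>x. F x - f 0 x)"
  proof (rule square_integrableI)
    show "(\<integral>\<^sup>+x. ennreal ((norm (F x - f 0 x))\<^sup>2) \<partial>lborel) < \<infinity>"
      using le_less_trans[OF F_near[of 0] ennreal_less_top] unfolding infinity_ennreal_def .
  qed measurable
  from square_integrable_add[OF this f(1)[of 0]] have F: "square_integrable F" by simp
  have "norm (X (r m) - abs_L2 F) \<le> (1 / 2) ^ m" for m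
  proof -
    have "ennreal ((norm (abs_L2 F - X (r m)))\<^sup>2) \<le> ennreal (((1 / 2) ^ m)\<^sup>2)"
      using norm_abs_L2[OF square_integrable_diff[OF F f(1)[of m]]] F_near[of m] by (simp add: f abs_L2_diff F)
    then have "(norm (abs_L2 F - X (r m)))\<^sup>2 \<le> ((1 / 2) ^ m)\<^sup>2" by (simp add: ennreal_le_iff)
    then have "norm (abs_L2 F - X (r m)) \<le> (1 / 2) ^ m" by (rule power2_le_imp_le) simp
    then show ?thesis by (simp add: norm_minus_commute)
  qed
  then have "(\<lambda>m. X (r m) - abs_L2 F) \<longlonglongrightarrow> 0"
    by (intro tendsto_0_le[OF LIMSEQ_power_zero[of "1 / 2 :: real"], of _ 1]) (auto simp: power_one_over)
  then have "(X \<circ> r) \<longlonglongrightarrow> abs_L2 F" unfolding o_def by (rule LIM_zero_cancel)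
  then have "X \<longlonglongrightarrow> abs_L2 F" using Cauchy_converges_subseq[OF \<open>Cauchy X\<close> r(1)] by (simp add: o_def)
  then show "\<exists>l\<in>UNIV. X \<longlonglongrightarrow> l" by blast
qed

lemma vanishes_outside_abs_L2:
  "square_integrable f \<Longrightarrow> vanishes_outside \<Omega> (abs_L2 f) \<longleftrightarrow> (AE x in lborel. x \<notin> \<Omega> \<longrightarrow> f x = 0)"
  by (rule vanishes_outside.abs_eq) (rule L2_eq_refl)

text \<open>The part \<open>g\<close> of the limit outside \<Omega> is orthogonal to every member of
  the sequence, hence to the limit, hence to itself.\<close>

lemma closed_L2_on:
  assumes \<Omega>: "open \<Omega>"
  shows "closed (L2_on \<Omega>)"
proof (rule closed_sequential_limits[THEN iffD2], intro allI impI, elim conjE)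
  fix X u assume X: "\<forall>n. X n \<in> L2_on \<Omega>" and lim: "X \<longlonglongrightarrow> u"
  obtain f where f: "square_integrable f" "u = abs_L2 f" by (rule L2_rep)
  have meas [measurable]: "f \<in> borel_measurable lborel" "\<Omega> \<in> sets lborel"
    using f \<Omega> by (auto simp: square_integrable_def)
  define g where "g x = indicator (- \<Omega>) x * f x" for x
  have g: "square_integrable g" unfolding square_integrable_def
  proof
    show "g \<in> borel_measurable lborel" unfolding g_def using meas by measurable
    then have "(\<lambda>x. (norm (g x))\<^sup>2) \<in> borel_measurable lborel" by measurable
    then show "integrable lborel (\<lambda>x. (norm (g x))\<^sup>2)"
      using f(1) unfolding square_integrable_def
      by (elim conjE Bochner_Integration.integrable_bound) (auto simp: g_def indicator_def)
  qed
  have "cinner (X n) (abs_L2 g) = 0" for n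
  proof -
    obtain k where k: "square_integrable k" "X n = abs_L2 k" by (rule L2_rep)
    have ae: "AE x in lborel. x \<notin> \<Omega> \<longrightarrow> k x = 0" using X[rule_format, of n] by (simp add: L2_on_def k vanishes_outside_abs_L2)
    have "AE x in lborel. k x * cnj (g x) = 0"
      using ae by (rule eventually_mono) (auto simp: g_def indicator_def)
    then have "(LINT x|lborel. k x * cnj (g x)) = 0" by (rule integral_eq_zero_AE)
    then show ?thesis by (simp add: k cinner_abs_L2 g)
  qed
  moreover have "(\<lambda>n. cinner (X n) (abs_L2 g)) \<longlonglongrightarrow> cinner u (abs_L2 g)"
    by (intro cinner.tendsto lim tendsto_const)
  ultimately have "cinner u (abs_L2 g) = 0" by (simp add: LIMSEQ_const_iff)
  then have "(LINT x|lborel. f x * cnj (g x)) = 0" by (simp add: f cinner_abs_L2 g)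
  moreover have "f x * cnj (g x) = g x * cnj (g x)" for x by (cases "x \<in> \<Omega>") (simp_all add: g_def)
  ultimately have "cinner (abs_L2 g) (abs_L2 g) = 0" by (simp add: cinner_abs_L2 g)
  then have "norm (abs_L2 g) = 0" by (simp add: cinner_self)
  then have "(\<integral>\<^sup>+x. ennreal ((norm (g x))\<^sup>2) \<partial>lborel) = 0" using norm_abs_L2[OF g] by simp
  then have "AE x in lborel. ennreal ((norm (g x))\<^sup>2) = 0"
    using g by (subst (asm) nn_integral_0_iff_AE) (auto simp: square_integrable_def)
  then have "AE x in lborel. x \<notin> \<Omega> \<longrightarrow> f x = 0"
    by (rule eventually_mono) (auto simp: g_def)
  then show "u \<in> L2_on \<Omega>" by (simp add: L2_on_def f vanishes_outside_abs_L2)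
qed

lemma hilbert_subspace_L2_on:
  assumes \<Omega>: "open \<Omega>"
  shows "hilbert_subspace (L2_on \<Omega>)"
proof
  show "complete (L2_on \<Omega>)"
    using complete_closed_subset[OF closed_L2_on[OF \<Omega>] subset_UNIV complete_L2] .
  show "0 \<in> L2_on \<Omega>"
    by (simp add: L2_on_def zero_L2_def vanishes_outside_abs_L2 square_integrable_zero)
  fix u assume u: "u \<in> L2_on \<Omega>"
  obtain f where f: "square_integrable f" "u = abs_L2 f" by (rule L2_rep)
  have fae: "AE x in lborel. x \<notin> \<Omega> \<longrightarrow> f x = 0" using u f by (simp add: L2_on_def vanishes_outside_abs_L2)
  show "c *\<^sub>C u \<in> L2_on \<Omega>" for c
  proof -
    have "AE x in lborel. x \<notin> \<Omega> \<longrightarrow> c * f x = 0" using fae by eventually_elim simp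
    then show ?thesis
      by (simp add: f L2_on_def abs_L2_scaleC vanishes_outside_abs_L2 square_integrable_mult)
  qed
  fix v assume v: "v \<in> L2_on \<Omega>"
  obtain g where g: "square_integrable g" "v = abs_L2 g" by (rule L2_rep)
  have gae: "AE x in lborel. x \<notin> \<Omega> \<longrightarrow> g x = 0" using v g by (simp add: L2_on_def vanishes_outside_abs_L2)
  have "AE x in lborel. x \<notin> \<Omega> \<longrightarrow> f x + g x = 0" using fae gae by eventually_elim simp
  then show "u + v \<in> L2_on \<Omega>"
    by (simp add: f g L2_on_def abs_L2_add vanishes_outside_abs_L2 square_integrable_add)
qed

section \<open>Test functions\<close>

text \<open>The functions \<open>p(1/t) exp(-1/t)\<close>, extended by zero to \<open>t \<le> 0\<close>, are closed under
  differentiation.\<close>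

definition flat :: "real poly \<Rightarrow> real \<Rightarrow> real" where
  "flat p t = (if 0 < t then poly p (1 / t) * exp (- (1 / t)) else 0)"

lemma tendsto_poly_mult_exp_minus: "((\<lambda>y. poly p y * exp (- y)) \<longlongrightarrow> 0) (at_top :: real filter)"
proof (induction p)
  case (pCons a p)
  \<comment> \<open>The free power \<open>y ^ k\<close> absorbs the factor \<open>y\<close> produced
    by \<open>pCons\<close>, which keeps the induction going.\<close>
  have gen: "((\<lambda>y. y ^ k * poly q y * exp (- y)) \<longlongrightarrow> 0) (at_top :: real filter)" for q k
  proof (induction q arbitrary: k)
    case (pCons b q)
    have "((\<lambda>y. b * (y ^ k / exp y) + y ^ Suc k * poly q y * exp (- y)) \<longlongrightarrow> b * 0 + 0) (at_top :: real filter)"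
      by (intro tendsto_add tendsto_mult tendsto_const tendsto_power_div_exp_0 pCons)
    then show ?case by (simp add: algebra_simps exp_minus divide_inverse)
  qed simp
  show ?case using gen[of 0 "pCons a p"] by simp
qed simp

text \<open>With \<open>s = 1 / t\<close> the derivative is
  \<open>s\<^sup>2 * (p(s) - p'(s)) * exp (- s)\<close>, again of the same form. At 0 the right
  difference quotient is \<open>s * p(s) * exp (- s)\<close>, which tends to 0.\<close>

lemma has_derivative_flat:
  "(flat p has_real_derivative flat ([:0, 0, 1:] * (p - pderiv p)) t) (at t)"
proof -
  consider "0 < t" | "t < 0" | "t = 0" by linarith
  then show ?thesis
  proof cases
    case 1
    have "((\<lambda>t. poly p (1 / t) * exp (- (1 / t))) has_real_derivative
        flat ([:0, 0, 1:] * (p - pderiv p)) t) (at t)"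
      using 1 by (auto intro!: derivative_eq_intros DERIV_chain'[OF _ poly_DERIV]
        simp: flat_def field_simps power2_eq_square)
    moreover have "\<forall>\<^sub>F s in nhds t. flat p s = poly p (1 / s) * exp (- (1 / s))"
      using eventually_nhds_in_open[of "{0<..}" t] 1 by (auto elim!: eventually_mono simp: flat_def)
    ultimately show ?thesis by (subst DERIV_cong_ev[OF refl _ refl])
  next
    case 2
    have "\<forall>\<^sub>F s in nhds t. flat p s = 0"
      using eventually_nhds_in_open[of "{..<0}" t] 2 by (auto elim!: eventually_mono simp: flat_def)
    then show ?thesis using 2 by (subst DERIV_cong_ev[OF refl _ refl]) (auto simp: flat_def)
  next
    case 3
    have "((\<lambda>h. flat p h / h) \<longlongrightarrow> 0) (at_right 0)"
    proof (rule Lim_transform_eventually)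
      have inv: "filterlim (\<lambda>h::real. 1 / h) at_top (at_right 0)"
        using filterlim_inverse_at_top_right by (simp add: inverse_eq_divide)
      show "((\<lambda>h. poly ([:0, 1:] * p) (1 / h) * exp (- (1 / h))) \<longlongrightarrow> 0) (at_right 0)"
        by (rule filterlim_compose[OF tendsto_poly_mult_exp_minus inv])
      show "\<forall>\<^sub>F h in at_right 0. poly ([:0, 1:] * p) (1 / h) * exp (- (1 / h)) = flat p h / h"
        using eventually_at_right_less[of "0::real"] by eventually_elim (simp add: flat_def)
    qed
    moreover have "((\<lambda>h. flat p h / h) \<longlongrightarrow> 0) (at_left 0)"
    proof (rule Lim_transform_eventually[OF tendsto_const])
      show "\<forall>\<^sub>F h in at_left 0. 0 = flat p h / h"
        using eventually_at_left_real[of "-1" "0::real"] by (auto elim!: eventually_mono simp: flat_def)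
    qed
    ultimately have "((\<lambda>h. flat p h / h) \<longlongrightarrow> 0) (at 0)" by (simp add: filterlim_at_split)
    then show ?thesis unfolding 3 by (simp add: DERIV_def flat_def[of _ 0])
  qed
qed

text \<open>An algebra of functions closed under directional derivatives, so that smoothness of its
  members follows by induction on the order, without a general calculus for
  \<open>C_k_on\<close>.\<close>

inductive flat_alg :: "('a::euclidean_space \<Rightarrow> complex) \<Rightarrow> bool" where
  const: "flat_alg (\<lambda>x. c)"
| flat: "flat_alg (\<lambda>x. complex_of_real (flat p (k + x \<bullet> v)))"
| add: "flat_alg f \<Longrightarrow> flat_alg g \<Longrightarrow> flat_alg (\<lambda>x. f x + g x)"
| mult: "flat_alg f \<Longrightarrow> flat_alg g \<Longrightarrow> flat_alg (\<lambda>x. f x * g x)"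

lemma flat_alg_derivative:
  fixes f :: "'a::euclidean_space \<Rightarrow> complex"
  assumes "flat_alg f"
  shows "\<exists>D. (\<forall>x. (f has_derivative D x) (at x)) \<and> (\<forall>v. flat_alg (\<lambda>x. D x v))"
  using assms
proof induction
  case (const c)
  show ?case by (intro exI[of _ "\<lambda>x v. 0"]) (auto intro: flat_alg.const)
next
  case (flat p k v)
  let ?q = "[:0, 0, 1:] * (p - pderiv p)"
  let ?D = "\<lambda>x w. complex_of_real (flat ?q (k + x \<bullet> v)) * complex_of_real (w \<bullet> v)"
  have "((\<lambda>x. complex_of_real (flat p (k + x \<bullet> v))) has_derivative ?D x) (at x)" for x
  proof -
    have inner: "((\<lambda>x. k + x \<bullet> v) has_derivative (\<lambda>w. w \<bullet> v)) (at x)"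
      by (auto intro!: derivative_eq_intros)
    have "(flat p has_derivative (\<lambda>h. flat ?q (k + x \<bullet> v) * h)) (at (k + x \<bullet> v))"
      using has_derivative_flat[of p "k + x \<bullet> v"] by (simp only: has_field_derivative_def)
    from has_derivative_compose[OF inner this]
    have "((\<lambda>x. flat p (k + x \<bullet> v)) has_derivative (\<lambda>w. flat ?q (k + x \<bullet> v) * (w \<bullet> v))) (at x)" .
    from has_derivative_of_real[OF this] show ?thesis by simp
  qed
  then show ?case
    by (intro exI[of _ ?D] conjI allI) (auto intro: flat_alg.flat flat_alg.const flat_alg.mult)
next
  case (add f g)
  then obtain Df Dg where D: "\<And>x. (f has_derivative Df x) (at x)" "\<And>v. flat_alg (\<lambda>x. Df x v)"
      "\<And>x. (g has_derivative Dg x) (at x)" "\<And>v. flat_alg (\<lambda>x. Dg x v)" by blast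
  show ?case
    by (intro exI[of _ "\<lambda>x v. Df x v + Dg x v"] conjI allI has_derivative_add flat_alg.add D)
next
  case (mult f g)
  then obtain Df Dg where D: "\<And>x. (f has_derivative Df x) (at x)" "\<And>v. flat_alg (\<lambda>x. Df x v)"
      "\<And>x. (g has_derivative Dg x) (at x)" "\<And>v. flat_alg (\<lambda>x. Dg x v)" by blast
  show ?case
    by (intro exI[of _ "\<lambda>x v. f x * Dg x v + Df x v * g x"] conjI allI has_derivative_mult
        flat_alg.add flat_alg.mult mult.hyps D)
qed

lemma flat_alg_C_k_on:
  fixes f :: "'a::euclidean_space \<Rightarrow> complex"
  shows "flat_alg f \<Longrightarrow> C_k_on k UNIV f"
proof (induction k arbitrary: f)
  case 0
  then obtain D where "\<And>x. (f has_derivative D x) (at x)" using flat_alg_derivative by blast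
  then show ?case by (auto intro!: continuous_at_imp_continuous_on has_derivative_continuous)
next
  case (Suc k)
  obtain D where D: "\<And>x. (f has_derivative D x) (at x)" "\<And>v. flat_alg (\<lambda>x. D x v)"
    using flat_alg_derivative[OF Suc.prems] by blast
  have "frechet_derivative f (at x) = D x" for x using frechet_derivative_at[OF D(1)] by simp
  moreover have "f differentiable_on UNIV" using D(1) by (auto simp: differentiable_on_def differentiable_def)
  ultimately show ?case using Suc.IH D(2) by simp
qed

lemma flat_alg_prod:
  assumes "finite I" "\<And>i. i \<in> I \<Longrightarrow> flat_alg (f i)"
  shows "flat_alg (\<lambda>x. \<Prod>i\<in>I. f i x)"
  using assms by (induction I rule: finite_induct) (auto intro: flat_alg.const flat_alg.mult)

text \<open>The shift by -1 keeps the support inside the box shrunk by \<open>1 / n\<close> on every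
  side, hence compact in the open box; as \<open>n\<close> grows the functions converge to the
  indicator of that box.\<close>

definition bump :: "'a::euclidean_space \<Rightarrow> 'a \<Rightarrow> nat \<Rightarrow> 'a \<Rightarrow> complex" where
  "bump a b n x = (\<Prod>i\<in>Basis. complex_of_real (flat 1 (real n * (x \<bullet> i - a \<bullet> i) - 1)) *
     complex_of_real (flat 1 (real n * (b \<bullet> i - x \<bullet> i) - 1)))"

lemma flat_bounds: "0 \<le> flat 1 t" "flat 1 t \<le> 1"
  by (auto simp: flat_def)

lemma smooth_on_bump: "smooth_on UNIV (bump a b n)"
proof -
  have "flat_alg (bump a b n)"
    unfolding bump_def[abs_def]
  proof (intro flat_alg_prod flat_alg.mult finite_Basis)
    fix i :: 'a
    have "flat_alg (\<lambda>x. complex_of_real (flat 1 ((- (real n * (a \<bullet> i)) - 1) + x \<bullet> (real n *\<^sub>R i))))"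
      by (rule flat_alg.flat)
    then show "flat_alg (\<lambda>x. complex_of_real (flat 1 (real n * (x \<bullet> i - a \<bullet> i) - 1)))"
      by (simp add: algebra_simps)
    have "flat_alg (\<lambda>x. complex_of_real (flat 1 ((real n * (b \<bullet> i) - 1) + x \<bullet> ((- real n) *\<^sub>R i))))"
      by (rule flat_alg.flat)
    then show "flat_alg (\<lambda>x. complex_of_real (flat 1 (real n * (b \<bullet> i - x \<bullet> i) - 1)))"
      by (simp add: algebra_simps)
  qed
  then show ?thesis unfolding smooth_on_def by (auto intro: flat_alg_C_k_on)
qed

lemma bump_nonzero:
  fixes a b x i :: "'a::euclidean_space"
  assumes "bump a b n x \<noteq> 0" "i \<in> Basis"
  shows "1 < real n * (x \<bullet> i - a \<bullet> i)" "1 < real n * (b \<bullet> i - x \<bullet> i)"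
proof -
  have "flat 1 (real n * (x \<bullet> i - a \<bullet> i) - 1) \<noteq> 0" "flat 1 (real n * (b \<bullet> i - x \<bullet> i) - 1) \<noteq> 0"
    using assms by (auto simp: bump_def)
  then show "1 < real n * (x \<bullet> i - a \<bullet> i)" "1 < real n * (b \<bullet> i - x \<bullet> i)"
    by (auto simp: flat_def split: if_splits)
qed

lemma norm_bump_le: "norm (bump a b n x) \<le> 1"
  unfolding bump_def prod_norm[symmetric] using flat_bounds
  by (intro prod_le_1) (auto simp: norm_mult intro!: mult_le_one)

lemma bump_eq_0:
  fixes a b x :: "'a::euclidean_space"
  shows "x \<notin> box a b \<Longrightarrow> bump a b n x = 0"
proof (rule ccontr)
  assume x: "x \<notin> box a b" "bump a b n x \<noteq> 0"
  have "a \<bullet> i < x \<bullet> i \<and> x \<bullet> i < b \<bullet> i" if "i \<in> Basis" for i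
  proof -
    have pos: "0 < c" if "1 < real n * c" for c :: real
    proof (rule ccontr)
      assume "\<not> 0 < c"
      then have "real n * c \<le> 0" by (intro mult_nonneg_nonpos) auto
      then show False using that by simp
    qed
    show ?thesis using pos[OF bump_nonzero(1)[OF x(2) that]] pos[OF bump_nonzero(2)[OF x(2) that]] by simp
  qed
  then show False using x(1) by (auto simp: mem_box)
qed

lemma bump_tendsto:
  fixes a b x :: "'a::euclidean_space"
  shows "(\<lambda>n. bump a b n x) \<longlonglongrightarrow> indicator (box a b) x"
proof (cases "x \<in> box a b")
  case True
  have lim: "(\<lambda>n. flat 1 (real n * c - 1)) \<longlonglongrightarrow> 1" if "0 < c" for c :: real
  proof (rule Lim_transform_eventually)
    have at: "filterlim (\<lambda>n. real n * c - 1) at_top sequentially" using that by real_asymp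
    have inv: "(\<lambda>n. 1 / (real n * c - 1)) \<longlonglongrightarrow> 0"
      by (rule tendsto_divide_0[OF tendsto_const filterlim_at_top_imp_at_infinity[OF at]])
    have "(\<lambda>n. exp (- (1 / (real n * c - 1)))) \<longlonglongrightarrow> exp (- 0)"
      by (intro tendsto_exp tendsto_minus inv)
    then show "(\<lambda>n. exp (- (1 / (real n * c - 1)))) \<longlonglongrightarrow> 1" by simp
    have "\<forall>\<^sub>F n in sequentially. 0 < real n * c - 1" using at unfolding filterlim_at_top_dense by (rule spec)
    then show "\<forall>\<^sub>F n in sequentially. exp (- (1 / (real n * c - 1))) = flat 1 (real n * c - 1)"
      by eventually_elim (simp add: flat_def)
  qed
  have "(\<lambda>n. bump a b n x) \<longlonglongrightarrow> (\<Prod>i\<in>(Basis :: 'a set). complex_of_real 1 * complex_of_real 1)"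
    unfolding bump_def using True
    by (intro tendsto_prod tendsto_mult tendsto_of_real lim) (auto simp: mem_box)
  then show ?thesis using True by simp
qed (simp add: bump_eq_0)

lemma bump_test_function:
  fixes a b :: "'a::euclidean_space"
  assumes \<Omega>: "box a b \<subseteq> \<Omega>" and n: "0 < n"
  shows "bump a b n \<in> test_functions \<Omega>"
proof -
  let ?S = "{x. bump a b n x \<noteq> 0}" and ?c = "cbox (a + (1 / n) *\<^sub>R One) (b - (1 / n) *\<^sub>R One)"
  have "?S \<subseteq> ?c"
  proof
    fix x assume "x \<in> ?S"
    then have x: "bump a b n x \<noteq> 0" by simp
    have "a \<bullet> i + 1 / n \<le> x \<bullet> i \<and> x \<bullet> i \<le> b \<bullet> i - 1 / n" if "i \<in> Basis" for i
      using bump_nonzero[OF x that] n by (auto simp: field_simps)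
    then show "x \<in> ?c" by (auto simp: mem_box inner_add_left inner_diff_left)
  qed
  then have sub: "closure ?S \<subseteq> ?c" by (rule closure_minimal) (rule closed_cbox)
  have "?c \<subseteq> box a b"
  proof
    fix x assume x: "x \<in> ?c"
    have pos: "0 < 1 / real n" using n by simp
    have "a \<bullet> i < x \<bullet> i \<and> x \<bullet> i < b \<bullet> i" if "i \<in> Basis" for i
    proof -
      have "a \<bullet> i + 1 / n \<le> x \<bullet> i \<and> x \<bullet> i \<le> b \<bullet> i - 1 / n"
        using x that by (auto simp: mem_box inner_add_left inner_diff_left)
      then show ?thesis using pos by linarith
    qed
    then show "x \<in> box a b" unfolding mem_box by blast
  qed
  moreover have "compact (closure ?S)"
    using sub compact_cbox bounded_subset[OF bounded_cbox] by (simp add: compact_eq_bounded_closed)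
  ultimately show ?thesis
    using sub \<Omega> smooth_on_bump by (auto simp: test_functions_def)
qed

text \<open>The positive and the negative part of \<open>g\<close> are densities of two finite
  measures that agree on the boxes, an intersection-stable generator, so the measures and their
  densities coincide.\<close>

lemma AE_eq_0_if_box_integrals:
  fixes g :: "'a::euclidean_space \<Rightarrow> real"
  assumes g: "integrable lborel g" and box: "\<And>a b. (LINT x|lborel. indicator (box a b) x * g x) = 0"
  shows "AE x in lborel. g x = 0"
proof -
  let ?p = "\<lambda>x. ennreal (g x)" and ?m = "\<lambda>x. ennreal (- g x)"
  have [measurable]: "g \<in> borel_measurable lborel" using g by auto
  have fin: "(\<integral>\<^sup>+x. ?p x \<partial>lborel) \<noteq> \<infinity>" "(\<integral>\<^sup>+x. ?m x \<partial>lborel) \<noteq> \<infinity>"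
    using g by (auto simp: real_integrable_def)
  have eq: "density lborel ?p = density lborel ?m"
  proof (rule measure_eqI_generator_eq)
    let ?E = "range (\<lambda>(a, b). box a b :: 'a set)"
    show "Int_stable ?E" by (auto simp: Int_stable_def box_Int_box)
    show "?E \<subseteq> Pow UNIV" by simp
    show "sets (density lborel ?p) = sigma_sets UNIV ?E" "sets (density lborel ?m) = sigma_sets UNIV ?E"
      by (simp_all add: borel_eq_box)
    show "range (\<lambda>n::nat. box (- (real n *\<^sub>R One)) (real n *\<^sub>R One) :: 'a set) \<subseteq> ?E" by auto
    show "(\<Union>n::nat. box (- (real n *\<^sub>R One)) (real n *\<^sub>R One) :: 'a set) = UNIV" by (rule UN_box_eq_UNIV)
    show "emeasure (density lborel ?p) (box (- (real n *\<^sub>R One)) (real n *\<^sub>R One)) \<noteq> \<infinity>" for n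
    proof -
      have "emeasure (density lborel ?p) (box (- (real n *\<^sub>R One)) (real n *\<^sub>R One))
          \<le> emeasure (density lborel ?p) UNIV" by (rule emeasure_mono) auto
      also have "\<dots> = (\<integral>\<^sup>+x. ?p x \<partial>lborel)" by (simp add: emeasure_density)
      finally show ?thesis using fin(1) by (auto simp: top_unique)
    qed
    fix X assume "X \<in> ?E"
    then obtain a b where X: "X = box a b" by auto
    have int: "integrable lborel (\<lambda>x. indicator X x * g x)"
      using integrable_real_mult_indicator[of X lborel g] g X by (simp add: mult.commute)
    have p: "emeasure (density lborel ?p) X = (\<integral>\<^sup>+x. ennreal (indicator X x * g x) \<partial>lborel)"
      using X by (subst emeasure_density) (auto intro!: nn_integral_cong simp: indicator_def)
    have m: "emeasure (density lborel ?m) X = (\<integral>\<^sup>+x. ennreal (- (indicator X x * g x)) \<partial>lborel)"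
      using X by (subst emeasure_density) (auto intro!: nn_integral_cong simp: indicator_def)
    have box0: "(LINT x|lborel. indicator X x * g x) = 0" unfolding X by (rule box)
    have eq_if: "I = J" if "enn2real I - enn2real J = 0" "I \<noteq> \<infinity>" "J \<noteq> \<infinity>" for I J :: ennreal
    proof -
      have "ennreal (enn2real I) = I" "ennreal (enn2real J) = J"
        using that(2,3) by (auto intro!: ennreal_enn2real simp: less_top)
      moreover have "enn2real I = enn2real J" using that(1) by simp
      ultimately show ?thesis by metis
    qed
    have "(\<integral>\<^sup>+x. ennreal (indicator X x * g x) \<partial>lborel) = (\<integral>\<^sup>+x. ennreal (- (indicator X x * g x)) \<partial>lborel)"
    proof (rule eq_if)
      show "enn2real (\<integral>\<^sup>+x. ennreal (indicator X x * g x) \<partial>lborel)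
          - enn2real (\<integral>\<^sup>+x. ennreal (- (indicator X x * g x)) \<partial>lborel) = 0"
        using box0 unfolding real_lebesgue_integral_def[OF int] .
      show "(\<integral>\<^sup>+x. ennreal (indicator X x * g x) \<partial>lborel) \<noteq> \<infinity>"
          "(\<integral>\<^sup>+x. ennreal (- (indicator X x * g x)) \<partial>lborel) \<noteq> \<infinity>"
        using int unfolding real_integrable_def by blast+
    qed
    then show "emeasure (density lborel ?p) X = emeasure (density lborel ?m) X" unfolding p m .
  qed
  have "AE x in lborel. ?p x = ?m x"
    using eq fin by (subst (asm) finite_density_unique) auto
  then show ?thesis
  proof (rule eventually_mono)
    fix x assume "ennreal (g x) = ennreal (- g x)"
    then show "g x = 0"
      by (cases "0 \<le> g x") (auto simp: ennreal_neg ennreal_eq_0_iff)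
  qed
qed

section \<open>The maximal operator\<close>

text \<open>Bump functions approximate indicators, so \<open>f\<close> integrates to 0 over every
  box inside \<Omega>. This forces \<open>f\<close> to vanish almost everywhere on each such box,
  and countably many of them cover \<Omega>.\<close>

lemma orthogonal_to_test_functions_imp_0:
  fixes u :: "'a::euclidean_space L2"
  assumes \<Omega>: "open \<Omega>" "bounded \<Omega>" and u: "u \<in> L2_on \<Omega>"
    and orth: "\<And>\<phi>. \<phi> \<in> test_functions \<Omega> \<Longrightarrow> cinner (abs_L2 \<phi>) u = 0"
  shows "u = 0"
proof -
  obtain f where f: "square_integrable f" "u = abs_L2 f" by (rule L2_rep)
  have [measurable]: "f \<in> borel_measurable lborel" using f(1) by (simp add: square_integrable_def)
  have cnj_meas: "(\<lambda>x. cnj (f x)) \<in> borel_measurable lborel"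
    by (rule borel_measurable_continuous_on[of cnj]) (auto intro!: continuous_intros)
  have sq: "integrable lborel (\<lambda>x. (norm (f x))\<^sup>2)" using f(1) by (simp add: square_integrable_def)
  have f0: "AE x in lborel. x \<notin> \<Omega> \<longrightarrow> f x = 0" using u by (simp add: L2_on_def f vanishes_outside_abs_L2)
  have smooth_meas: "bump a b n \<in> borel_measurable lborel" for a b :: 'a and n
  proof -
    have "continuous_on UNIV (bump a b n)"
      using smooth_on_bump[of a b n] unfolding smooth_on_def by (metis C_k_on.simps(1))
    then show ?thesis by (simp add: borel_measurable_continuous_onI)
  qed
  \<comment> \<open>On a box, which has finite measure,
    \<open>norm (f x) \<le> 1 + (norm (f x))\<^sup>2\<close>. This majorant gives integrability of
    \<open>f\<close> there and dominates the bump approximations.\<close>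
  have bdd_box: "\<exists>w. integrable lborel w \<and> (\<forall>x. 0 \<le> w x) \<and> (\<forall>x\<in>box a b. norm (f x) \<le> w x)" for a b :: 'a
  proof (intro exI conjI allI ballI)
    show "integrable lborel (\<lambda>x. indicator (box a b) x + (norm (f x))\<^sup>2)"
      by (intro Bochner_Integration.integrable_add sq) (auto simp: emeasure_lborel_box_eq)
    show "norm (f x) \<le> indicator (box a b) x + (norm (f x))\<^sup>2" if "x \<in> box a b" for x
    proof -
      have "norm (f x) \<le> 1 + (norm (f x))\<^sup>2"
        using sum_squares_bound[of 1 "norm (f x)"] norm_ge_zero[of "f x"] unfolding mult_1_right power_one by linarith
      then show ?thesis using that by simp
    qed
  qed auto
  have box_int: "integrable lborel (\<lambda>x. indicator (box a b) x * f x)" for a b :: 'a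
  proof -
    obtain w where w: "integrable lborel w" "\<forall>x. 0 \<le> w x" "\<forall>x\<in>box a b. norm (f x) \<le> w x" using bdd_box by blast
    show ?thesis
    proof (rule Bochner_Integration.integrable_bound[OF w(1)])
      show "(\<lambda>x. indicator (box a b) x * f x) \<in> borel_measurable lborel"
        by (intro borel_measurable_times borel_measurable_indicator) simp_all
      have "norm (indicator (box a b) x * f x) \<le> norm (w x)" for x
        using w(2)[rule_format, of x] w(3)[rule_format, of x] by (cases "x \<in> box a b") simp_all
      then show "AE x in lborel. norm (indicator (box a b) x * f x) \<le> norm (w x)" by simp
    qed
  qed
  have box0: "(LINT x|lborel. indicator (box a b) x * f x) = 0" if ab: "box a b \<subseteq> \<Omega>" for a b
  proof -
    obtain w where w: "integrable lborel w" "\<forall>x. 0 \<le> w x" "\<forall>x\<in>box a b. norm (f x) \<le> w x" using bdd_box by blast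
    have "(\<lambda>n. LINT x|lborel. bump a b n x * cnj (f x)) \<longlonglongrightarrow> (LINT x|lborel. indicator (box a b) x * cnj (f x))"
    proof (rule integral_dominated_convergence)
      show "(\<lambda>x. bump a b n x * cnj (f x)) \<in> borel_measurable lborel" for n
        by (intro borel_measurable_times smooth_meas cnj_meas)
      show "AE x in lborel. (\<lambda>n. bump a b n x * cnj (f x)) \<longlonglongrightarrow> indicator (box a b) x * cnj (f x)"
        by (intro always_eventually allI tendsto_mult tendsto_const bump_tendsto)
      show "AE x in lborel. norm (bump a b n x * cnj (f x)) \<le> w x" for n
      proof (intro always_eventually allI)
        fix x show "norm (bump a b n x * cnj (f x)) \<le> w x"
        proof (cases "x \<in> box a b")
          case True
          have "norm (bump a b n x) * norm (f x) \<le> 1 * w x"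
            using w(3) True norm_bump_le[of a b n x] by (intro mult_mono) auto
          then show ?thesis by (simp add: norm_mult)
        qed (use w(2) in \<open>simp add: bump_eq_0\<close>)
      qed
    next
      show "(\<lambda>x. indicator (box a b) x * cnj (f x)) \<in> borel_measurable lborel"
        by (intro borel_measurable_times borel_measurable_indicator cnj_meas) simp
    qed (rule w(1))
    moreover have "\<forall>\<^sub>F n in sequentially. (LINT x|lborel. bump a b n x * cnj (f x)) = 0"
      using eventually_gt_at_top[of "0::nat"]
    proof eventually_elim
      case (elim n)
      have "square_integrable (bump a b n)" unfolding square_integrable_def
      proof
        show "integrable lborel (\<lambda>x. (norm (bump a b n x))\<^sup>2)"
        proof (rule Bochner_Integration.integrable_bound)
          show "integrable lborel (indicator (box a b) :: 'a \<Rightarrow> real)" by (auto simp: emeasure_lborel_box_eq)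
          have "(norm (bump a b n x))\<^sup>2 \<le> indicator (box a b) x" for x
            using norm_bump_le[of a b n x] by (cases "x \<in> box a b") (simp_all add: bump_eq_0 power_le_one)
          then show "AE x in lborel. norm ((norm (bump a b n x))\<^sup>2) \<le> norm (indicator (box a b) x :: real)" by simp
        qed (use smooth_meas[of a b n] in measurable)
      qed (rule smooth_meas)
      then show ?case
        using orth[OF bump_test_function[OF ab elim]] f by (simp add: cinner_abs_L2)
    qed
    then have "(\<lambda>n. LINT x|lborel. bump a b n x * cnj (f x)) \<longlonglongrightarrow> 0" by (rule tendsto_eventually)
    ultimately have "(LINT x|lborel. indicator (box a b) x * cnj (f x)) = 0" by (rule LIMSEQ_unique)
    moreover have "(\<lambda>x. indicator (box a b) x * cnj (f x)) = (\<lambda>x. cnj (indicator (box a b) x * f x))"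
      by (rule ext) (simp add: indicator_def)
    ultimately have "cnj (LINT x|lborel. indicator (box a b) x * f x) = 0" by (simp only: Bochner_Integration.integral_cnj)
    then show ?thesis by simp
  qed
  \<comment> \<open>The criterion for vanishing asks about all boxes, while \<open>box0\<close>
    covers only those inside \<Omega>. Cutting \<open>f\<close> off to one such box suffices,
    because the intersection of two boxes is a box.\<close>
  have box_ae: "AE x in lborel. x \<in> box c d \<longrightarrow> f x = 0" if cd: "box c d \<subseteq> \<Omega>" for c d
  proof -
    let ?g = "\<lambda>x. indicator (box c d) x * f x"
    have zero: "(LINT x|lborel. complex_of_real (indicator (box a b) x) * ?g x) = 0" for a b
    proof -
      obtain a' b' where ab': "box a b \<inter> box c d = box a' b'" by (rule that[OF box_Int_box])
      have eq: "(\<lambda>x. complex_of_real (indicator (box a b) x) * ?g x) = (\<lambda>x. indicator (box a' b') x * f x)"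
        unfolding ab'[symmetric] by (rule ext) (simp add: indicator_def)
      show ?thesis unfolding eq using ab' cd by (intro box0) blast
    qed
    have int: "integrable lborel (\<lambda>x. complex_of_real (indicator (box a b) x) * ?g x)" for a b
    proof -
      obtain a' b' where ab': "box a b \<inter> box c d = box a' b'" by (rule that[OF box_Int_box])
      have eq: "(\<lambda>x. complex_of_real (indicator (box a b) x) * ?g x) = (\<lambda>x. indicator (box a' b') x * f x)"
        unfolding ab'[symmetric] by (rule ext) (simp add: indicator_def)
      show ?thesis unfolding eq by (rule box_int)
    qed
    have "AE x in lborel. Re (?g x) = 0"
    proof (rule AE_eq_0_if_box_integrals)
      show "integrable lborel (\<lambda>x. Re (?g x))" using box_int by (rule integrable_Re)
      fix a b
      have "(LINT x|lborel. indicator (box a b) x * Re (?g x)) = (LINT x|lborel. Re (complex_of_real (indicator (box a b) x) * ?g x))"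
        by simp
      also have "\<dots> = Re (LINT x|lborel. complex_of_real (indicator (box a b) x) * ?g x)" by (rule integral_Re[OF int])
      finally show "(LINT x|lborel. indicator (box a b) x * Re (?g x)) = 0" by (simp only: zero zero_complex.sel)
    qed
    moreover have "AE x in lborel. Im (?g x) = 0"
    proof (rule AE_eq_0_if_box_integrals)
      show "integrable lborel (\<lambda>x. Im (?g x))" using box_int by (rule integrable_Im)
      fix a b
      have "(LINT x|lborel. indicator (box a b) x * Im (?g x)) = (LINT x|lborel. Im (complex_of_real (indicator (box a b) x) * ?g x))"
        by simp
      also have "\<dots> = Im (LINT x|lborel. complex_of_real (indicator (box a b) x) * ?g x)" by (rule integral_Im[OF int])
      finally show "(LINT x|lborel. indicator (box a b) x * Im (?g x)) = 0" by (simp only: zero zero_complex.sel)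
    qed
    ultimately show ?thesis by eventually_elim (rule impI, simp add: complex_eq_iff)
  qed
  obtain \<D> where D: "countable \<D>" "\<D> \<subseteq> Pow \<Omega>" "\<And>X. X \<in> \<D> \<Longrightarrow> \<exists>a b. X = box a b" "\<Union>\<D> = \<Omega>"
    by (rule open_countable_Union_open_box[OF \<Omega>(1)]) blast
  have "AE x in lborel. \<forall>X\<in>\<D>. x \<in> X \<longrightarrow> f x = 0"
  proof (rule AE_ball_countable[OF D(1), THEN iffD2], intro ballI)
    fix X assume X: "X \<in> \<D>"
    then obtain a b where "X = box a b" using D(3) by blast
    then show "AE x in lborel. x \<in> X \<longrightarrow> f x = 0" using box_ae[of a b] D(2) X by auto
  qed
  with f0 have "AE x in lborel. f x = 0"
    by eventually_elim (use D(4) in blast)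
  then have "abs_L2 f = abs_L2 (\<lambda>x. 0)" by (intro abs_L2_eqI f(1) square_integrable_zero)
  then show ?thesis by (simp add: f(2) zero_L2_def)
qed

lemma maximal_operator_add:
  assumes "open \<Omega>" "(x, y) \<in> maximal_operator \<Omega>" "(x', y') \<in> maximal_operator \<Omega>"
  shows "(x + x', y + y') \<in> maximal_operator \<Omega>"
proof -
  interpret hilbert_subspace "L2_on \<Omega>" by (rule hilbert_subspace_L2_on[OF assms(1)])
  show ?thesis using assms(2,3) unfolding maximal_operator_def adjoint_operator_def
    by (force simp: add_mem cinner_add_right)
qed

lemma maximal_operator_scaleC:
  assumes "open \<Omega>" "(x, y) \<in> maximal_operator \<Omega>"
  shows "(c *\<^sub>C x, c *\<^sub>C y) \<in> maximal_operator \<Omega>"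
proof -
  interpret hilbert_subspace "L2_on \<Omega>" by (rule hilbert_subspace_L2_on[OF assms(1)])
  show ?thesis using assms(2) unfolding maximal_operator_def adjoint_operator_def
    by (force simp: scaleC_mem cinner_scaleC_right)
qed

lemma linear_operator_maximal:
  fixes \<Omega> :: "'a::euclidean_space set"
  assumes \<Omega>: "open \<Omega>" "bounded \<Omega>"
  shows "linear_operator (L2_on \<Omega>) (maximal_operator \<Omega>)"
proof -
  interpret hilbert_subspace "L2_on \<Omega>" by (rule hilbert_subspace_L2_on[OF \<Omega>(1)])
  have sub: "maximal_operator \<Omega> \<subseteq> L2_on \<Omega> \<times> L2_on \<Omega>"
    unfolding maximal_operator_def adjoint_operator_def by blast
  have zero: "(0, 0) \<in> maximal_operator \<Omega>"
    unfolding maximal_operator_def adjoint_operator_def using zero_mem by auto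
  have "single_valued (maximal_operator \<Omega>)"
  proof (rule single_valuedI)
    fix x y z assume xy: "(x, y) \<in> maximal_operator \<Omega>" "(x, z) \<in> maximal_operator \<Omega>"
    \<comment> \<open>Subtracting the two pairs puts 0 in the first component, and membership in the
      adjoint then says exactly that \<open>y - z\<close> is orthogonal to all test
      functions.\<close>
    have "(x + (-1) *\<^sub>C x, y + (-1) *\<^sub>C z) \<in> maximal_operator \<Omega>"
      by (intro maximal_operator_add maximal_operator_scaleC \<Omega>(1) xy)
    then have yz: "(0, y - z) \<in> maximal_operator \<Omega>" by (simp add: scaleC.minus_left)
    have "y - z = 0"
    proof (rule orthogonal_to_test_functions_imp_0[OF \<Omega>])
      show "y - z \<in> L2_on \<Omega>" using subsetD[OF sub yz] by simp
      fix \<phi> assume "\<phi> \<in> test_functions \<Omega>"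
      then have mem: "(abs_L2 \<phi>, abs_L2 (\<lambda>x. - laplacian \<phi> x)) \<in> minimal_operator \<Omega>"
        unfolding minimal_operator_def by (intro subsetD[OF closure_subset] CollectI exI[of _ \<phi>]) simp
      have "\<forall>(u, v)\<in>minimal_operator \<Omega>. cinner v 0 = cinner u (y - z)"
        using yz by (simp add: maximal_operator_def adjoint_operator_def)
      from bspec[OF this mem] show "cinner (abs_L2 \<phi>) (y - z) = 0" by (simp add: cinner.zero_right)
    qed
    then show "y = z" by simp
  qed
  then show ?thesis
    unfolding linear_operator_def
    by (intro conjI allI impI sub zero) (auto intro: maximal_operator_add[OF \<Omega>(1)] maximal_operator_scaleC[OF \<Omega>(1)])
qed

theorem theorem3p1:
  fixes \<Omega> :: "(real ^ 'm) set"
    and L K L\<^sub>K :: "(real ^ 'm) L2 operator"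
    and \<alpha> a :: real
  assumes "bounded_smooth_domain \<Omega>"
    and "well_defined_restriction \<Omega> L"
    and "nonneg_operator (L2_on \<Omega>) (L\<inverse>)"
    and "compact_operator (L2_on \<Omega>) (L\<inverse>)"
    and "filterlim (\<lambda>n. real n ^ 2 * s_number (L2_on \<Omega>) (L\<inverse>) n) at_top sequentially"
    and "0 < \<alpha>" and "\<alpha> < 2" and "0 < a"
    and "(\<lambda>n. real n powr \<alpha> * s_number (L2_on \<Omega>) (L\<inverse>) n) \<longlonglongrightarrow> a"
    and "bounded_operator (L2_on \<Omega>) K"
    and "Range K \<subseteq> op_kernel (maximal_operator \<Omega>)"
    and "\<forall>q. 0 < q \<and> q \<le> 1 / \<alpha> \<longrightarrow> K \<in> schatten_class (L2_on \<Omega>) q"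
    and "L\<^sub>K\<inverse> = op_sum (L\<inverse>) K"
  shows "\<not> volterra_operator (L2_on \<Omega>) (L\<^sub>K\<inverse>) \<and>
    well_defined_restriction \<Omega> L\<^sub>K \<and> \<not> volterra_well_defined_operator (L2_on \<Omega>) L\<^sub>K"
proof -
  let ?H = "L2_on \<Omega>"
  have \<Omega>: "open \<Omega>" "bounded \<Omega>" using assms(1) by (simp_all add: bounded_smooth_domain_def)
  interpret hilbert_subspace ?H by (rule hilbert_subspace_L2_on[OF \<Omega>(1)])
  have "bounded_operator ?H (L\<inverse>)" using assms(4) by (simp add: compact_operator_def)
  then obtain A B\<^sub>A where A: "L\<inverse> = graph_on ?H A" "bounded_map ?H A B\<^sub>A" by (rule bounded_operator_imp_graph)
  interpret A: compact_map ?H A B\<^sub>A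
    using assms(4) A by (intro compact_operator_graph_imp_compact_map) simp_all
  obtain k B\<^sub>K where k: "K = graph_on ?H k" "bounded_map ?H k B\<^sub>K" using assms(10) by (rule bounded_operator_imp_graph)
  have schatten: "K \<in> schatten_class ?H q" if "0 < q" "q \<le> 1 / \<alpha>" for q using assms(12) that by blast
  have "compact_operator ?H K" using schatten[of "1 / \<alpha>"] assms(6) by (simp add: schatten_class_def)
  then interpret K: compact_map ?H k B\<^sub>K
    using k by (intro compact_operator_graph_imp_compact_map) simp_all
  have lim: "(\<lambda>n. real (Suc n) powr \<alpha> * A.sval n) \<longlonglongrightarrow> a"
    using LIMSEQ_Suc[OF assms(9)] unfolding A(1) A.s_number_eq_sval .
  have summ: "summable (\<lambda>j. K.sval j powr q)" if "0 < q" "q \<le> 1 / \<alpha>" for q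
  proof -
    have "summable (\<lambda>j. s_number ?H K (Suc j) powr q)" using schatten[OF that] by (simp add: schatten_class_def)
    then show ?thesis unfolding k(1) K.s_number_eq_sval .
  qed
  have L: "single_valued L" "(0, 0) \<in> L"
    using assms(2)
    by (simp_all add: well_defined_restriction_def well_defined_operator_def closed_operator_def linear_operator_def)
  have self_adjoint: "adjoint_operator ?H (graph_on ?H A) = graph_on ?H A"
    using assms(3) unfolding A(1) by (simp add: nonneg_operator_def self_adjoint_operator_def)
  interpret perturbed_positive ?H A B\<^sub>A k B\<^sub>K
  proof unfold_locales
    show "cinner (A x) y = cinner x (A y)" if "x \<in> ?H" "y \<in> ?H" for x y
    proof -
      have "(y, A y) \<in> adjoint_operator ?H (graph_on ?H A)" unfolding self_adjoint using that by simp
      then have "\<forall>(x, z)\<in>graph_on ?H A. cinner z y = cinner x (A y)" by (simp add: adjoint_operator_def)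
      then show ?thesis using that by simp
    qed
    show "0 \<le> Re (cinner (A x) x)" if "x \<in> ?H" for x
    proof -
      have "\<forall>(x, y)\<in>graph_on ?H A. cinner y x \<in> \<real>\<^sub>\<ge>\<^sub>0" using assms(3) unfolding A(1) by (simp add: nonneg_operator_def)
      then show ?thesis using that by (simp add: complex_nonneg_Reals_iff)
    qed
    show "x = 0" if "x \<in> ?H" "A x = 0" for x
    proof -
      have "(x, 0) \<in> L\<inverse>" unfolding A(1) using that by simp
      then have "(0, x) \<in> L" by simp
      then show ?thesis using single_valuedD[OF L(1) L(2)] by simp
    qed
    \<comment> \<open>The positive limit makes \<open>sval\<close> positive at arbitrarily large
      indices, and monotonicity carries this back to \<open>n\<close>.\<close>
    show "0 < A.sval n" for n
    proof -
      have "\<forall>\<^sub>F m in sequentially. 0 < real (Suc m) powr \<alpha> * A.sval m"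
        using order_tendstoD(1)[OF lim assms(8)] .
      moreover have "\<forall>\<^sub>F m in sequentially. n \<le> m" by (rule eventually_ge_at_top)
      ultimately obtain m where m: "0 < real (Suc m) powr \<alpha> * A.sval m" "n \<le> m"
        using eventually_happens'[OF sequentially_bot eventually_conj] by blast
      have "0 < A.sval m" using m(1) by (simp add: zero_less_mult_iff)
      also have "\<dots> \<le> A.sval n" by (rule decseqD[OF A.decseq_sval m(2)])
      finally show ?thesis .
    qed
  qed
  define V where "V x = A x + k x" for x
  interpret V: bounded_map ?H V "B\<^sub>A + B\<^sub>K"
  proof
    fix x y c assume x: "x \<in> ?H"
    show "V x \<in> ?H" unfolding V_def by (intro add_mem A.f_mem K.f_mem x)
    show "V (c *\<^sub>C x) = c *\<^sub>C V x" unfolding V_def using x by (simp add: A.f_scaleC K.f_scaleC scaleC_add_right)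
    show "norm (V x) \<le> (B\<^sub>A + B\<^sub>K) * norm x"
      unfolding V_def distrib_right using norm_triangle_le[OF add_mono[OF A.f_bound K.f_bound]] x by blast
    show "V (x + y) = V x + V y" if "y \<in> ?H" unfolding V_def using x that by (simp add: A.f_add K.f_add)
  qed
  have V: "L\<^sub>K\<inverse> = graph_on ?H V"
    unfolding assms(13) A(1) k(1) by (auto simp: op_sum_def V_def graph_on_def)
  have LK: "(x, y) \<in> L\<^sub>K \<longleftrightarrow> y \<in> ?H \<and> x = V y" for x y
  proof -
    have "(x, y) \<in> L\<^sub>K \<longleftrightarrow> (y, x) \<in> L\<^sub>K\<inverse>" by simp
    then show ?thesis unfolding V by simp
  qed
  obtain x z where xz: "x \<in> ?H" "x \<noteq> 0" "x = z *\<^sub>C V x"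
    using has_nonzero_eigenvalue[OF assms(6,7,8) lim summ] unfolding V_def by blast
  have z: "z \<noteq> 0" using xz(2,3) by auto
  have "(1 / z) *\<^sub>C x = (1 / z) *\<^sub>C z *\<^sub>C V x" using xz(3) by simp
  then have eig: "V x = (1 / z) *\<^sub>C x" using z by (simp add: scaleC_scaleC)
  \<comment> \<open>If the spectrum were \<open>{0}\<close>, the inverse relation of
    \<open>V - 1 / z\<close> would be single-valued; but it relates 0 both to the eigenvector
    \<open>x\<close> and to 0.\<close>
  have not_volterra: "\<not> volterra_operator ?H (L\<^sub>K\<inverse>)"
  proof
    assume "volterra_operator ?H (L\<^sub>K\<inverse>)"
    then have "operator_spectrum ?H (graph_on ?H V) = {0}" unfolding V by (simp add: volterra_operator_def)
    then have "1 / z \<notin> operator_spectrum ?H (graph_on ?H V)" using z by simp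
    then have sv: "single_valued ({(x, y - (1 / z) *\<^sub>C x) | x y. (x, y) \<in> graph_on ?H V}\<inverse>)"
      unfolding operator_spectrum_def bounded_operator_def linear_operator_def by simp
    have mem: "(V y - (1 / z) *\<^sub>C y, y) \<in> {(x, y - (1 / z) *\<^sub>C x) | x y. (x, y) \<in> graph_on ?H V}\<inverse>" if "y \<in> ?H" for y
      using that by auto
    have "(0, x) \<in> {(x, y - (1 / z) *\<^sub>C x) | x y. (x, y) \<in> graph_on ?H V}\<inverse>" using mem[OF xz(1)] by (simp add: eig)
    moreover have "(0, 0) \<in> {(x, y - (1 / z) *\<^sub>C x) | x y. (x, y) \<in> graph_on ?H V}\<inverse>"
      using mem[OF zero_mem] by (simp add: V.f_zero)
    ultimately show False using single_valuedD[OF sv] xz(2) by blast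
  qed
  have lin_max: "linear_operator ?H (maximal_operator \<Omega>)" by (rule linear_operator_maximal[OF \<Omega>])
  have sub: "L\<^sub>K \<subseteq> maximal_operator \<Omega>"
    using assms(2) by (intro Domain_perturbed_restriction(2)[OF lin_max _ assms(11,13)]) (simp add: well_defined_restriction_def)
  have "linear_operator ?H L\<^sub>K"
    unfolding linear_operator_def
  proof (intro conjI allI impI)
    show "L\<^sub>K \<subseteq> ?H \<times> ?H" using LK V.f_mem by auto
    \<comment> \<open>Injectivity of \<open>A + K\<close> is inherited from the maximal operator:
      \<open>L\<^sub>K\<close> is contained in a single-valued relation.\<close>
    show "single_valued L\<^sub>K"
      using lin_max unfolding linear_operator_def by (blast intro: single_valued_subset[OF sub])
  qed (auto simp: LK V.f_zero V.f_add V.f_scaleC zero_mem add_mem scaleC_mem)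
  moreover have "closed L\<^sub>K"
  proof (rule closed_sequential_limits[THEN iffD2], intro allI impI, elim conjE)
    fix X p assume X: "\<forall>n. X n \<in> L\<^sub>K" and lim: "X \<longlonglongrightarrow> p"
    have mem: "snd (X n) \<in> ?H" "fst (X n) = V (snd (X n))" for n
      using X[rule_format, of n] LK[of "fst (X n)" "snd (X n)"] by simp_all
    have snd: "(\<lambda>n. snd (X n)) \<longlonglongrightarrow> snd p" and fst: "(\<lambda>n. V (snd (X n))) \<longlonglongrightarrow> fst p"
      using tendsto_snd[OF lim] tendsto_fst[OF lim] by (simp_all add: mem(2))
    have p: "snd p \<in> ?H" by (rule closed_sequentially[OF closed mem(1) snd])
    have "fst p = V (snd p)" by (rule LIMSEQ_unique[OF fst V.f_tendsto[OF snd mem(1) p]])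
    then have "(fst p, snd p) \<in> L\<^sub>K" using p LK by blast
    then show "p \<in> L\<^sub>K" by simp
  qed
  moreover have "bounded_operator ?H (L\<^sub>K\<inverse>)"
    unfolding V bounded_operator_def
  proof (intro conjI exI)
    show "linear_operator ?H (graph_on ?H V)" by (rule V.linear_operator_graph)
    show "Domain (graph_on ?H V) = ?H" by (auto simp: graph_on_def)
    show "\<forall>(x, y)\<in>graph_on ?H V. norm y \<le> (B\<^sub>A + B\<^sub>K) * norm x" by (simp add: V.f_bound)
  qed
  ultimately have "well_defined_restriction \<Omega> L\<^sub>K"
    using sub by (simp add: well_defined_restriction_def well_defined_operator_def closed_operator_def)
  then show ?thesis using not_volterra by (simp add: volterra_well_defined_operator_def)
qed

end
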